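(* Let $n \geq 4$ be an integer. There is no recurrent infinite word over an $n$-letter alphabet with exactly $n$ Abelian factors of each length $m \geq 1$.
   Context: An infinite word over a finite alphabet $\Sigma$ is a sequence $w = w_0w_1w_2\cdots$ with $w_i \in \Sigma$ for $i = 0,1,2,\ldots$. A factor of $w$ is a finite block of consecutive letters $w_iw_{i+1}\cdots w_{j}$ of $w$. The word $w$ is recurrent if every factor of $w$ occurs infinitely often in $w$ (i.e. at infinitely many starting positions). For finite words $u,v \in \Sigma^*$, write $u \sim v$ if $u$ is an anagram of $v$ (each letter occurs the same number of times in $u$ as in $v$), and let $[u]$ denote the equivalence class of $u$ under $\sim$. If $u$ is a factor of $w$, then $[u]$ is called an Abelian factor of $w$; its length is the length of $u$. The number of Abelian factors of length $m$ is thus the number of distinct classes $[u]$ as $u$ ranges over the factors of $w$ of length $m$. *)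

theory Defs
  imports Main
begin

text \<open>
  An infinite word over \<open>\<Sigma>\<close> is a function \<open>w :: nat \<Rightarrow> 'a\<close> with \<open>range w \<subseteq> \<Sigma>\<close>.
\<close>

definition block :: "(nat \<Rightarrow> 'a) \<Rightarrow> nat \<Rightarrow> nat \<Rightarrow> 'a list" where
  "block w i m = map w [i..<i + m]"

definition is_factor :: "'a list \<Rightarrow> (nat \<Rightarrow> 'a) \<Rightarrow> bool" where
  "is_factor u w \<longleftrightarrow> (\<exists>i. block w i (length u) = u)"

definition recurrent :: "(nat \<Rightarrow> 'a) \<Rightarrow> bool" where
  "recurrent w \<longleftrightarrow> (\<forall>u. is_factor u w \<longrightarrow> infinite {i. block w i (length u) = u})"

definition anagram :: "('a list \<times> 'a list) set" where
  "anagram = {(u, v). \<forall>x. count_list u x = count_list v x}"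

lemma equiv_anagram: "equiv UNIV anagram"
  by (auto simp: anagram_def intro!: equivI refl_onI symI transI)

text \<open>
  The quotient consists of the full classes \<open>anagram `` {u}\<close>. An anagram of a word over \<open>\<Sigma>\<close>
  is again a word over \<open>\<Sigma>\<close>, so these are the classes taken in \<open>\<Sigma>\<^sup>*\<close>.
\<close>

definition abelian_factors :: "(nat \<Rightarrow> 'a) \<Rightarrow> nat \<Rightarrow> 'a list set set" where
  "abelian_factors w m = {u. is_factor u w \<and> length u = m} // anagram"

end

theory Submission
  imports Defs "HOL-Library.Multiset"
begin

text \<open>
  Call two windows of a word equivalent if they are anagrams; the classes are multisets. The
  proof rests on one inequality (\<open>card_wins_le\<close>): inside any stretch of the word, the
  number of classes of windows of length \<open>m\<close> is at most the number of letters of the stretch. For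
  every letter that is still missing produces a further class when it first appears afterwards,
  and distinct missing letters produce distinct classes, so a larger number of classes inside the
  stretch would exceed \<open>n\<close> in the end. Consequently a stretch that grows to the right has a
  small budget, called slack below: if it has \<open>k\<close> more letters than classes, then at
  most \<open>k\<close> times can a letter seen before complete a class not seen before
  (\<open>slack_event\<close>). With slack \<open>0\<close> the classes are frozen until a new letter arrives.

  For \<open>m = 2\<close> the classes are the edges of a connected graph with \<open>n\<close> vertices and \<open>n\<close> edges, that
  is, a graph with exactly one cycle, and the word is a walk in it. A run of new letters walks
  along a new branch and must turn back at its end. This turn costs one unit of slack for
  \<open>m = 3\<close> and one for \<open>m = 4\<close> (\<open>fresh_run_cost\<close>), and there is hardly any slack to
  spend, so near a suitable starting point the walk has only a few possible shapes. Each of them is refuted in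
  one of three ways: a budget is exceeded; the last few letters always determine the next one,
  so that the word would be eventually periodic and windows as long as a period would form one class
  (\<open>branching\<close>); or this holds after two letters are identified, and then windows as long as a
  period form at most three classes (\<open>merged_not_periodic\<close>).

  Suppose first that no letter is doubled. Some letter \<open>u\<close> occurs in a factor \<open>u v u\<close>
  (\<open>has_return\<close>), since otherwise the word would run around a cycle forever. From such a return one
  finds another one after which the walk reaches the cycle along a path of new letters, and the cycle turns out to be a triangle
  \<open>a b c\<close> (\<open>has_turn\<close>). If the triangle is reached along a path from \<open>d\<close>, the
  factor is \<open>d a b c a\<close>, and \<open>b\<close>, \<open>c\<close>, \<open>d\<close> or a new letter may follow (\<open>no_long_turn\<close>).
  Otherwise the factor is \<open>b a b c a\<close>, and the walk stays on the triangle until a new letter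
  appears, which has to happen as \<open>n \<ge> 4\<close> (\<open>no_short_turn\<close>).

  Now suppose that \<open>a a\<close> occurs. Then the cycle of the graph is the loop at \<open>a\<close>, and the rest is a tree.
  A branch of depth two is impossible (\<open>all_near\<close>), so the tree is a star and every
  other letter is surrounded by \<open>a\<close>. Deleting the letter \<open>a\<close> from the windows leaves at most
  \<open>n\<close> multisets. Windows slightly longer than the shortest block of \<open>a\<close> show all \<open>n - 1\<close>
  single letters and one pair. This leaves hardly any room for the other pairs of successive letters,
  and the one configuration that remains is determined by its past (\<open>star_impossible\<close>).
\<close>

section \<open>Counting letters against Abelian classes\<close>

text \<open>
  Anagram classes correspond to multisets; a window is the multiset of a block.
\<close>
definition win :: "(nat \<Rightarrow> 'a) \<Rightarrow> nat \<Rightarrow> nat \<Rightarrow> 'a multiset" where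
  "win w i m = mset (block w i m)"

lemma block_0: "block w i 0 = []"
  by (simp add: block_def)

lemma block_Suc: "block w i (Suc m) = w i # block w (Suc i) m"
  by (simp add: block_def upt_conv_Cons del: upt_Suc)

lemma win_Suc: "win w i (Suc m) = add_mset (w (i + m)) (win w i m)"
  by (simp add: win_def block_def)

lemma win_Suc_left: "win w i (Suc m) = add_mset (w i) (win w (Suc i) m)"
  by (simp add: win_def block_def upt_conv_Cons del: upt_Suc)

lemma win_0 [simp]: "win w i 0 = {#}"
  by (simp add: win_def block_def)

lemma set_mset_win: "set_mset (win w i m) = w ` {i..<i + m}"
  by (simp add: win_def block_def)

lemma size_win [simp]: "size (win w i m) = m"
  by (simp add: win_def block_def)

lemma win_1: "win w i 1 = {#w i#}"
  by (simp add: win_Suc_left)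

lemma win_2: "win w i 2 = {#w i, w (i + 1)#}"
  by (simp add: win_Suc_left numeral_eq_Suc)

lemma win_3: "win w i 3 = {#w i, w (i + 1), w (i + 2)#}"
  by (simp add: win_Suc_left numeral_eq_Suc)

lemma win_4: "win w i 4 = {#w i, w (i + 1), w (i + 2), w (i + 3)#}"
  by (simp add: win_Suc_left numeral_eq_Suc)

lemma image_mset_win: "image_mset f (win w i m) = win (f \<circ> w) i m"
  by (simp add: win_def block_def flip: mset_map)

lemma length_block [simp]: "length (block w i m) = m"
  by (simp add: block_def)

lemma block_eq_iff: "block w i m = block w j m \<longleftrightarrow> (\<forall>k<m. w (i + k) = w (j + k))"
  by (simp add: block_def list_eq_iff_nth_eq)

lemma card_abelian_factors:
  fixes w :: "nat \<Rightarrow> 'a"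
  shows "card (abelian_factors w m) = card (range (\<lambda>i. win w i m))"
proof -
  let ?cl = "\<lambda>M :: 'a multiset. {v. mset v = M}"
  have eq: "anagram `` {u} = ?cl (mset u)" for u :: "'a list"
    by (auto simp: anagram_def multiset_eq_iff count_mset)
  have "{u. is_factor u w \<and> length u = m} = range (\<lambda>i. block w i m)"
    by (auto simp: is_factor_def image_def) metis
  then have "abelian_factors w m = ?cl ` range (\<lambda>i. win w i m)"
    unfolding abelian_factors_def quotient_def by (auto simp: eq win_def)
  moreover have "inj ?cl"
  proof (rule injI)
    fix M N :: "'a multiset"
    assume e: "?cl M = ?cl N"
    obtain xs where "mset xs = M" by (metis ex_mset)
    then show "M = N" using e by blast
  qed
  ultimately show ?thesis by (metis card_image inj_on_subset subset_UNIV)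
qed

text \<open>
  A stretch of the word is given by its bounds as the half-open interval from \<open>s\<close> to \<open>t\<close>; a window
  belongs to it only if it lies inside entirely. A position \<open>k\<close> with \<open>w k \<notin> letters w s k\<close> is the
  first occurrence of its letter since \<open>s\<close>; such a letter is called fresh below.
\<close>
definition letters :: "(nat \<Rightarrow> 'a) \<Rightarrow> nat \<Rightarrow> nat \<Rightarrow> 'a set" where
  "letters w s t = w ` {s..<t}"

definition wins :: "(nat \<Rightarrow> 'a) \<Rightarrow> nat \<Rightarrow> nat \<Rightarrow> nat \<Rightarrow> 'a multiset set" where
  "wins w m s t = {win w i m |i. s \<le> i \<and> i + m \<le> t}"

lemma in_winsI: "s \<le> i \<Longrightarrow> i + m \<le> t \<Longrightarrow> win w i m \<in> wins w m s t"
  by (auto simp: wins_def)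

lemma in_winsE:
  assumes "x \<in> wins w m s t"
  obtains i where "s \<le> i" "i + m \<le> t" "x = win w i m"
  using assms by (auto simp: wins_def)

lemma letters_Suc: "s \<le> t \<Longrightarrow> letters w s (Suc t) = insert (w t) (letters w s t)"
  by (simp add: letters_def atLeastLessThanSuc)

lemma wins_extend:
  assumes "s \<le> i" shows "wins w (Suc r) s (Suc (i + r)) = insert (win w i (Suc r)) (wins w (Suc r) s (i + r))"
  using assms unfolding wins_def
  by (auto simp: le_Suc_eq)

lemma finite_letters [simp]: "finite (letters w s t)"
  by (simp add: letters_def)

lemma finite_wins [simp]: "finite (wins w m s t)"
proof -
  have "wins w m s t \<subseteq> (\<lambda>i. win w i m) ` {..t}" by (auto simp: wins_def)
  then show ?thesis using finite_surj by blast
qed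

lemma letters_mono: "t \<le> t' \<Longrightarrow> letters w s t \<subseteq> letters w s t'"
  by (auto simp: letters_def)

lemma wins_mono: "t \<le> t' \<Longrightarrow> wins w m s t \<subseteq> wins w m s t'"
  by (force simp: wins_def)

lemma in_letters_iff: "x \<in> letters w s t \<longleftrightarrow> (\<exists>k. s \<le> k \<and> k < t \<and> w k = x)"
  by (auto simp: letters_def)

lemma in_lettersI: "s \<le> k \<Longrightarrow> k < t \<Longrightarrow> w k \<in> letters w s t"
  by (auto simp: letters_def)

lemma win_mem_letters: "s \<le> i \<Longrightarrow> i + m \<le> t \<Longrightarrow> x \<in># win w i m \<Longrightarrow> x \<in> letters w s t"
  by (auto simp: set_mset_win letters_def)

locale const_word =
  fixes w :: "nat \<Rightarrow> 'a" and n :: nat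
  assumes rec: "recurrent w"
    and n4: "4 \<le> n"
    and card_range_win: "1 \<le> m \<Longrightarrow> card (range (\<lambda>i. win w i m)) = n"
begin

lemma recurs:
  obtains j where "T \<le> j" "\<And>k. k < m \<Longrightarrow> w (j + k) = w (i + k)"
proof -
  have "is_factor (block w i m) w"
    unfolding is_factor_def by auto
  then have "infinite {j. block w j m = block w i m}"
    using rec unfolding recurrent_def by fastforce
  then obtain j where "T \<le> j" "block w j m = block w i m"
    by (metis (mono_tags, lifting) finite_nat_set_iff_bounded linorder_not_less mem_Collect_eq)
  with that show thesis by (metis block_eq_iff)
qed

lemma recurs_win:
  obtains j where "T \<le> j" "win w j m = win w i m"
  by (metis recurs[of T m i] block_eq_iff win_def)

lemma finite_range_win: "1 \<le> m \<Longrightarrow> finite (range (\<lambda>i. win w i m))"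
  using card_range_win[of m] n4 by (metis card.infinite not_numeral_le_zero)

lemma card_range: "card (range w) = n"
proof -
  have "range (\<lambda>i. win w i 1) = (\<lambda>x. {#x#}) ` range w"
    by (auto simp: win_1 simp del: One_nat_def)
  then show ?thesis using card_range_win[of 1] by (simp add: card_image inj_on_def)
qed

lemma finite_range: "finite (range w)"
  using card_range n4 by (metis card.infinite not_numeral_le_zero)

text \<open>
  A missing letter \<open>x\<close> is assigned the window that ends with its first occurrence after \<open>t\<close>. These windows
  are pairwise different, and different from those of the stretch, as they contain missing letters.
\<close>
lemma card_wins_le:
  assumes st: "s + m \<le> t" and m: "1 \<le> m"
  shows "card (wins w m s t) \<le> card (letters w s t)"
proof -
  define F where "F = range w - letters w s t"
  define \<tau> where "\<tau> x = (LEAST i. t \<le> i \<and> w i = x)" for x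
  have \<tau>: "t \<le> \<tau> x \<and> w (\<tau> x) = x" if "x \<in> F" for x
  proof -
    from \<open>x \<in> F\<close> have "x \<in> range w" by (simp add: F_def)
    then obtain i where i: "w i = x" by blast
    obtain j where "t \<le> j" "\<And>k. k < 1 \<Longrightarrow> w (j + k) = w (i + k)" using recurs[of t 1 i] by blast
    then have "t \<le> j \<and> w j = x" using i by (metis add.right_neutral zero_less_one)
    then show ?thesis unfolding \<tau>_def by (rule LeastI)
  qed
  have before: "\<tau> x \<le> i" if "x \<in> F" "s \<le> i" "w i = x" for x i
  proof (cases "i < t")
    case True
    then have "x \<in> letters w s t" using that by (auto simp: letters_def)
    then show ?thesis using that F_def by blast
  next
    case False
    then show ?thesis unfolding \<tau>_def using that by (auto intro: Least_le)
  qed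
  (* This window ends with the first occurrence of x after t. Among the missing letters in it, x is the
     last one to appear, so x can be recovered from the window. *)
  define \<phi> where "\<phi> x = win w (Suc (\<tau> x) - m) m" for x
  have \<phi>: "x \<in># \<phi> x" "\<And>y. y \<in> F \<Longrightarrow> y \<in># \<phi> x \<Longrightarrow> \<tau> y \<le> \<tau> x" if "x \<in> F" for x
  proof -
    have r: "\<tau> x \<in> {Suc (\<tau> x) - m..<Suc (\<tau> x) - m + m}" using \<tau>[OF that] st m by auto
    have "w (\<tau> x) \<in> w ` {Suc (\<tau> x) - m..<Suc (\<tau> x) - m + m}" by (rule imageI[OF r])
    then show "x \<in># \<phi> x" unfolding \<phi>_def set_mset_win using \<tau>[OF that] by metis
    fix y assume y: "y \<in> F" "y \<in># \<phi> x"
    then obtain i where i: "i \<in> {Suc (\<tau> x) - m..<Suc (\<tau> x) - m + m}" "w i = y"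
      unfolding \<phi>_def set_mset_win by auto
    have "s \<le> i" "i \<le> \<tau> x" using i(1) \<tau>[OF that] st m by auto
    then show "\<tau> y \<le> \<tau> x" using before[OF y(1) _ i(2)] by simp
  qed
  have inj: "inj_on \<phi> F"
    by (rule inj_onI) (metis \<phi> \<tau> le_antisym)
  have "\<phi> ` F \<inter> wins w m s t = {}"
  proof (safe, goal_cases)
    case (1 x x')
    then show ?case using \<phi>(1)[of x'] by (metis DiffD2 F_def in_winsE win_mem_letters)
  qed
  moreover have "\<phi> ` F \<union> wins w m s t \<subseteq> range (\<lambda>i. win w i m)"
    by (auto simp: \<phi>_def wins_def)
  moreover have fF: "finite F" using finite_range F_def by simp
  ultimately have "card (\<phi> ` F) + card (wins w m s t) \<le> n"
    using card_mono[OF finite_range_win[OF m]] card_range_win[OF m]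
    by (metis card_Un_disjoint finite_imageI finite_wins)
  moreover have "card (\<phi> ` F) = n - card (letters w s t)"
    using inj card_range finite_range
    by (simp add: card_image F_def letters_def card_Diff_subset image_mono)
  moreover have "card (letters w s t) \<le> n"
    using card_range finite_range by (metis card_mono image_mono letters_def top_greatest)
  ultimately show ?thesis by linarith
qed

text \<open>
  By \<open>card_wins_le\<close> the classes never outnumber the letters, so \<open>k\<close> bounds how often the number of
  classes can still grow while the number of letters stays the same.
\<close>
definition slack :: "nat \<Rightarrow> nat \<Rightarrow> nat \<Rightarrow> nat \<Rightarrow> bool" where
  "slack m s t k \<longleftrightarrow> card (letters w s t) \<le> card (wins w m s t) + k"

text \<open>
  A fresh letter enlarges both cardinalities, since every window that contains it is new.
\<close>
lemma slack_step:
  assumes "slack (Suc r) s (i + r) k" "s \<le> i"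
  shows "slack (Suc r) s (Suc (i + r)) k"
proof (cases "w (i + r) \<in> letters w s (i + r)")
  case True
  then show ?thesis using assms card_mono[OF finite_wins wins_mono[of "i+r" "Suc (i + r)" w "Suc r" s]]
    by (auto simp: slack_def letters_Suc insert_absorb)
next
  case False
  have "win w i (Suc r) \<notin> wins w (Suc r) s (i + r)"
  proof
    assume "win w i (Suc r) \<in> wins w (Suc r) s (i + r)"
    moreover have "w (i + r) \<in># win w i (Suc r)" by (simp add: win_Suc)
    ultimately show False using False win_mem_letters by (metis in_winsE)
  qed
  then show ?thesis using assms False by (simp add: slack_def letters_Suc wins_extend)
qed

lemma slack_mono:
  assumes "slack m s t k" "s + m \<le> Suc t" "t \<le> t'" "1 \<le> m"
  shows "slack m s t' k"
  using assms(3)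
proof (induction t' rule: dec_induct)
  case base then show ?case using assms by simp
next
  case (step t')
  define r i where "r = m - 1" and "i = t' - r"
  have "m = Suc r" "t' = i + r" "s \<le> i" using assms step r_def i_def by auto
  then show ?case using slack_step step by metis
qed

lemma slack_event:
  assumes "slack (Suc r) s (i + r) k" "s < i" "w (i + r) \<in> letters w s (i + r)"
    "win w i (Suc r) \<notin> wins w (Suc r) s (i + r)"
  shows "0 < k \<and> slack (Suc r) s (Suc (i + r)) (k - 1)"
proof -
  have 1: "card (wins w (Suc r) s (Suc (i + r))) = Suc (card (wins w (Suc r) s (i + r)))"
    using assms by (simp add: wins_extend)
  have 2: "letters w s (Suc (i + r)) = letters w s (i + r)"
    using assms by (simp add: letters_Suc insert_absorb)
  have "card (wins w (Suc r) s (Suc (i + r))) \<le> card (letters w s (Suc (i + r)))"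
    using assms by (intro card_wins_le) auto
  with 1 2 assms(1) show ?thesis unfolding slack_def by (cases k) auto
qed

lemma slack_0_known:
  assumes "slack (Suc r) s t 0" "s + r < t" "t \<le> i + r" "w (i + r) \<in> letters w s (i + r)"
  shows "win w i (Suc r) \<in> wins w (Suc r) s (i + r)"
proof (rule ccontr)
  assume "\<not> ?thesis"
  moreover have "slack (Suc r) s (i + r) 0" using slack_mono[OF assms(1)] assms by auto
  ultimately show False using slack_event assms by fastforce
qed

end

section \<open>Non-periodicity and runs of new letters\<close>

text \<open>
  Windows of small length in the form that the simplifier reaches when numerals are unfolded into
  successors, with all positions written as successors of the first one.
\<close>
lemma win_nf:
  "win w i (Suc (Suc 0)) = {#w i, w (Suc i)#}"
  "win w i (Suc (Suc (Suc 0))) = {#w i, w (Suc i), w (Suc (Suc i))#}"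
  "win w i (Suc (Suc (Suc (Suc 0)))) = {#w i, w (Suc i), w (Suc (Suc i)), w (Suc (Suc (Suc i)))#}"
  by (simp_all add: win_Suc_left)

lemma pair_mset: "{#x, y#} = {#u, v#} \<longleftrightarrow> x = u \<and> y = v \<or> x = v \<and> y = u"
  by (auto simp: add_eq_conv_ex)

lemma win_periodic:
  assumes "\<And>i. T \<le> i \<Longrightarrow> g (i + N) = g i" "T \<le> i"
  shows "win g i N = win g T N"
  using assms(2)
proof (induction i rule: dec_induct)
  case (step i)
  have "add_mset (g i) (win g (Suc i) N) = add_mset (g (i + N)) (win g i N)"
    using win_Suc[of g i N] win_Suc_left[of g i N] by simp
  then have "win g (Suc i) N = win g i N" using assms(1)[OF step(1)] by simp
  then show ?case using step(3) by (rule trans)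
qed simp

text \<open>
  A class that contains a letter which is absent before position \<open>e\<close> can only be realised by windows reaching \<open>e\<close>.
\<close>
lemma wins_after:
  assumes "M \<in> wins w m s t" "c \<in># M" "c \<notin> letters w s e"
  shows "\<exists>i\<ge>s. i + m \<le> t \<and> e < i + m \<and> M = win w i m"
proof -
  obtain i where i: "s \<le> i" "i + m \<le> t" "M = win w i m" using assms(1) by (rule in_winsE)
  have "e < i + m"
  proof (rule ccontr)
    assume "\<not> e < i + m"
    then have "c \<in> letters w s e"
      using assms(2) i(3) by (intro win_mem_letters[OF i(1), of m e]) auto
    then show False using assms(3) by simp
  qed
  then show ?thesis using i by blast
qed

context const_word
begin

lemma letter_recurs:
  obtains j where "T \<le> j" "w j = w i"
  using recurs_win[of T 1 i] by (metis win_1 single_eq_single)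

lemma range_win_from: "range (\<lambda>i. win w i m) = (\<lambda>i. win w i m) ` {T..}"
proof (rule antisym)
  show "range (\<lambda>i. win w i m) \<subseteq> (\<lambda>i. win w i m) ` {T..}"
  proof
    fix M assume "M \<in> range (\<lambda>i. win w i m)"
    then obtain i where "M = win w i m" by blast
    moreover obtain j where "T \<le> j" "win w j m = win w i m" by (rule recurs_win)
    ultimately show "M \<in> (\<lambda>i. win w i m) ` {T..}" by (metis atLeast_iff imageI)
  qed
qed (rule image_mono, simp)

text \<open>
  Once all \<open>n\<close> letters have been seen without slack, the stretch shows \<open>n\<close> classes, which are all there are.
\<close>
lemma saturated:
  assumes "slack m s t 0" "1 \<le> m" "letters w s t = range w"
  shows "win w i m \<in> wins w m s t"
proof -
  have "n \<le> card (wins w m s t)" using assms card_range by (simp add: slack_def)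
  moreover have "wins w m s t \<subseteq> range (\<lambda>i. win w i m)" by (auto simp: wins_def)
  ultimately have "wins w m s t = range (\<lambda>i. win w i m)"
    using card_range_win[OF assms(2)] finite_range_win[OF assms(2)]
    by (simp add: card_seteq)
  then show ?thesis by auto
qed

text \<open>
  After \<open>c\<close> has been replaced by \<open>b\<close>, windows of length \<open>N\<close> are all equal, so a window is
  determined by the number of its \<open>c\<close>. Three values of this number give at most three classes, fewer than \<open>n\<close>.
\<close>
lemma merged_not_periodic:
  assumes per: "\<And>i. T \<le> i \<Longrightarrow> (if w (i + N) = c then b else w (i + N)) = (if w i = c then b else w i)"
    and N: "1 \<le> N" and cb: "c \<noteq> b"
    and cnt: "\<And>i. T \<le> i \<Longrightarrow> count (win w i N) c \<le> 2"
  shows False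
proof -
  define f where "f x = (if x = c then b else x)" for x
  have im: "image_mset f (win w i N) = image_mset f (win w T N)" if "T \<le> i" for i
    using win_periodic[of T "f \<circ> w" N i] per that by (simp add: image_mset_win f_def)
  have cim: "count (image_mset f M) x = (if x = c then 0 else if x = b then count M b + count M c else count M x)"
    for M x
    using cb by (induction M) (auto simp: f_def)
  have "inj_on (\<lambda>M. count M c) ((\<lambda>i. win w i N) ` {T..})"
  proof (rule inj_onI, clarsimp)
    fix i j assume ij: "T \<le> i" "T \<le> j" "count (win w i N) c = count (win w j N) c"
    have "count (image_mset f (win w i N)) x = count (image_mset f (win w j N)) x" for x
      using im ij by metis
    then have e: "(if x = c then 0 else if x = b then count (win w i N) b + count (win w i N) c else count (win w i N) x)
       = (if x = c then 0 else if x = b then count (win w j N) b + count (win w j N) c else count (win w j N) x)" for x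
      unfolding cim .
    show "win w i N = win w j N"
    proof (rule multiset_eqI)
      fix x show "count (win w i N) x = count (win w j N) x"
        using e[of x] ij(3) by (auto split: if_splits)
    qed
  qed
  moreover have "(\<lambda>M. count M c) ` (\<lambda>i. win w i N) ` {T..} \<subseteq> {..2}"
    using cnt by auto
  ultimately have "card ((\<lambda>i. win w i N) ` {T..}) \<le> card {..2::nat}"
    by (meson card_inj_on_le finite_atMost)
  then have "n \<le> 3" using card_range_win[OF N] range_win_from[of N T] by simp
  then show False using n4 by simp
qed

text \<open>
  Windows whose length is a period form a single class.
\<close>
lemma not_periodic:
  assumes "\<And>i. T \<le> i \<Longrightarrow> w (i + N) = w i" "1 \<le> N"
  shows False
proof -
  have "(\<lambda>i. win w i N) ` {T..} \<subseteq> {win w T N}"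
  proof (rule image_subsetI)
    fix i assume "i \<in> {T..}"
    then have "win w i N = win w T N" by (intro win_periodic assms(1)) simp_all
    then show "win w i N \<in> {win w T N}" by (simp only: singleton_iff)
  qed
  then have "card ((\<lambda>i. win w i N) ` {T..}) \<le> card {win w T N}"
    by (rule card_mono[rotated]) simp
  then have "n \<le> 1" using card_range_win[OF assms(2)] range_win_from[of N T] by simp
  then show False using n4 by simp
qed

text \<open>
  There are finitely many blocks of length \<open>k\<close>. If each of them determined the letter that follows it,
  the word would be eventually periodic.
\<close>
lemma branching:
  "\<exists>i j. T \<le> i \<and> T \<le> j \<and> (\<forall>l<k. w (i + l) = w (j + l)) \<and> w (i + k) \<noteq> w (j + k)"
proof (rule ccontr)
  assume "\<not> ?thesis"
  then have det: "w (i + k) = w (j + k)" if "T \<le> i" "T \<le> j" "\<And>l. l < k \<Longrightarrow> w (i + l) = w (j + l)" for i j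
    using that by blast
  have "finite (range (\<lambda>i. block w i k))"
    by (rule finite_subset[OF _ finite_lists_length_eq[OF finite_range, of k]])
      (auto simp: block_def)
  then have "finite ((\<lambda>i. block w i k) ` {T..})"
    by (rule finite_subset[OF image_mono[OF subset_UNIV]])
  then obtain B where B: "infinite {i \<in> {T..}. block w i k = B}"
    using pigeonhole_infinite[OF infinite_Ici] by blast
  obtain i where i: "T \<le> i" "block w i k = B"
    using infinite_imp_nonempty[OF B] by auto
  obtain j where j: "i < j" "block w j k = B"
  proof -
    have "infinite ({i \<in> {T..}. block w i k = B} - {..i})" using B by (simp add: Diff_infinite_finite)
    then have "{i \<in> {T..}. block w i k = B} - {..i} \<noteq> {}" by (rule infinite_imp_nonempty)
    then obtain j where "j \<in> {i \<in> {T..}. block w i k = B} - {..i}" by blast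
    then show thesis by (intro that[of j]) auto
  qed
  have eq: "w (i + l) = w (j + l)" for l
  proof (induction l rule: less_induct)
    case (less l)
    show ?case
    proof (cases "l < k")
      case True
      have "block w i k = block w j k" using i j by simp
      then show ?thesis using True by (simp add: block_eq_iff)
    next
      case False
      have "w (i + (l - k) + m) = w (j + (l - k) + m)" if "m < k" for m
        using less.IH[of "l - k + m"] that False by (simp add: add.assoc)
      then have "w (i + (l - k) + k) = w (j + (l - k) + k)"
        by (intro det) (use i j in auto)
      then show ?thesis using False by simp
    qed
  qed
  show False
  proof (rule not_periodic[of i "j - i"])
    fix x assume "i \<le> x"
    then show "w (x + (j - i)) = w x" using eq[of "x - i"] j(1) by (simp add: add.commute)
  qed (use j in auto)
qed

lemma next_fresh:
  assumes "letters w s t \<noteq> range w" "s \<le> t"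
  shows "\<exists>g\<ge>t. w g \<notin> letters w s g \<and> letters w s g = letters w s t"
proof -
  obtain i where i: "w i \<notin> letters w s t" using assms(1) by (auto simp: letters_def)
  have "\<exists>j\<ge>t. w j \<notin> letters w s t"
    by (rule letter_recurs[of t i]) (use i in metis)
  then obtain g where g: "t \<le> g \<and> w g \<notin> letters w s t" "\<forall>j<g. \<not> (t \<le> j \<and> w j \<notin> letters w s t)"
    using exists_least_iff[of "\<lambda>g. t \<le> g \<and> w g \<notin> letters w s t"] by blast
  have "letters w s g \<subseteq> letters w s t"
  proof
    fix x assume "x \<in> letters w s g"
    then obtain k where k: "s \<le> k" "k < g" "w k = x" by (auto simp: in_letters_iff)
    show "x \<in> letters w s t"
      by (cases "k < t") (use k g(2) in \<open>auto intro: in_lettersI\<close>)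
  qed
  moreover have "letters w s t \<subseteq> letters w s g" using g by (intro letters_mono) simp
  ultimately have "letters w s g = letters w s t" by (rule equalityI)
  then show ?thesis using g by auto
qed

lemma slack_init:
  assumes "card (letters w s (s + m)) \<le> Suc k"
  shows "slack m s (s + m) k"
proof -
  have "wins w m s (s + m) = {win w s m}" by (auto simp: wins_def)
  then show ?thesis using assms by (simp add: slack_def)
qed

lemma run_end:
  assumes "w g \<notin> letters w s g" "s \<le> g"
  obtains h where "g \<le> h" "\<And>k. g \<le> k \<Longrightarrow> k \<le> h \<Longrightarrow> w k \<notin> letters w s k" "w (Suc h) \<in> letters w s (Suc h)"
proof -
  have "\<exists>k. g \<le> k \<and> w k \<in> letters w s k"
  proof -
    obtain j where j: "Suc g \<le> j" "w j = w g" by (rule letter_recurs)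
    moreover have "w g \<in> letters w s j" using j(1) assms(2) by (intro in_lettersI) auto
    ultimately show ?thesis using j(1) by (intro exI[of _ j]) auto
  qed
  then obtain k where k: "g \<le> k \<and> w k \<in> letters w s k" "\<forall>i<k. \<not> (g \<le> i \<and> w i \<in> letters w s i)"
    using exists_least_iff[of "\<lambda>k. g \<le> k \<and> w k \<in> letters w s k"] by blast
  have "k \<noteq> g" using assms(1) k(1) by auto
  then have 1: "g \<le> k - 1" "Suc (k - 1) = k" using k(1) by auto
  show thesis
  proof (rule that[of "k - 1"])
    fix i assume "g \<le> i" "i \<le> k - 1"
    then have "i < k" using 1 by linarith
    then show "w i \<notin> letters w s i" using k(2) \<open>g \<le> i\<close> by blast
  next
    show "w (Suc (k - 1)) \<in> letters w s (Suc (k - 1))" using k(1) 1(2) by simp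
  qed (rule 1)
qed

text \<open>
  So far a fresh letter is contained in one pair only, the one with its predecessor. If the pair it forms
  with its successor is not new, the two pairs coincide.
\<close>
lemma fresh_turn:
  assumes f: "w h \<notin> letters w s h" and sh: "s + 2 \<le> h"
    and e: "win w h 2 \<in> wins w 2 s (Suc h)"
  shows "w (Suc h) = w (h - 1)"
proof -
  have "w h \<in># win w h 2" by (simp add: win_2)
  then obtain i where i: "s \<le> i" "i + 2 \<le> Suc h" "h < i + 2" "win w h 2 = win w i 2"
    using wins_after[OF e _ f] by blast
  have "i = h - 1" "Suc i = h" using sh i(2,3) by linarith+
  then show ?thesis using i(4) by (simp add: win_2)
qed

text \<open>
  The factor \<open>u y u\<close> around a fresh \<open>y\<close> completes a class unless the window before it is already \<open>{u, u, y}\<close>,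
  which takes a doubled \<open>u\<close>.
\<close>
lemma fresh_turn_new_class:
  assumes f: "w h \<notin> letters w s h" and sh: "s + 2 \<le> h"
    and t: "w (Suc h) = w (h - 1)" and ne: "w (h - 2) \<noteq> w (h - 1)"
  shows "win w (h - 1) 3 \<notin> wins w 3 s (Suc h)"
proof
  obtain k where k: "h = k + 2" using sh le_Suc_ex[of 2 h] by (metis add.commute add_leD2)
  assume e: "win w (h - 1) 3 \<in> wins w 3 s (Suc h)"
  have "w h \<in># win w (h - 1) 3" using k by (simp add: win_3)
  then obtain i where i: "s \<le> i" "i + 3 \<le> Suc h" "h < i + 3" "win w (h - 1) 3 = win w i 3"
    using wins_after[OF e _ f] by blast
  have "i = k" using k i(2,3) by linarith
  then show False using i(4) ne k t by (simp add: win_3)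
qed

lemma slack_old:
  assumes "slack 2 s t 0" "s + 2 \<le> t" "t \<le> i + 1" "w (i + 1) \<in> letters w s (i + 1)"
  shows "win w i 2 \<in> wins w 2 s (i + 1)"
  using slack_0_known[of 1 s t i] assms by (simp add: numeral_eq_Suc)

lemma slack_old_4:
  assumes "slack 4 s t 0" "s + 4 \<le> t" "t \<le> i + 3" "w (i + 3) \<in> letters w s (i + 3)"
  shows "win w i 4 \<in> wins w 4 s (i + 3)"
  using slack_0_known[of 3 s t i] assms by (simp add: numeral_eq_Suc)

lemma slack_event_3:
  assumes "slack 3 s t k" "s < i" "s + 2 \<le> t" "t \<le> i + 2" "w (i + 2) \<in> letters w s (i + 2)" "win w i 3 \<notin> wins w 3 s (i + 2)"
  shows "0 < k \<and> slack 3 s (i + 3) (k - 1)"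
proof -
  have "slack 3 s (i + 2) k" by (rule slack_mono[OF assms(1)]) (use assms in auto)
  then show ?thesis using slack_event[of 2 s i k] assms by (simp add: numeral_eq_Suc)
qed

lemma slack_event_4:
  assumes "slack 4 s t k" "s < i" "s + 3 \<le> t" "t \<le> i + 3" "w (i + 3) \<in> letters w s (i + 3)" "win w i 4 \<notin> wins w 4 s (i + 3)"
  shows "0 < k \<and> slack 4 s (i + 4) (k - 1)"
proof -
  have "slack 4 s (i + 3) k" by (rule slack_mono[OF assms(1)]) (use assms in auto)
  then show ?thesis using slack_event[of 3 s i k] assms by (simp add: numeral_eq_Suc)
qed

text \<open>
  With no slack for pairs, a run of fresh letters must end by stepping back over its last letter. The old
  letter that makes this step completes a new class of length 3 and a new class of length 4, and both
  must be paid for.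
\<close>
lemma fresh_run_cost:
  assumes s2: "slack 2 s (g + 3) 0" and sg: "s \<le> g" and fr: "w (g + 3) \<notin> letters w s (g + 3)"
    and ne: "w g \<noteq> w (g + 2)" "w (g + 1) \<noteq> w (g + 2)" and s3: "slack 3 s (g + 3) k3" and s4: "slack 4 s (g + 3) k4"
  shows "\<exists>h\<ge>g + 3. (\<forall>k. g + 3 \<le> k \<longrightarrow> k \<le> h \<longrightarrow> w k \<notin> letters w s k) \<and> w (h + 1) = w (h - 1) \<and>
    0 < k3 \<and> 0 < k4 \<and> slack 2 s (h + 2) 0 \<and> slack 3 s (h + 2) (k3 - 1) \<and> slack 4 s (h + 2) (k4 - 1)"
proof -
  obtain h where h: "g + 3 \<le> h" "\<And>k. g + 3 \<le> k \<Longrightarrow> k \<le> h \<Longrightarrow> w k \<notin> letters w s k" "w (Suc h) \<in> letters w s (Suc h)"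
    using run_end[OF fr] sg by auto
  define q where "q = h - 3"
  have q: "h = q + 3" "g \<le> q" using h(1) by (auto simp: q_def)
  have fh: "w h \<notin> letters w s h" using h(1,2) by simp
  have "win w h 2 \<in> wins w 2 s (h + 1)"
    by (rule slack_old[OF s2]) (use h sg in auto)
  then have t: "w (Suc h) = w (h - 1)" using fresh_turn[OF fh] h(1) sg by simp
  have ne': "w q \<noteq> w (q + 2)" "w (q + 1) \<noteq> w (q + 2)"
  proof -
    have "w (q + 2) \<notin> letters w s (q + 2)" if "q \<noteq> g" using h(2)[of "q + 2"] q that by simp
    moreover have "w q \<in> letters w s (q + 2)" "w (q + 1) \<in> letters w s (q + 2)" using q sg by (auto intro: in_lettersI)
    ultimately show "w q \<noteq> w (q + 2)" "w (q + 1) \<noteq> w (q + 2)" using ne by metis+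
  qed
  have "win w (h - 1) 3 \<notin> wins w 3 s (Suc h)"
    by (rule fresh_turn_new_class[OF fh _ t]) (use h(1) sg q ne' in \<open>auto simp: numeral_eq_Suc\<close>)
  then have 3: "0 < k3 \<and> slack 3 s (h + 2) (k3 - 1)"
    using slack_event_3[OF s3, of "q + 2"] h(3) q sg by (simp add: numeral_eq_Suc)
  have "win w (q + 1) 4 \<notin> wins w 4 s (Suc h)"
  proof
    assume a: "win w (q + 1) 4 \<in> wins w 4 s (Suc h)"
    have "w h \<in># win w (q + 1) 4" using q by (simp add: numeral_eq_Suc win_nf)
    then obtain i where i: "s \<le> i" "i + 4 \<le> Suc h" "h < i + 4" "win w (q + 1) 4 = win w i 4"
      using wins_after[OF a _ fh] by blast
    have "i = q" using q i(2,3) by linarith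
    then show False using i(4) ne' t q by (simp add: numeral_eq_Suc win_nf)
  qed
  then have 4: "0 < k4 \<and> slack 4 s (h + 2) (k4 - 1)"
    using slack_event_4[OF s4, of "q + 1"] h(3) q sg by (simp add: numeral_eq_Suc)
  have "slack 2 s (h + 2) 0" by (rule slack_mono[OF s2]) (use h(1) sg in auto)
  then show ?thesis using 3 4 h t by auto
qed

text \<open>
  The letters of a run are new, and its final step back leads to a letter of the run as well, unless
  the run consists of one letter only.
\<close>
lemma run_letters:
  assumes "\<And>k. g \<le> k \<Longrightarrow> k \<le> h \<Longrightarrow> w k \<notin> letters w s k" "w (h + 1) = w (h - 1)" "g \<le> h" "s \<le> g"
    and k: "g \<le> k" "k \<le> h + 1" "w k \<in> letters w s g"
  shows "h = g \<and> k = g + 1"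
proof -
  have fr: "w l \<notin> letters w s g" if "g \<le> l" "l \<le> h" for l
    using assms(1)[OF that] letters_mono[of g l w s] that(1) by blast
  have "k = h + 1" using fr[of k] k by force
  moreover have "h = g"
  proof (rule ccontr)
    assume "h \<noteq> g"
    then show False using fr[of "h - 1"] assms(2,3) k(3) \<open>k = h + 1\<close> by auto
  qed
  ultimately show ?thesis by simp
qed

end

locale loopless_word = const_word +
  assumes no_loop: "w i \<noteq> w (Suc i)"
begin

lemma fresh_turn_new:
  assumes "w h \<notin> letters w s h" "s + 2 \<le> h" "w (Suc h) = w (h - 1)"
  shows "win w (h - 1) 3 \<notin> wins w 3 s (Suc h)"
proof (rule fresh_turn_new_class[OF assms])
  have "Suc (h - 2) = h - 1" using assms(2) by simp
  then show "w (h - 2) \<noteq> w (h - 1)" using no_loop[of "h - 2"] by simp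
qed

text \<open>
  A further run of fresh letters would need slack for triples.
\<close>
lemma no_fresh:
  assumes "slack 2 s t 0" "slack 3 s t 0" "s + 3 \<le> t"
  shows "letters w s t = range w"
proof (rule ccontr)
  assume "letters w s t \<noteq> range w"
  then obtain g where g: "t \<le> g" "w g \<notin> letters w s g" using next_fresh[of s t] assms(3) by auto
  moreover have "s \<le> g" using g assms by simp
  ultimately obtain h where h: "g \<le> h" "\<And>k. g \<le> k \<Longrightarrow> k \<le> h \<Longrightarrow> w k \<notin> letters w s k"
    "w (Suc h) \<in> letters w s (Suc h)"
    using run_end by metis
  have f: "w h \<notin> letters w s h" using h by simp
  have th: "t \<le> h" using h g by simp
  have "win w h (Suc 1) \<in> wins w (Suc 1) s (h + 1)"
    by (rule slack_0_known[where t = t]) (use assms h th in \<open>auto simp: numeral_eq_Suc\<close>)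
  then have t: "w (Suc h) = w (h - 1)" using fresh_turn[OF f] assms th by (simp add: numeral_eq_Suc)
  have "win w (h - 1) (Suc 2) \<in> wins w (Suc 2) s (h - 1 + 2)"
    by (rule slack_0_known[where t = t]) (use assms h th in \<open>auto simp: numeral_eq_Suc\<close>)
  moreover have "h - 1 + 2 = Suc h" using th assms by simp
  ultimately show False using fresh_turn_new[OF f _ t] assms th by (simp add: numeral_eq_Suc)
qed

end

section \<open>Returns in words without doubled letters\<close>

lemma win_occ:
  assumes "c \<in># win w i m" "s \<le> i" "i + m \<le> t"
    and "\<And>k. s \<le> k \<Longrightarrow> k < t \<Longrightarrow> w k = c \<Longrightarrow> P k"
  shows "\<exists>k. P k \<and> i \<le> k \<and> k < i + m"
proof -
  obtain k where k: "i \<le> k" "k < i + m" "w k = c" using assms(1) by (auto simp: set_mset_win)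
  then have "P k" using assms(2,3) by (intro assms(4)) auto
  then show ?thesis using k by blast
qed

lemmas nf = numeral_eq_Suc win_nf pair_mset

context const_word
begin

text \<open>
  Within the stretch, \<open>v\<close> has no neighbours but \<open>l\<close> and \<open>r\<close>, and it is not entered and left on the same
  side: a walk that comes to \<open>v\<close> goes straight on. Since only classes are known, this is expressed by the pairs
  and triples that contain \<open>v\<close>. The case \<open>l = r\<close> describes the end of a branch.
\<close>
definition pass :: "nat \<Rightarrow> nat \<Rightarrow> 'a \<Rightarrow> 'a \<Rightarrow> 'a \<Rightarrow> bool" where
  "pass s t v l r \<longleftrightarrow> (\<forall>M\<in>wins w 2 s t. v \<in># M \<longrightarrow> M = {#l, v#} \<or> M = {#v, r#}) \<and>
     (l \<noteq> r \<longrightarrow> {#l, v, l#} \<notin> wins w 3 s t \<and> {#r, v, r#} \<notin> wins w 3 s t)"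

lemma pass_through:
  assumes "pass s t v l r" "w (i + 1) = v"
    and "win w i 2 \<in> wins w 2 s t" "win w (i + 1) 2 \<in> wins w 2 s t"
    and "w i = w (i + 2) \<Longrightarrow> win w i 3 \<in> wins w 3 s t"
  shows "w i = l \<and> w (i + 2) = r \<or> w i = r \<and> w (i + 2) = l"
proof -
  have "win w i 2 = {#l, v#} \<or> win w i 2 = {#v, r#}"
    using assms(1-3) by (auto simp: pass_def win_2)
  then have 1: "w i = l \<or> w i = r" using assms(2) by (auto simp: win_2 add_mset_eq_single)
  have "win w (i + 1) 2 = {#l, v#} \<or> win w (i + 1) 2 = {#v, r#}"
    using assms(1,2,4) by (auto simp: pass_def win_2)
  then have 2: "w (i + 2) = l \<or> w (i + 2) = r" using assms(2) by (auto simp: win_2)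
  show ?thesis
  proof (cases "w i = w (i + 2) \<and> l \<noteq> r")
    case True
    then have "{#w i, v, w i#} \<in> wins w 3 s t" using assms(2,5) by (simp add: win_3)
    then show ?thesis using True assms(1) 1 by (auto simp: pass_def)
  next
    case False
    then show ?thesis using 1 2 by auto
  qed
qed

lemma pass_single_local:
  assumes "s \<le> f" "f + 2 < t" "\<And>k. s \<le> k \<Longrightarrow> k < t \<Longrightarrow> w k = w (f + 1) \<Longrightarrow> k = f + 1"
    and nl: "\<And>k. s \<le> k \<Longrightarrow> k + 1 < t \<Longrightarrow> w k \<noteq> w (k + 1)"
  shows "pass s t (w (f + 1)) (w f) (w (f + 2))"
proof -
  have "M = {#w f, w (f + 1)#} \<or> M = {#w (f + 1), w (f + 2)#}"
    if M: "M \<in> wins w 2 s t" "w (f + 1) \<in># M" for M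
  proof -
    obtain i where i: "s \<le> i" "i + 2 \<le> t" "M = win w i 2" using M(1) by (rule in_winsE)
    have "i \<le> f + 1 \<and> f + 1 < i + 2"
      using win_occ[of "w (f + 1)" w i 2 s t "\<lambda>k. k = f + 1"] M(2) assms(3) unfolding i(3) using i(1,2) by blast
    then have "i = f + 1 \<or> i = f" by linarith
    then show ?thesis using i(3) by (auto simp: win_2)
  qed
  moreover have False if H: "w f \<noteq> w (f + 2)" "{#x, w (f + 1), x#} \<in> wins w 3 s t" "x = w f \<or> x = w (f + 2)" for x
  proof -
    obtain i where i: "s \<le> i" "i + 3 \<le> t" "{#x, w (f + 1), x#} = win w i 3" using H(2) by (rule in_winsE)
    have "w (f + 1) \<in># win w i 3" unfolding i(3)[symmetric] by simp
    then have "i \<le> f + 1 \<and> f + 1 < i + 3"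
      using win_occ[of "w (f + 1)" w i 3 s t "\<lambda>k. k = f + 1"] assms(3) i(1,2) by blast
    then consider "i = f + 1" | "i = f" | "i + 2 = f + 1" by linarith
    then show False
    proof cases
      case 1
      then show False using i(3) H(1,3) nl[of f] nl[of "f + 1"] nl[of "f + 2"] i(2) assms(1,2) by (auto simp: nf)
    next
      case 2
      then show False using i(3) H(1,3) by (auto simp: win_3)
    next
      case 3
      then have "f = i + 1" by simp
      then show False using i(3) H(1,3) nl[of i] nl[of "i + 1"] i(1) assms(1,2) by (auto simp: nf pair_mset)
    qed
  qed
  ultimately show ?thesis unfolding pass_def by blast
qed

lemma pass_end_local:
  assumes "s \<le> f" "w (f + 3) = w (f + 1)"
    "\<And>k. s \<le> k \<Longrightarrow> k < f + 4 \<Longrightarrow> w k = w (f + 1) \<Longrightarrow> k = f + 1 \<or> k = f + 3"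
    and nl: "\<And>k. s \<le> k \<Longrightarrow> k + 1 < f + 4 \<Longrightarrow> w k \<noteq> w (k + 1)"
  shows "pass s (f + 4) (w (f + 1)) (w f) (w (f + 2))"
proof -
  have "M = {#w f, w (f + 1)#} \<or> M = {#w (f + 1), w (f + 2)#}"
    if M: "M \<in> wins w 2 s (f + 4)" "w (f + 1) \<in># M" for M
  proof -
    obtain i where i: "s \<le> i" "i + 2 \<le> f + 4" "M = win w i 2" using M(1) by (rule in_winsE)
    obtain k where "k = f + 1 \<or> k = f + 3" "i \<le> k" "k < i + 2"
      using win_occ[of "w (f + 1)" w i 2 s "f + 4" "\<lambda>k. k = f + 1 \<or> k = f + 3"] M(2) assms(3) unfolding i(3) using i(1,2) by blast
    then have "i = f \<or> i = f + 1 \<or> i = f + 2" using i(2) by linarith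
    then show ?thesis using i(3) assms(2) by (auto simp: nf)
  qed
  moreover have False if H: "w f \<noteq> w (f + 2)" "{#x, w (f + 1), x#} \<in> wins w 3 s (f + 4)" "x = w f \<or> x = w (f + 2)" for x
  proof -
    obtain i where i: "s \<le> i" "i + 3 \<le> f + 4" "{#x, w (f + 1), x#} = win w i 3" using H(2) by (rule in_winsE)
    have "w (f + 1) \<in># win w i 3" unfolding i(3)[symmetric] by simp
    then obtain k where "k = f + 1 \<or> k = f + 3" "i \<le> k" "k < i + 3"
      using win_occ[of "w (f + 1)" w i 3 s "f + 4" "\<lambda>k. k = f + 1 \<or> k = f + 3"] assms(3) i(1,2) by blast
    then consider "f = i + 1" | "i = f" | "i = f + 1" using i(2) by linarith
    then show False
    proof cases
      case 1
      then show False using i(3) H(1,3) nl[of i] nl[of "i + 1"] i(1,2) by (auto simp: nf pair_mset)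
    next
      case 2
      then show False using i(3) H(1,3) by (auto simp: nf)
    next
      case 3
      then show False using i(3) H(1,3) assms(2) nl[of f] nl[of "f + 1"] assms(1) by (auto simp: nf)
    qed
  qed
  ultimately show ?thesis unfolding pass_def by blast
qed

text \<open>
  A run that turns back at its end is a branch: its inner letters have two neighbours each, and its
  last letter has one.
\<close>
lemma run_pass:
  assumes run: "\<And>k. g \<le> k \<Longrightarrow> k \<le> h \<Longrightarrow> w k \<notin> letters w s k" "w (h + 1) = w (h - 1)" and g: "s < g" "g \<le> h"
    and nl: "\<And>k. s \<le> k \<Longrightarrow> k + 1 < h + 2 \<Longrightarrow> w k \<noteq> w (k + 1)"
    and f: "g \<le> f" "f \<le> h"
  shows "\<exists>l r. pass s (h + 2) (w f) l r"
proof -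
  have uniq: "k = f \<or> k = h + 1 \<and> f = h - 1" if k: "s \<le> k" "k < h + 2" "w k = w f" for k
  proof -
    have le: "l = f" if l: "s \<le> l" "l \<le> h" "w l = w f" for l
    proof (cases l f rule: linorder_cases)
      case less
      then have "w l \<in> letters w s f" using l by (intro in_lettersI)
      then show ?thesis using run(1)[OF f] l(3) by simp
    next
      case greater
      then have "w f \<in> letters w s l" using f g by (intro in_lettersI) auto
      then show ?thesis using run(1)[of l] l f greater by simp
    qed simp
    show ?thesis
    proof (cases "k = h + 1")
      case True
      then have "h - 1 = f" using le[of "h - 1"] k run(2) g by simp
      then show ?thesis using True by simp
    next
      case False then show ?thesis using le[of k] k by simp
    qed
  qed
  obtain q where q: "f = q + 1" using f g by (cases f) auto
  show "\<exists>l r. pass s (h + 2) (w f) l r"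
  proof (cases "f = h - 1")
    case True
    then have h: "h = q + 2" using q f g by simp
    have "pass s (q + 4) (w (q + 1)) (w q) (w (q + 2))"
    proof (rule pass_end_local)
      fix k assume "s \<le> k" "k < q + 4" "w k = w (q + 1)"
      then show "k = q + 1 \<or> k = q + 3" using uniq[of k] q h by auto
    next
      fix k assume "s \<le> k" "k + 1 < q + 4"
      then show "w k \<noteq> w (k + 1)" using nl h by simp
    qed (use run(2) q h f g in \<open>auto simp: numeral_eq_Suc\<close>)
    then show ?thesis using q h by (auto simp: numeral_eq_Suc)
  next
    case False
    have "pass s (h + 2) (w (q + 1)) (w q) (w (q + 2))"
    proof (rule pass_single_local)
      fix k assume "s \<le> k" "k < h + 2" "w k = w (q + 1)"
      then show "k = q + 1" using uniq[of k] q False by auto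
    next
      fix k assume "s \<le> k" "k + 1 < h + 2"
      then show "w k \<noteq> w (k + 1)" by (rule nl)
    qed (use q f g in auto)
    then show ?thesis using q by auto
  qed
qed

end

context loopless_word
begin

text \<open>
  The letter before \<open>v\<close> determines the letter after it.
\<close>
definition plain :: "'a \<Rightarrow> bool" where
  "plain v \<longleftrightarrow> (\<forall>i j. w i = w j \<and> w (i + 1) = v \<and> w (j + 1) = v \<longrightarrow> w (i + 2) = w (j + 2))"

lemma pass_plain:
  assumes "pass s t v l r"
    and "\<And>i. win w i 2 \<in> wins w 2 s t"
    and "\<And>i. w i = w (i + 2) \<Longrightarrow> win w i 3 \<in> wins w 3 s t"
  shows "plain v"
  unfolding plain_def
proof (intro allI impI, elim conjE)
  fix i j assume ij: "w i = w j" "w (i + 1) = v" "w (j + 1) = v"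
  have "w i = l \<and> w (i + 2) = r \<or> w i = r \<and> w (i + 2) = l"
    "w j = l \<and> w (j + 2) = r \<or> w j = r \<and> w (j + 2) = l"
    by (rule pass_through[OF assms(1)]; use assms ij in blast)+
  then show "w (i + 2) = w (j + 2)" using ij(1) by auto
qed

lemma no_loop_shifted [simp]: "w i \<noteq> w (i + 1)" "w (i + 1) \<noteq> w i" "w (i + 1) \<noteq> w (i + 2)" "w (i + 2) \<noteq> w (i + 1)"
  "w (i + 2) \<noteq> w (i + 3)" "w (i + 3) \<noteq> w (i + 2)"
  by (simp_all add: numeral_eq_Suc no_loop no_loop[symmetric])

lemma pass_single:
  assumes "s \<le> f" "f + 2 < t" "\<And>k. s \<le> k \<Longrightarrow> k < t \<Longrightarrow> w k = w (f + 1) \<Longrightarrow> k = f + 1"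
  shows "pass s t (w (f + 1)) (w f) (w (f + 2))"
  by (rule pass_single_local[OF assms no_loop_shifted(1)])

lemma pass_start:
  assumes "s + 3 < t" "w (s + 2) = w s" "\<And>k. s \<le> k \<Longrightarrow> k < t \<Longrightarrow> w k = w s \<Longrightarrow> k = s \<or> k = s + 2"
  shows "pass s t (w s) (w (s + 1)) (w (s + 3))"
proof -
  have "M = {#w (s + 1), w s#} \<or> M = {#w s, w (s + 3)#}"
    if M: "M \<in> wins w 2 s t" "w s \<in># M" for M
  proof -
    obtain i where i: "s \<le> i" "i + 2 \<le> t" "M = win w i 2" using M(1) by (rule in_winsE)
    obtain k where "k = s \<or> k = s + 2" "i \<le> k" "k < i + 2"
      using win_occ[of "w s" w i 2 s t "\<lambda>k. k = s \<or> k = s + 2"] M(2) assms(3) unfolding i(3) using i(1,2) by blast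
    then have "i = s \<or> i = s + 1 \<or> i = s + 2" using i(1) by linarith
    then show ?thesis using i(3) assms(2) by (auto simp: nf)
  qed
  moreover have False if H: "w (s + 1) \<noteq> w (s + 3)" "{#x, w s, x#} \<in> wins w 3 s t" "x = w (s + 1) \<or> x = w (s + 3)" for x
  proof -
    obtain i where i: "s \<le> i" "i + 3 \<le> t" "{#x, w s, x#} = win w i 3" using H(2) by (rule in_winsE)
    have "w s \<in># win w i 3" unfolding i(3)[symmetric] by simp
    then obtain k where "k = s \<or> k = s + 2" "i \<le> k" "k < i + 3"
      using win_occ[of "w s" w i 3 s t "\<lambda>k. k = s \<or> k = s + 2"] assms(3) i(1,2) by blast
    then consider "i = s" | "i = s + 1" | "i = s + 2" using i(1) by linarith
    then show False
    proof cases
      case 1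
      then show False using i(3) H(1,3) assms(2) no_loop_shifted[of s] by (auto simp: nf pair_mset)
    next
      case 2
      then show False using i(3) H(1,3) assms(2) by (auto simp: nf)
    next
      case 3
      then show False using i(3) H(1,3) assms(2) no_loop_shifted[of s] no_loop_shifted[of "s + 2"] by (auto simp: nf)
    qed
  qed
  ultimately show ?thesis unfolding pass_def by blast
qed

lemma pass_end:
  assumes "s \<le> f" "w (f + 3) = w (f + 1)"
    "\<And>k. s \<le> k \<Longrightarrow> k < f + 4 \<Longrightarrow> w k = w (f + 1) \<Longrightarrow> k = f + 1 \<or> k = f + 3"
  shows "pass s (f + 4) (w (f + 1)) (w f) (w (f + 2))"
  by (rule pass_end_local[OF assms no_loop_shifted(1)])

text \<open>
  The stretch starts with \<open>u v u\<close>, which has a single pair, so that there is one unit of slack for pairs. The run of new letters after it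
  ends with a step to an old letter. Counting classes leaves only two possibilities: a step back over the last letter, or
  a step that closes a triangle.
\<close>
lemma return_run:
  assumes ret: "w (s + 2) = w s"
  shows "\<exists>e\<ge>s + 2. (\<forall>i j. s < i \<longrightarrow> i < j \<longrightarrow> j \<le> e \<longrightarrow> w i \<noteq> w j) \<and>
    (\<forall>k. s + 3 \<le> k \<longrightarrow> k \<le> e \<longrightarrow> w k \<notin> letters w s k) \<and>
    (w (e + 1) = w (e - 1) \<or> s + 3 \<le> e \<and> w (e + 1) = w (e - 2))"
proof -
  have sl2: "slack 2 s t 1" if "s + 2 \<le> t" for t
  proof (rule slack_mono[OF _ _ that])
    have "letters w s (s + 2) = {w s, w (s + 1)}" by (simp add: letters_Suc numeral_eq_Suc insert_commute) (simp add: letters_def)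
    then show "slack 2 s (s + 2) 1" by (intro slack_init) (simp add: card_insert_if)
  qed simp_all
  have sl3: "slack 3 s t 1" if "s + 3 \<le> t" for t
  proof (rule slack_mono[OF _ _ that])
    have "letters w s (s + 3) = {w s, w (s + 1)}" using ret by (simp add: letters_Suc numeral_eq_Suc insert_commute) (simp add: letters_def)
    then show "slack 3 s (s + 3) 1" by (intro slack_init) (simp add: card_insert_if)
  qed simp_all
  obtain e where e: "s + 2 \<le> e" "\<And>k. s + 3 \<le> k \<Longrightarrow> k \<le> e \<Longrightarrow> w k \<notin> letters w s k"
    "w (Suc e) \<in> letters w s (Suc e)"
  proof (cases "w (s + 3) \<in> letters w s (s + 3)")
    case True
    then show thesis by (intro that[of "s + 2"]) (auto simp: numeral_eq_Suc)
  next
    case False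
    obtain h where "s + 3 \<le> h" "\<And>k. s + 3 \<le> k \<Longrightarrow> k \<le> h \<Longrightarrow> w k \<notin> letters w s k" "w (Suc h) \<in> letters w s (Suc h)"
      using run_end[OF False] by auto
    then show thesis by (intro that[of h]) auto
  qed
  have dist: "w i \<noteq> w j" if "s < i" "i < j" "j \<le> e" for i j
  proof (cases "s + 3 \<le> j")
    case True
    have "w i \<in> letters w s j" using that by (intro in_lettersI) auto
    then show ?thesis using e(2)[OF True that(3)] by metis
  next
    case False
    then have "i = s + 1" "j = s + 2" using that by auto
    then show ?thesis using no_loop_shifted(3)[of s] by blast
  qed
  have "w (e + 1) = w (e - 1) \<or> s + 3 \<le> e \<and> w (e + 1) = w (e - 2)"
  proof (rule ccontr)
    assume neg: "\<not> ?thesis"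
    obtain k where k: "s \<le> k" "k < Suc e" "w k = w (Suc e)" using e(3) by (auto simp: in_letters_iff)
    obtain k where k: "s < k" "k \<le> e" "w k = w (Suc e)"
    proof (cases "k = s")
      case True then show thesis using that[of "s + 2"] k ret e(1) by simp
    next
      case False then show thesis using that[of k] k by simp
    qed
    have "k \<noteq> e" using k(3) no_loop[of e] by metis
    moreover have "k \<noteq> e - 1" using k(3) neg by auto
    moreover have "k \<noteq> e - 2 \<or> e < s + 3" using k(3) neg by auto
    ultimately have ke: "k + 3 \<le> e" using k(1,2) e(1) by linarith
    then have se: "s + 4 \<le> e" using k by simp
    have f: "w e \<notin> letters w s e" using e(2)[of e] se by simp
    obtain q where q: "e = q + 2" using se by (metis add.commute add_leD2 le_Suc_ex numeral_Bit0)
    have nk: "w (Suc e) \<noteq> w (q + 1)" "w (Suc e) \<noteq> w q" using neg q se by (auto simp: numeral_eq_Suc)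
    have "win w e 2 \<notin> wins w 2 s (Suc e)"
      using fresh_turn[OF f] nk q se by (auto simp: numeral_eq_Suc)
    then have s2: "slack 2 s (e + 2) 0"
      using slack_event[of 1 s e 1] sl2[of "e + 1"] e(3) se by (simp add: numeral_eq_Suc)
    have "win w (e - 1) 3 \<notin> wins w 3 s (Suc e)"
    proof
      assume a: "win w (e - 1) 3 \<in> wins w 3 s (Suc e)"
      have "w e \<in># win w (e - 1) 3" using q by (simp add: nf)
      then obtain i where i: "s \<le> i" "i + 3 \<le> Suc e" "e < i + 3" "win w (e - 1) 3 = win w i 3"
        using wins_after[OF a _ f] by blast
      have "i = q" using q i(2,3) by linarith
      then show False using i(4) nk q by (simp add: nf)
    qed
    then have s3: "slack 3 s (e + 2) 0"
      using slack_event[of 2 s "q + 1" 1] sl3[of "e + 1"] e(3) se q by (simp add: numeral_eq_Suc)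
    have old: "w (e + 2) \<in> letters w s (e + 2)"
      using no_fresh[OF s2 s3] se by simp
    have "win w (q + 2) (Suc 2) \<in> wins w (Suc 2) s (q + 2 + 2)"
      by (rule slack_0_known[where t = "e + 2"]) (use s3 old q se in \<open>auto simp: numeral_eq_Suc\<close>)
    then have a: "win w e 3 \<in> wins w 3 s (e + 2)" using q by (simp add: numeral_eq_Suc)
    have "w e \<in># win w e 3" by (simp add: win_3)
    then obtain i where i: "s \<le> i" "i + 3 \<le> e + 2" "e < i + 3" "win w e 3 = win w i 3"
      using wins_after[OF a _ f] by blast
    have "i = q \<or> i = q + 1" using i(2,3) q by linarith
    then have bk: "w (e + 2) = w (q + 1)"
    proof
      assume "i = q"
      then have "{#w (e + 1), w (e + 2)#} = {#w q, w (q + 1)#}" using i(4) q by (auto simp: nf)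
      then show ?thesis using nk by (auto simp: pair_mset)
    next
      assume "i = q + 1"
      then show ?thesis using i(4) q by (simp add: numeral_eq_Suc win_nf)
    qed
    have "win w (e + 1) (Suc 1) \<in> wins w (Suc 1) s (e + 1 + 1)"
      by (rule slack_0_known[where t = "e + 2"]) (use s2 old se in \<open>auto simp: numeral_eq_Suc\<close>)
    then have a: "{#w (q + 1), w (e + 1)#} \<in> wins w 2 s (e + 2)" using q bk by (simp add: nf add_mset_commute)
    have q1: "w (q + 1) \<notin> letters w s (q + 1)" using e(2)[of "q + 1"] q se by simp
    obtain i where i: "s \<le> i" "i + 2 \<le> e + 2" "q + 1 < i + 2" "{#w (q + 1), w (e + 1)#} = win w i 2"
      using wins_after[OF a _ q1] by auto
    have "i = q \<or> i = q + 1 \<or> i = q + 2" using i(2,3) q by linarith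
    moreover have "w (q + 1) \<noteq> w (q + 2)" "w (e + 1) \<noteq> w (q + 2)"
      using no_loop[of "q + 1"] no_loop[of "q + 2"] q by (simp_all add: numeral_eq_Suc)
    ultimately show False
      using i(4) nk q by (elim disjE) (simp_all add: win_2 pair_mset)
  qed
  then show ?thesis using e dist by auto
qed

text \<open>
  Otherwise any two successive letters determine the next one.
\<close>
lemma not_all_plain: "\<exists>i. \<not> plain (w i)"
proof -
  obtain i j where "\<And>l. l < 2 \<Longrightarrow> w (i + l) = w (j + l)" "w (i + 2) \<noteq> w (j + 2)"
    using branching[of 0 2] by blast
  then have "\<not> plain (w (i + 1))"
    unfolding plain_def by (metis add.right_neutral one_less_numeral_iff semiring_norm(76) zero_less_numeral)
  then show ?thesis by blast
qed

lemma first_run: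
  assumes d: "w s \<noteq> w (s + 2)"
  shows "\<exists>e\<ge>s + 2. (\<forall>i j. s \<le> i \<longrightarrow> i < j \<longrightarrow> j \<le> e \<longrightarrow> w i \<noteq> w j) \<and> w (e + 1) \<in> letters w s (e + 1)"
proof -
  obtain e where e: "s + 2 \<le> e" "\<And>k. s + 3 \<le> k \<Longrightarrow> k \<le> e \<Longrightarrow> w k \<notin> letters w s k"
    "w (Suc e) \<in> letters w s (Suc e)"
  proof (cases "w (s + 3) \<in> letters w s (s + 3)")
    case True
    then show thesis by (intro that[of "s + 2"]) (auto simp: numeral_eq_Suc)
  next
    case False
    obtain h where "s + 3 \<le> h" "\<And>k. s + 3 \<le> k \<Longrightarrow> k \<le> h \<Longrightarrow> w k \<notin> letters w s k" "w (Suc h) \<in> letters w s (Suc h)"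
      using run_end[OF False] by auto
    then show thesis by (intro that[of h]) auto
  qed
  have "w i \<noteq> w j" if "s \<le> i" "i < j" "j \<le> e" for i j
  proof (cases "s + 3 \<le> j")
    case True
    have "w i \<in> letters w s j" using that by (intro in_lettersI) auto
    then show ?thesis using e(2)[OF True that(3)] by metis
  next
    case False
    then have "i = s \<and> j = s + 1 \<or> i = s \<and> j = s + 2 \<or> i = s + 1 \<and> j = s + 2" using that by auto
    then show ?thesis using no_loop_shifted(1,3)[of s] d by blast
  qed
  then show ?thesis using e by auto
qed

text \<open>
  Without returns, the first repetition closes a cycle and uses up the slack for pairs. No letter can
  be missing then, since a new branch would need a return at its end, and every letter of the
  cycle is passed straight through.
\<close>
lemma has_return: "\<exists>i. w (i + 2) = w i"
proof (rule ccontr)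
  assume "\<not> ?thesis"
  then have nr: "w (i + 2) \<noteq> w i" for i by blast
  obtain e where e: "2 \<le> e" "\<And>i j. i < j \<Longrightarrow> j \<le> e \<Longrightarrow> w i \<noteq> w j" "w (e + 1) \<in> letters w 0 (e + 1)"
    using first_run[of 0] nr[of 0] by (metis add_0 le0)
  have turn: "win w h 2 \<notin> wins w 2 0 (Suc h)" if "w h \<notin> letters w 0 h" "2 \<le> h" for h
    using fresh_turn[OF that(1)] that(2) nr[of "h - 1"] by (auto simp: numeral_eq_Suc Suc_diff_Suc)
  have "slack 2 0 2 1" using slack_init[of 0 2 1] by (simp add: letters_def card_insert_if numeral_eq_Suc atLeastLessThanSuc)
  then have "slack 2 0 (e + 1) 1" using slack_mono e(1) by simp
  moreover have "w e \<notin> letters w 0 e" using e(2) by (fastforce simp: in_letters_iff)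
  ultimately have s2: "slack 2 0 (e + 2) 0"
    using slack_event[of 1 0 e 1] turn[of e] e(1,3) by (simp add: numeral_eq_Suc)
  have all: "letters w 0 (e + 2) = range w"
  proof (rule ccontr)
    assume "letters w 0 (e + 2) \<noteq> range w"
    then obtain g where g: "e + 2 \<le> g" "w g \<notin> letters w 0 g" using next_fresh[of 0 "e + 2"] by auto
    obtain h where h: "g \<le> h" "w h \<notin> letters w 0 h" "w (Suc h) \<in> letters w 0 (Suc h)"
      using run_end[OF g(2)] by (metis le_refl zero_le)
    have "win w h (Suc 1) \<in> wins w (Suc 1) 0 (h + 1)"
      by (rule slack_0_known[where t = "e + 2"]) (use s2 h g in \<open>auto simp: numeral_eq_Suc\<close>)
    then show False using turn[OF h(2)] h g by (simp add: numeral_eq_Suc)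
  qed
  have sat: "win w i 2 \<in> wins w 2 0 (e + 2)" for i
    by (rule saturated[OF s2 _ all]) simp
  have w0: "i = 0 \<or> i = e + 1 \<and> w (e + 1) = w 0" if "w i = w 0" "i < e + 2" for i
    using that e(2)[of 0 i] by (cases "i = 0"; cases "i = e + 1") auto
  have nb: "x = w 1 \<or> x = w e \<and> w (e + 1) = w 0" if edge: "{#w 0, x#} \<in> wins w 2 0 (e + 2)" for x
  proof -
    obtain i where i: "i + 2 \<le> e + 2" "{#w 0, x#} = win w i 2" using edge by (auto elim: in_winsE)
    then have "w i = w 0 \<and> w (i + 1) = x \<or> w (i + 1) = w 0 \<and> w i = x" by (auto simp: win_2 pair_mset)
    then show ?thesis using w0[of i] w0[of "i + 1"] i(1) by auto
  qed
  have nb': "w (i + 2) \<in> {w 1, w e} \<and> w i \<in> {w 1, w e} \<and> w (e + 1) = w 0" if "w (i + 1) = w 0" for i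
  proof -
    have "{#w 0, w i#} \<in> wins w 2 0 (e + 2)" "{#w 0, w (i + 2)#} \<in> wins w 2 0 (e + 2)"
      using sat[of i] sat[of "i + 1"] that by (simp_all add: nf add_mset_commute)
    then show ?thesis using nb[of "w i"] nb[of "w (i + 2)"] nr[of i] by auto
  qed
  have "plain (w f)" if "f \<le> e" for f
  proof (cases "f = 0")
    case True
    show ?thesis unfolding plain_def True
    proof (intro allI impI, elim conjE)
      fix i j assume "w i = w j" "w (i + 1) = w 0" "w (j + 1) = w 0"
      then show "w (i + 2) = w (j + 2)" using nb'[of i] nb'[of j] nr[of i] nr[of j] by auto
    qed
  next
    case False
    obtain x where x: "w x = w 0" "2 \<le> x" by (metis letter_recurs)
    then have "w (x - 1 + 1) = w 0" by simp
    then have close: "w (e + 1) = w 0" using nb' by blast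
    obtain q where q: "f = q + 1" using False by (cases f) auto
    have "pass 0 (e + 2) (w (q + 1)) (w q) (w (q + 2))"
    proof (rule pass_single)
      fix k assume k: "k < e + 2" "w k = w (q + 1)"
      show "k = q + 1"
        using k e(2)[of k "q + 1"] e(2)[of "q + 1" k] e(2)[of 0 "q + 1"] close that q
        by (cases "k = e + 1"; cases k "q + 1" rule: linorder_cases) auto
    qed (use that q in auto)
    then show ?thesis unfolding q by (rule pass_plain) (use sat nr in \<open>metis+\<close>)
  qed
  moreover obtain i where "\<not> plain (w i)" using not_all_plain by blast
  moreover have "w i \<in> letters w 0 (e + 2)" using all by simp
  then obtain f where "f \<le> e" "w f = w i"
  proof -
    obtain f where "f < e + 2" "w f = w i" using \<open>w i \<in> letters w 0 (e + 2)\<close> by (auto simp: in_letters_iff)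
    moreover obtain f' where "f' \<le> e" "w f' = w (e + 1)" using e(3) by (auto simp: in_letters_iff less_Suc_eq_le)
    ultimately show thesis using that[of f] that[of f'] by (cases "f = e + 1") auto
  qed
  ultimately show False by metis
qed

end

section \<open>Turning around a triangle\<close>

context loopless_word
begin

text \<open>
  Between two returns without repetition the walk runs along a path, and its two ends are the only letters
  where it turns.
\<close>
lemma path_pass:
  assumes se: "s + 2 \<le> e" and ret: "w (s + 2) = w s" "w (e + 1) = w (e - 1)"
    and dist: "\<And>i j. s < i \<Longrightarrow> i < j \<Longrightarrow> j \<le> e \<Longrightarrow> w i \<noteq> w j"
    and f: "s < f" "f \<le> e"
  shows "\<exists>l r. pass s (e + 2) (w f) l r"
proof -
  have uniq: "w i = w j \<longleftrightarrow> i = j" if "s < i" "i \<le> e" "s < j" "j \<le> e" for i j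
    using dist[of i j] dist[of j i] that by (cases i j rule: linorder_cases) auto
  have occ: "k = f \<or> k = s \<and> f = s + 2 \<or> k = e + 1 \<and> f = e - 1" if H: "s \<le> k" "k < e + 2" "w k = w f" for k
  proof -
    consider "k = s" | "k = e + 1" | "s < k" "k \<le> e" using H by linarith
    then show ?thesis
    proof cases
      case 1 then show ?thesis using uniq[of "s + 2" f] H ret se f by auto
    next
      case 2 then show ?thesis using uniq[of "e - 1" f] H ret se f by auto
    next
      case 3 then show ?thesis using uniq[of k f] H f by auto
    qed
  qed
  obtain q where q: "f = q + 1" using f by (cases f) auto
  consider "e = s + 2" | "e = s + 3" "f = s + 2" | "e \<ge> s + 4" "f = s + 2" | "e \<ge> s + 4" "f = e - 1"
    | "f \<noteq> s + 2" "f \<noteq> e - 1"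
    using f se by linarith
  then show ?thesis
  proof cases
    case 1
    have "M = {#w s, w (s + 1)#}" if H: "M \<in> wins w 2 s (e + 2)" for M
    proof -
      obtain i where i: "s \<le> i" "i + 2 \<le> e + 2" "M = win w i 2" using H by (rule in_winsE)
      then have "i = s \<or> i = s + 1 \<or> i = s + 2" using 1 by linarith
      then show ?thesis using i(3) ret 1 by (auto simp: nf)
    qed
    moreover have "f = s + 1 \<or> f = s + 2" using 1 f by linarith
    ultimately have "pass s (e + 2) (w f) (w (f - 1)) (w (f - 1))"
      using ret 1 by (auto simp: pass_def pair_mset)
    then show ?thesis by blast
  next
    case 2
    have "M = {#w (s + 1), w f#} \<or> M = {#w f, w (s + 3)#}" if H: "M \<in> wins w 2 s (e + 2)" for M
    proof -
      obtain i where i: "s \<le> i" "i + 2 \<le> e + 2" "M = win w i 2" using H by (rule in_winsE)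
      then have "i = s \<or> i = s + 1 \<or> i = s + 2 \<or> i = s + 3" using 2 by linarith
      then show ?thesis using i(3) ret 2 by (auto simp: nf)
    qed
    moreover have "{#x, w f, x#} \<notin> wins w 3 s (e + 2)" if x: "x = w (s + 1) \<or> x = w (s + 3)" for x
    proof
      assume "{#x, w f, x#} \<in> wins w 3 s (e + 2)"
      then obtain i where i: "s \<le> i" "i + 3 \<le> e + 2" "{#x, w f, x#} = win w i 3" by (rule in_winsE)
      then have "i = s \<or> i = s + 1 \<or> i = s + 2" using 2 by linarith
      then show False using i(3) ret 2 x uniq[of "s + 1" "s + 2"] uniq[of "s + 2" "s + 3"] uniq[of "s + 1" "s + 3"]
        by (auto simp: nf)
    qed
    ultimately have "pass s (e + 2) (w f) (w (s + 1)) (w (s + 3))"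
      unfolding pass_def by blast
    then show ?thesis by blast
  next
    case 3
    have "pass s (e + 2) (w s) (w (s + 1)) (w (s + 3))"
    proof (rule pass_start)
      fix k assume "s \<le> k" "k < e + 2" "w k = w s"
      then have "k = f \<or> k = s \<and> f = s + 2 \<or> k = e + 1 \<and> f = e - 1" using occ[of k] 3 ret by simp
      then show "k = s \<or> k = s + 2" using 3 by linarith
    qed (use 3 ret in auto)
    then show ?thesis using 3 ret by auto
  next
    case 4
    have "pass s (q + 4) (w (q + 1)) (w q) (w (q + 2))"
    proof (rule pass_end)
      fix k assume "s \<le> k" "k < q + 4" "w k = w (q + 1)"
      then have "k = f \<or> k = s \<and> f = s + 2 \<or> k = e + 1 \<and> f = e - 1" using occ[of k] 4 q by simp
      then show "k = q + 1 \<or> k = q + 3" using 4 q by linarith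
    next
      have h: "q + 3 = e + 1" "q + 1 = e - 1" using 4 q by simp_all
      show "w (q + 3) = w (q + 1)" unfolding h by (rule ret)
    qed (use q f in auto)
    moreover have "q + 4 = e + 2" using 4 q by simp
    ultimately show ?thesis unfolding q by auto
  next
    case 5
    have "pass s (e + 2) (w (q + 1)) (w q) (w (q + 2))"
      by (rule pass_single) (use 5 q f occ in auto)
    then show ?thesis using q by auto
  qed
qed

lemma letters_recur:
  assumes "\<And>t. T \<le> t \<Longrightarrow> letters w s t = L" "s \<le> T"
  shows "w i \<in> L"
proof -
  obtain j where "T \<le> j" "w j = w i" by (rule letter_recurs)
  then show ?thesis using assms(1)[of "Suc j"] assms(2) by (auto intro!: in_lettersI simp flip: \<open>w j = w i\<close>)
qed

lemma wins_recur:
  assumes "\<And>t. T \<le> t \<Longrightarrow> wins w m s t = K" "s \<le> T"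
  shows "win w i m \<in> K"
proof -
  obtain j where j: "T \<le> j" "win w j m = win w i m" by (rule recurs_win)
  have "win w j m \<in> wins w m s (j + m)" by (rule in_winsI) (use j assms in auto)
  then show ?thesis using assms(1)[of "j + m"] j by simp
qed

text \<open>
  A return at \<open>s\<close>, followed by distinct letters, the last three of which form a triangle that is closed at \<open>e + 1\<close>.
\<close>
definition turn :: "nat \<Rightarrow> nat \<Rightarrow> bool" where
  "turn s e \<longleftrightarrow> s + 3 \<le> e \<and> w (s + 2) = w s \<and> w (e + 1) = w (e - 2) \<and>
     (\<forall>i j. s < i \<longrightarrow> i < j \<longrightarrow> j \<le> e \<longrightarrow> w i \<noteq> w j)"

text \<open>
  If the run after a return is ended by another return, the walk goes to and fro on a path. It cannot do so
  forever, because all letters would be plain; the first new letter or pair closes a triangle, and the last return before it is the beginning of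
  the turn.
\<close>
lemma has_turn: "\<exists>s e. turn s e"
proof -
  obtain s where ret: "w (s + 2) = w s" using has_return by blast
  obtain e where e: "s + 2 \<le> e" "\<And>i j. s < i \<Longrightarrow> i < j \<Longrightarrow> j \<le> e \<Longrightarrow> w i \<noteq> w j"
    "\<And>k. s + 3 \<le> k \<Longrightarrow> k \<le> e \<Longrightarrow> w k \<notin> letters w s k"
    "w (e + 1) = w (e - 1) \<or> s + 3 \<le> e \<and> w (e + 1) = w (e - 2)"
    using return_run[OF ret] by auto
  show ?thesis
  proof (cases "w (e + 1) = w (e - 1)")
    case False
    then have "turn s e" using e ret by (auto simp: turn_def)
    then show ?thesis by blast
  next
    case eret: True
    define T where "T = e + 2"
    define L K2 K3 where "L = letters w s T" and "K2 = wins w 2 s T" and "K3 = wins w 3 s T"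
    have s3: "slack 3 s t 0" if "T \<le> t" for t
    proof -
      have "letters w s (s + 3) = {w s, w (s + 1)}" using ret by (simp add: letters_Suc numeral_eq_Suc insert_commute) (simp add: letters_def)
      then have "slack 3 s (s + 3) 1" by (intro slack_init) (simp add: card_insert_if)
      then have 1: "slack 3 s (e + 1) 1" by (rule slack_mono) (use e in auto)
      obtain q where q: "e = q + 1" using e(1) by (cases e) auto
      have "win w (e - 1) 3 \<notin> wins w 3 s (Suc e)"
      proof (cases "e = s + 2")
        case True
        have "M = win w s 3" if "M \<in> wins w 3 s (Suc e)" for M
          using that by (rule in_winsE) (use True in auto)
        moreover have "win w (e - 1) 3 \<noteq> win w s 3" using True ret eret no_loop[of s] by (auto simp: nf)
        ultimately show ?thesis by blast
      next
        case False
        then have "w e \<notin> letters w s e" using e by simp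
        then show ?thesis by (rule fresh_turn_new) (use e eret in auto)
      qed
      moreover have "w (e + 1) \<in> letters w s (e + 1)" unfolding eret by (rule in_lettersI) (use e in auto)
      ultimately have "slack 3 s (e + 2) 0"
        using slack_event[of 2 s q 1] 1 e(1) q by (simp add: numeral_eq_Suc)
      then show ?thesis by (rule slack_mono) (use e that T_def in auto)
    qed
    have occL: "\<exists>f. s < f \<and> f \<le> e \<and> w f = x" if H: "x \<in> L" for x
    proof -
      obtain k where k: "s \<le> k" "k < e + 2" "w k = x" using H by (auto simp: L_def T_def in_letters_iff)
      consider "k = s" | "k = e + 1" | "s < k" "k \<le> e" using k by linarith
      then show ?thesis
      proof cases
        case 1 then show ?thesis using k ret e(1) by (intro exI[of _ "s + 2"]) auto
      next
        case 2 then show ?thesis using k eret e(1) by (intro exI[of _ "e - 1"]) auto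
      next
        case 3 then show ?thesis using k by blast
      qed
    qed
    have pass: "\<exists>l r. pass s T x l r" if x: "x \<in> L" for x
    proof -
      obtain f where f: "s < f" "f \<le> e" "w f = x" using occL[OF x] by blast
      then show ?thesis using path_pass[OF e(1) ret eret e(2) f(1,2)] by (simp add: T_def)
    qed
    define stable where "stable t \<longleftrightarrow> letters w s t = L \<and> wins w 2 s t = K2 \<and> wins w 3 s t = K3" for t
    have sT: "stable T" by (simp add: stable_def L_def K2_def K3_def)
    have "\<exists>t\<ge>T. \<not> stable t"
    proof (rule ccontr)
      assume "\<not> ?thesis"
      then have st: "T \<le> t \<Longrightarrow> stable t" for t by blast
      have sT': "s \<le> T" using e(1) T_def by simp
      have L: "w i \<in> L" for i by (rule letters_recur[OF _ sT']) (use st stable_def in blast)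
      have 2: "win w i 2 \<in> wins w 2 s T" for i
        using wins_recur[OF _ sT', where m = 2 and K = K2] st unfolding stable_def K2_def by blast
      have 3: "win w i 3 \<in> wins w 3 s T" for i
        using wins_recur[OF _ sT', where m = 3 and K = K3] st unfolding stable_def K3_def by blast
      have "plain (w i)" for i
        using pass[OF L[of i]] pass_plain[of s T "w i"] 2 3 by blast
      then show False using not_all_plain by blast
    qed
    then obtain t where t: "T \<le> t \<and> \<not> stable t" "\<forall>i<t. \<not> (T \<le> i \<and> \<not> stable i)"
      using exists_least_iff[of "\<lambda>t. T \<le> t \<and> \<not> stable t"] by blast
    have "t \<noteq> T" using t sT by auto
    then obtain g where g: "t = Suc g" "T \<le> g" using t(1) by (cases t) auto
    have sg: "letters w s g = L" "wins w 2 s g = K2" "wins w 3 s g = K3" using t(2) g by (auto simp: stable_def)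
    define p where "p = g - 3"
    have p: "g = p + 3" "s < p" using g(2) e(1) by (auto simp: p_def T_def)
    have known2: "win w i 2 \<in> wins w 2 s T" if "s \<le> i" "i + 2 \<le> g" for i
      using in_winsI[OF that, where w = w] sg(2) by (simp add: K2_def)
    have known3: "win w i 3 \<in> wins w 3 s T" if "s \<le> i" "i + 3 \<le> g" for i
      using in_winsI[OF that, where w = w] sg(3) by (simp add: K3_def)
    have nst: "w g \<notin> letters w s g \<or> w g \<in> letters w s g \<and> win w (p + 2) 2 \<notin> K2"
    proof (rule ccontr)
      assume "\<not> ?thesis"
      then have a: "w g \<in> letters w s g" "win w (p + 2) 2 \<in> K2" by auto
      have "s \<le> g" using p by simp
      have "letters w s t = L"
        using letters_Suc[OF \<open>s \<le> g\<close>, of w] a(1) unfolding g(1) by (simp add: insert_absorb sg(1))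
      moreover have "wins w 2 s t = K2"
        using wins_extend[of s "p + 2" w 1] a(2) p(2) sg(2) unfolding g(1) p(1) by (simp add: numeral_eq_Suc insert_absorb)
      moreover have "win w (p + 1) (Suc 2) \<in> wins w (Suc 2) s (p + 1 + 2)"
        by (rule slack_0_known[where t = T]) (use s3[of T] a p g T_def e(1) in \<open>auto simp: numeral_eq_Suc\<close>)
      then have "wins w 3 s t = K3"
        using wins_extend[of s "p + 1" w 2] p(2) sg(3) unfolding g(1) p(1) by (simp add: numeral_eq_Suc insert_absorb)
      ultimately show False using t(1) by (simp add: stable_def)
    qed
    define R where "R z \<longleftrightarrow> z + 2 < g \<and> w (z + 2) = w z" for z
    have Re: "R (e - 1)" using eret e(1) g T_def by (simp add: R_def)
    define z where "z = (GREATEST z. R z)"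
    have bd: "\<And>y. R y \<Longrightarrow> y \<le> g" by (simp add: R_def)
    have z: "R z" "\<And>y. R y \<Longrightarrow> y \<le> z"
      unfolding z_def using GreatestI_nat[of R, OF Re bd] Greatest_le_nat[of R, OF _ bd] by blast+
    have ze: "e - 1 \<le> z" using z(2)[OF Re] .
    have "\<exists>h. p \<le> h \<and> z < h \<and> w (h + 3) = w h \<and> (\<forall>k. z < k \<longrightarrow> k \<le> h + 1 \<longrightarrow> w (k + 2) \<noteq> w k)"
      using nst
    proof
      assume fr: "w g \<notin> letters w s g"
      obtain h' where h': "g \<le> h'" "\<And>k. g \<le> k \<Longrightarrow> k \<le> h' \<Longrightarrow> w k \<notin> letters w s k" "w (Suc h') \<in> letters w s (Suc h')"
        using run_end[OF fr] p by auto
      define h where "h = h' - 2"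
      have h: "h' = h + 2" "p < h" using h'(1) p by (auto simp: h_def)
      have fh: "w (h + 2) \<notin> letters w s (h + 2)" using h'(2)[of "h + 2"] h h'(1) by simp
      have "win w (h + 1) (Suc 2) \<in> wins w (Suc 2) s (h + 1 + 2)"
        by (rule slack_0_known[where t = T]) (use s3[of T] h'(3) h p g T_def e(1) in \<open>auto simp: numeral_eq_Suc\<close>)
      then have k: "win w (h + 1) 3 \<in> wins w 3 s (h + 3)" by (simp add: numeral_eq_Suc)
      have "w (h + 2) \<in># win w (h + 1) 3" by (simp add: win_3)
      then obtain i where i: "s \<le> i" "i + 3 \<le> h + 3" "h + 2 < i + 3" "win w (h + 1) 3 = win w i 3"
        using wins_after[OF k _ fh] by blast
      have "i = h" using i(2,3) by linarith
      then have hh: "w (h + 3) = w h" using i(4) by (simp add: numeral_eq_Suc win_nf)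
      have zh: "z < h" using z(1) h g p h'(1) by (simp add: R_def)
      have "w (k + 2) \<noteq> w k" if k: "z < k" "k \<le> h + 1" for k
      proof
        assume r: "w (k + 2) = w k"
        consider "k + 2 < g" | "g \<le> k + 2" "k + 2 \<le> h'" | "k = h + 1" using k h by linarith
        then show False
        proof cases
          case 1 then show False using z(2)[of k] r k by (simp add: R_def)
        next
          case 2
          have "w k \<in> letters w s (k + 2)" by (rule in_lettersI) (use k ze e(1) in auto)
          then show False using h'(2)[OF 2] r by simp
        next
          case 3
          then have "w (h + 3) = w (h + 1)" using r by (simp add: numeral_eq_Suc)
          then show False using hh no_loop[of h] by simp
        qed
      qed
      then show ?thesis using hh zh h(2) by (intro exI[of _ h]) auto
    next
      assume ne: "w g \<in> letters w s g \<and> win w (p + 2) 2 \<notin> K2"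
      have e1: "win w (p + 1) 2 \<in> wins w 2 s T" by (rule known2) (use p in auto)
      have e0: "win w p 2 \<in> wins w 2 s T" by (rule known2) (use p in auto)
      have g1: "w (p + 3) \<noteq> w (p + 1)"
      proof
        assume "w (p + 3) = w (p + 1)"
        then have "win w (p + 2) 2 = win w (p + 1) 2" by (simp add: numeral_eq_Suc win_nf)
        then show False using e1 ne by (simp add: K2_def)
      qed
      have "win w (p + 1) (Suc 2) \<in> wins w (Suc 2) s (p + 1 + 2)"
        by (rule slack_0_known[where t = T]) (use s3[of T] ne p g T_def e(1) in \<open>auto simp: numeral_eq_Suc\<close>)
      then have "win w (p + 1) 3 \<in> wins w 3 s T" using p sg(3) by (simp add: numeral_eq_Suc K3_def)
      then obtain k where k: "s \<le> k" "k + 3 \<le> T" "win w (p + 1) 3 = win w k 3" by (rule in_winsE)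
      have k2: "win w k 2 \<in> wins w 2 s T" "win w (k + 1) 2 \<in> wins w 2 s T" "win w k 3 \<in> wins w 3 s T"
        using k by (auto intro: in_winsI)
      have eq: "{#w (p + 1), w (p + 2), w (p + 3)#} = {#w k, w (k + 1), w (k + 2)#}"
        using k(3) by (simp add: numeral_eq_Suc win_nf)
      have nK: "{#w (p + 2), w (p + 3)#} \<notin> wins w 2 s T" using ne by (simp add: K2_def nf)
      have c2: "{#w k, w (k + 1)#} \<noteq> {#w (p + 2), w (p + 3)#}" "{#w (k + 1), w (k + 2)#} \<noteq> {#w (p + 2), w (p + 3)#}"
        using k2(1,2) nK by (auto simp: numeral_eq_Suc win_nf)
      have "w (k + 1) \<in># {#w (p + 1), w (p + 2), w (p + 3)#}" unfolding eq by simp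
      then have "w (k + 1) = w (p + 1) \<or> w (k + 1) = w (p + 2) \<or> w (k + 1) = w (p + 3)" by simp
      moreover have "w (k + 1) \<noteq> w (p + 2)"
      proof
        assume a: "w (k + 1) = w (p + 2)"
        then have "{#w (p + 1), w (p + 3)#} = {#w k, w (k + 2)#}" using eq by (simp add: add_mset_commute)
        then show False using c2 a by (auto simp: pair_mset)
      qed
      moreover have "w (k + 1) \<noteq> w (p + 3)"
      proof
        assume a: "w (k + 1) = w (p + 3)"
        then have "{#w (p + 1), w (p + 2)#} = {#w k, w (k + 2)#}" using eq by (simp add: add_mset_commute)
        then show False using c2 a by (auto simp: pair_mset)
      qed
      ultimately have a: "w (k + 1) = w (p + 1)" by blast
      then have kk: "{#w (p + 2), w (p + 3)#} = {#w k, w (k + 2)#}" using eq by (simp add: add_mset_commute)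
      have "w (p + 1) \<in> L" unfolding sg(1)[symmetric] by (rule in_lettersI) (use p in auto)
      then obtain l r where lr: "pass s T (w (p + 1)) l r" using pass by blast
      have A: "w k = l \<and> w (k + 2) = r \<or> w k = r \<and> w (k + 2) = l"
        by (rule pass_through[OF lr a k2])
      have B: "w p = l \<and> w (p + 2) = r \<or> w p = r \<and> w (p + 2) = l"
        by (rule pass_through[OF lr refl e0 e1]) (rule known3, use p in auto)
      have hh: "w (p + 3) = w p" using A B kk by (auto simp: pair_mset)
      have "z \<noteq> p" using z(1) hh no_loop_shifted[of p] by (auto simp: R_def)
      then have zp: "z < p" using z(1) p by (simp add: R_def)
      have "w (k + 2) \<noteq> w k" if k: "z < k" "k \<le> p + 1" for k
      proof (cases "k = p + 1")
        case True then show ?thesis using g1 by (simp add: numeral_eq_Suc)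
      next
        case False then show ?thesis using k z(2)[of k] p by (fastforce simp: R_def)
      qed
      then show ?thesis using hh zp by (intro exI[of _ p]) auto
    qed
    then obtain h where h: "p \<le> h" "z < h" "w (h + 3) = w h"
      "\<And>k. z < k \<Longrightarrow> k \<le> h + 1 \<Longrightarrow> w (k + 2) \<noteq> w k" by blast
    obtain e' where e': "z + 2 \<le> e'" "\<And>i j. z < i \<Longrightarrow> i < j \<Longrightarrow> j \<le> e' \<Longrightarrow> w i \<noteq> w j"
      "w (e' + 1) = w (e' - 1) \<or> z + 3 \<le> e' \<and> w (e' + 1) = w (e' - 2)"
      using return_run[of z] z(1) by (auto simp: R_def)
    have "w (e' + 1) \<noteq> w (e' - 1)"
    proof
      assume "w (e' + 1) = w (e' - 1)"
      then have "w (e' - 1 + 2) = w (e' - 1)" using e'(1) by simp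
      then have "\<not> e' - 1 \<le> h + 1" using h(4)[of "e' - 1"] e'(1) by linarith
      then have "h + 3 \<le> e'" by linarith
      then show False using e'(2)[of h "h + 3"] h(2,3) by simp
    qed
    then have "turn z e'" using e' z(1) by (auto simp: turn_def R_def)
    then show ?thesis by blast
  qed
qed

end

section \<open>Words around a triangle\<close>

lemma count_win: "count (win w i m) x = card {k \<in> {i..<i + m}. w k = x}"
proof (induction m)
  case (Suc m)
  have "{k \<in> {i..<i + Suc m}. w k = x} = (if w (i + m) = x then insert (i + m) {k \<in> {i..<i + m}. w k = x} else {k \<in> {i..<i + m}. w k = x})"
    by (auto simp: less_Suc_eq)
  then show ?case using Suc by (simp add: win_Suc)
qed simp

context loopless_word
begin

lemma plainD: "plain v \<Longrightarrow> w i = w j \<Longrightarrow> w (i + 1) = v \<Longrightarrow> w (j + 1) = v \<Longrightarrow> w (i + 2) = w (j + 2)"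
  unfolding plain_def by blast

text \<open>
  The special case of \<open>branching\<close> for three letters. Positions from 1 on suffice, so the letter
  before the history may be used as well.
\<close>
lemma not_determined_3:
  assumes "\<And>i j. 1 \<le> i \<Longrightarrow> 1 \<le> j \<Longrightarrow> w i = w j \<Longrightarrow> w (i + 1) = w (j + 1) \<Longrightarrow> w (i + 2) = w (j + 2) \<Longrightarrow> w (i + 3) = w (j + 3)"
  shows False
proof -
  obtain i j where ij: "1 \<le> i" "1 \<le> j" "\<And>l. l < 3 \<Longrightarrow> w (i + l) = w (j + l)" "w (i + 3) \<noteq> w (j + 3)"
    using branching[of 1 3] by blast
  show False using assms[OF ij(1,2)] ij(3)[of 0] ij(3)[of 1] ij(3)[of 2] ij(4) by simp
qed

text \<open>
  The excluded factors say that after \<open>c b a\<close> and after \<open>b c a\<close> the walk leaves the triangle, with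
  \<open>d\<close> and \<open>q\<close>, respectively. Hence any three letters determine the next one.
\<close>
lemma triangle_determined:
  assumes abc: "a \<noteq> b" "a \<noteq> c" "b \<noteq> c"
    and plain: "\<And>v. v \<notin> {a, b, c} \<Longrightarrow> plain v"
    and tc: "\<And>i. w (i + 1) = c \<Longrightarrow> w i = a \<and> w (i + 2) = b \<or> w i = b \<and> w (i + 2) = a"
    and tb: "\<And>i. w (i + 1) = b \<Longrightarrow> w i = a \<and> w (i + 2) = c \<or> w i = c \<and> w (i + 2) = a"
    and ta: "\<And>i. w (i + 1) = a \<Longrightarrow> w i = b \<Longrightarrow> w (i + 2) = c \<or> w (i + 2) = d"
      "\<And>i. w (i + 1) = a \<Longrightarrow> w i = c \<Longrightarrow> w (i + 2) = b \<or> w (i + 2) = q"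
      "\<And>i j. w (i + 1) = a \<Longrightarrow> w (j + 1) = a \<Longrightarrow> w i = w j \<Longrightarrow> w i \<noteq> b \<Longrightarrow> w i \<noteq> c \<Longrightarrow> w (i + 2) = w (j + 2)"
    and no: "\<And>i. \<not> (w i = c \<and> w (i + 1) = b \<and> w (i + 2) = a \<and> w (i + 3) = c)"
      "\<And>i. \<not> (w i = b \<and> w (i + 1) = c \<and> w (i + 2) = a \<and> w (i + 3) = b)"
  shows False
proof (rule not_determined_3)
  fix i j assume ij: "w i = w j" "w (i + 1) = w (j + 1)" "w (i + 2) = w (j + 2)"
  have s: "w (k + 1 + 1) = w (k + 2)" "w (k + 1 + 2) = w (k + 3)" for k by (simp_all add: numeral_eq_Suc)
  have cab: "w (k + 3) = d" if "w (k + 1) = b" "w (k + 2) = a" for k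
    using tb[of k] ta(1)[of "k + 1"] no(1)[of k] that s[of k] abc by auto
  have caq: "w (k + 3) = q" if "w (k + 1) = c" "w (k + 2) = a" for k
    using tc[of k] ta(2)[of "k + 1"] no(2)[of k] that s[of k] abc by auto
  consider "w (i + 2) = a" "w (i + 1) = b" | "w (i + 2) = a" "w (i + 1) = c" | "w (i + 2) = a" "w (i + 1) \<noteq> b" "w (i + 1) \<noteq> c"
    | "w (i + 2) = b" | "w (i + 2) = c" | "w (i + 2) \<notin> {a, b, c}" by auto
  then show "w (i + 3) = w (j + 3)"
  proof cases
    case 1 then show ?thesis using cab[of i] cab[of j] ij by simp
  next
    case 2 then show ?thesis using caq[of i] caq[of j] ij by simp
  next
    case 3 then show ?thesis using ta(3)[of "i + 1" "j + 1"] ij s[of i] s[of j] by simp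
  next
    case 4
    then show ?thesis using tb[of "i + 1"] tb[of "j + 1"] ij s[of i] s[of j] abc by auto
  next
    case 5
    then show ?thesis using tc[of "i + 1"] tc[of "j + 1"] ij s[of i] s[of j] abc by auto
  next
    case 6
    then show ?thesis using plain[of "w (i + 2)"] ij s[of i] s[of j] unfolding plain_def by metis
  qed
qed

text \<open>
  Here the triangle may be run through in both directions, so the word is not determined by its past. But when
  \<open>b\<close> and \<open>c\<close> are identified the direction becomes invisible, and two letters determine the next
  one. The stretch from one passage of the edge \<open>b c\<close> to the next is a period, and it contains
  \<open>b\<close> and \<open>c\<close> only at this edge, so \<open>c\<close> occurs at most twice in it.
\<close>
lemma triangle_merged:
  assumes abc: "a \<noteq> b" "a \<noteq> c" "b \<noteq> c" "d \<notin> {a, b, c}"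
    and plain: "\<And>v. v \<notin> {a, b, c} \<Longrightarrow> plain v"
    and tc: "\<And>i. w (i + 1) = c \<Longrightarrow> w i = a \<and> w (i + 2) = b \<or> w i = b \<and> w (i + 2) = a"
    and tb: "\<And>i. w (i + 1) = b \<Longrightarrow> w i = a \<and> w (i + 2) = c \<or> w i = c \<and> w (i + 2) = a"
    and ta: "\<And>i. w (i + 1) = a \<Longrightarrow> w i \<in> {b, c, d} \<and> w (i + 2) \<in> {b, c, d} \<and> w i \<noteq> w (i + 2)"
    and no: "\<And>i. \<not> (w i = c \<and> w (i + 1) = b \<and> w (i + 2) = a \<and> w (i + 3) = c)"
      "\<And>i. \<not> (w i = b \<and> w (i + 1) = c \<and> w (i + 2) = a \<and> w (i + 3) = b)"
    and occ: "w i0 = c"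
  shows False
proof -
  define f where "f x = (if x = c then b else x)" for x
  have s: "w (k + 1 + 1) = w (k + 2)" "w (k + 1 + 2) = w (k + 3)" for k by (simp_all add: numeral_eq_Suc)
  have fab: "f a \<noteq> b" using abc by (simp add: f_def)
  have ret: "w (k + 3) = d" if "w (k + 1) = b \<or> w (k + 1) = c" "w (k + 2) = a" for k
    using tb[of k] tc[of k] ta[of "k + 1"] no(1)[of k] no(2)[of k] that s[of k] abc by auto
  have step: "f (w (i + 3)) = f (w (j + 3))" if ij: "f (w (i + 1)) = f (w (j + 1))" "f (w (i + 2)) = f (w (j + 2))" for i j
  proof -
    consider "w (i + 2) = a" "w (i + 1) = b \<or> w (i + 1) = c" | "w (i + 2) = a" "w (i + 1) = d"
      | "w (i + 2) = b \<or> w (i + 2) = c" | "w (i + 2) \<notin> {a, b, c}" using ta[of "i + 1"] s[of i] by auto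
    then show ?thesis
    proof cases
      case 1
      then have "w (j + 2) = a" "w (j + 1) = b \<or> w (j + 1) = c" using ij abc by (auto simp: f_def split: if_splits)
      then show ?thesis using ret[of i] ret[of j] 1 by simp
    next
      case 2
      then have "w (j + 2) = a" "w (j + 1) = d" using ij abc by (auto simp: f_def split: if_splits)
      then show ?thesis using 2 ta[of "i + 1"] ta[of "j + 1"] s[of i] s[of j] abc by (auto simp: f_def)
    next
      case 3
      then have j: "w (j + 2) = b \<or> w (j + 2) = c" using ij abc by (auto simp: f_def split: if_splits)
      have "w (k + 1) = a \<and> f (w (k + 3)) = b \<or> f (w (k + 1)) = b \<and> w (k + 3) = a" if "w (k + 2) = b \<or> w (k + 2) = c" for k
        using tb[of "k + 1"] tc[of "k + 1"] s[of k] that by (auto simp: f_def)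
      from this[OF 3] this[OF j] have "f (w (i + 3)) = b \<and> f (w (j + 3)) = b \<or> w (i + 3) = a \<and> w (j + 3) = a"
        using ij(1) fab by metis
      then show ?thesis by metis
    next
      case 4
      then have j: "w (j + 2) = w (i + 2)" using ij abc by (auto simp: f_def split: if_splits)
      have nbc: "w (k + 1) \<noteq> b \<and> w (k + 1) \<noteq> c" if "w (k + 2) \<notin> {a, b, c}" for k
        using tb[of k] tc[of k] that by blast
      have fi: "u = v" if "f u = f v" "u \<noteq> b \<and> u \<noteq> c" "v \<noteq> b \<and> v \<noteq> c" for u v
        using that by (simp add: f_def)
      have "w (i + 1) = w (j + 1)"
        by (rule fi[OF ij(1) nbc[OF 4] nbc]) (use 4 j in simp)
      then have "w (i + 1 + 2) = w (j + 1 + 2)"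
        by (rule plainD[OF plain[OF 4]]) (use j s(1) in simp_all)
      then show ?thesis using s(2)[of i] s(2)[of j] by simp
    qed
  qed
  define B where "B x \<longleftrightarrow> (w x = b \<or> w x = c) \<and> (w (x + 1) = b \<or> w (x + 1) = c)" for x
  have ex: "\<exists>x>y. B x" for y
  proof -
    obtain k where k: "y + 2 \<le> k" "w k = w i0" by (rule letter_recurs)
    then obtain k' where k': "k = k' + 1" by (cases k) auto
    then have "w k' = a \<and> w (k' + 2) = b \<or> w k' = b \<and> w (k' + 2) = a" using tc[of k'] k occ by simp
    then have "B k' \<or> B k" using k k' occ by (auto simp: B_def)
    moreover have "y < k'" "y < k" using k k' by auto
    ultimately show ?thesis by blast
  qed
  obtain x where x: "0 < x" "B x" using ex by blast
  obtain y where y: "x < y \<and> B y" "\<forall>z<y. \<not> (x < z \<and> B z)"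
    using ex[of x] exists_least_iff[of "\<lambda>y. x < y \<and> B y"] by blast
  have eq: "f (w (x + k)) = f (w (y + k)) \<and> f (w (x + k + 1)) = f (w (y + k + 1))" for k
  proof (induction k)
    case 0
    then show ?case using x y by (auto simp: B_def f_def)
  next
    case (Suc k)
    define x' y' where "x' = x - 1" and "y' = y - 1"
    have xy: "x + k = x' + k + 1" "y + k = y' + k + 1" "x + Suc k = x' + k + 2" "y + Suc k = y' + k + 2"
      "x + Suc k + 1 = x' + k + 3" "y + Suc k + 1 = y' + k + 3"
      using x y by (auto simp: x'_def y'_def)
    have "f (w (x' + k + 1)) = f (w (y' + k + 1))" using Suc xy(1,2) by metis
    moreover have "f (w (x' + k + 2)) = f (w (y' + k + 2))" using Suc xy(3,4) by (metis add_Suc_right add.right_neutral One_nat_def)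
    ultimately show ?case using step[of "x' + k" "y' + k"] unfolding xy by (simp add: numeral_eq_Suc)
  qed
  define N where "N = y - x"
  have per: "f (w (i + N)) = f (w i)" if "x \<le> i" for i
  proof -
    have "y + (i - x) = i + N" "x + (i - x) = i" using y that by (auto simp: N_def)
    then show ?thesis using eq[of "i - x"] by simp
  qed
  have cnt: "count (win w i N) c \<le> 2" if "x \<le> i" for i
  proof -
    have "count (win w i N) c = card {k \<in> {i..<i + N}. w k = c}" by (rule count_win)
    also have "\<dots> \<le> card {k \<in> {i..<i + N}. (f \<circ> w) k = b}" by (rule card_mono) (auto simp: f_def)
    also have "\<dots> = count (win (f \<circ> w) i N) b" by (rule count_win[symmetric])
    also have "win (f \<circ> w) i N = win (f \<circ> w) x N" by (rule win_periodic) (use per that in auto)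
    also have "count (win (f \<circ> w) x N) b = card {k \<in> {x..<x + N}. (f \<circ> w) k = b}" by (rule count_win)
    also have "\<dots> \<le> card {x, x + 1}"
    proof (rule card_mono)
      show "{k \<in> {x..<x + N}. (f \<circ> w) k = b} \<subseteq> {x, x + 1}"
      proof
        fix k assume "k \<in> {k \<in> {x..<x + N}. (f \<circ> w) k = b}"
        then have k: "x \<le> k" "k < y" "w k = b \<or> w k = c" using y by (auto simp: N_def f_def split: if_splits)
        show "k \<in> {x, x + 1}"
        proof (rule ccontr)
          assume nk: "k \<notin> {x, x + 1}"
          define l where "l = k - 1"
          have l: "k = l + 1" "x < l" using nk k by (auto simp: l_def)
          have "B l \<or> B k" using tb[of l] tc[of l] k l by (auto simp: B_def)
          then show False using y(2) k l by auto
        qed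
      qed
    qed simp
    also have "\<dots> \<le> 2" by (simp add: card_insert_if)
    finally show ?thesis .
  qed
  show False
  proof (rule merged_not_periodic[of x N c b])
    fix i assume "x \<le> i"
    then show "(if w (i + N) = c then b else w (i + N)) = (if w i = c then b else w i)"
      "count (win w i N) c \<le> 2"
      using per[of i] cnt[of i] by (simp_all add: f_def)
  qed (use y abc in \<open>auto simp: N_def\<close>)
qed

text \<open>
  The four classes of length 5 that are present force the word to be a concatenation of the blocks
  \<open>d a b a c b a\<close> and \<open>d a b c a b a\<close>. They become equal when \<open>c\<close> is identified with \<open>a\<close>, so
  that the word has period 7 after merging.
\<close>
lemma four_letter_triangle:
  assumes abc: "a \<noteq> b" "a \<noteq> c" "b \<noteq> c" "d \<notin> {a, b, c}"
    and tc: "\<And>i. w (i + 1) = c \<Longrightarrow> w i = a \<and> w (i + 2) = b \<or> w i = b \<and> w (i + 2) = a"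
    and tb: "\<And>i. w (i + 1) = b \<Longrightarrow> w i = a \<and> w (i + 2) = c \<or> w i = c \<and> w (i + 2) = a \<or> w i = a \<and> w (i + 2) = a"
    and ta: "\<And>i. w (i + 1) = a \<Longrightarrow> w i = b \<and> w (i + 2) = d \<or> w i = d \<and> w (i + 2) = b \<or> w i = b \<and> w (i + 2) = c \<or> w i = c \<and> w (i + 2) = b"
    and no: "\<And>i. win w i 4 \<noteq> {#a, b, c, c#}"
    and r: "range w \<subseteq> {a, b, c, d}"
    and occ: "w i0 = c" "w j = a" "w (j + 1) = b" "w (j + 2) = a" "w j' = d" "j' = j + 3 \<or> j = j' + 1"
  shows False
proof -
  have s: "w (k + 1 + 1) = w (k + 2)" "w (k + 1 + 2) = w (k + 3)" "w (k + 2 + 1) = w (k + 3)" "w (k + 2 + 2) = w (k + 4)"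
    "w (k + 3 + 1) = w (k + 4)" "w (k + 3 + 2) = w (k + 5)" "w (k + 4 + 1) = w (k + 5)" "w (k + 4 + 2) = w (k + 6)"
    "w (k + 5 + 1) = w (k + 6)" "w (k + 5 + 2) = w (k + 7)" "w (k + 1 + 3) = w (k + 4)" "w (k + 1 + 4) = w (k + 5)"
    "w (k + 2 + 3) = w (k + 5)" "w (k + 2 + 4) = w (k + 6)" "w (k + 3 + 3) = w (k + 6)" "w (k + 3 + 4) = w (k + 7)" for k
    by (simp_all add: numeral_eq_Suc)
  have nl: "w (k + 1) \<noteq> w (k + 2)" "w (k + 2) \<noteq> w (k + 3)" for k
    by (rule no_loop_shifted)+
  have nw: "\<not> (w i = c \<and> w (i + 1) = a \<and> w (i + 2) = b \<and> w (i + 3) = c)"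
    "\<not> (w i = c \<and> w (i + 1) = b \<and> w (i + 2) = a \<and> w (i + 3) = c)" for i
    using no[of i] by (auto simp: win_4)
  have mem: "w k = a \<or> w k = b \<or> w k = c \<or> w k = d" for k using r by auto
  have td: "w (k + 1) = a \<and> w (k + 3) = a" if "w (k + 2) = d" for k
    using tb[of k] tc[of k] tb[of "k + 2"] tc[of "k + 2"] mem[of "k + 1"] mem[of "k + 3"] nl[of k] that s[of k] abc by auto
  have n: "n = 4"
  proof -
    have "card (range w) \<le> card {a, b, c, d}" using r by (intro card_mono) auto
    also have "\<dots> = 4" using abc by auto
    finally show ?thesis using card_range n4 by simp
  qed
  define A1 A2 A3 A4 where "A1 = {#a, a, b, b, d#}" and "A2 = {#a, a, b, c, d#}"
    and "A3 = {#a, a, b, b, c#}" and "A4 = {#a, a, a, b, d#}"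
  note A = A1_def A2_def A3_def A4_def
  have A1: "A1 \<in> range (\<lambda>i. win w i 5)"
  proof -
    obtain l where l: "3 \<le> l" "w l = w j'" by (rule letter_recurs)
    define k where "k = l - 3"
    have k: "w (k + 3) = d" using l occ by (simp add: k_def)
    then have "w (k + 2) = a" "w (k + 4) = a" using td[of "k + 1"] s[of k] by simp_all
    moreover have "w (k + 5) = b" "w (k + 1) = b"
      using ta[of "k + 3"] ta[of "k + 1"] k calculation s[of k] abc by auto
    ultimately have "win w (k + 1) 5 = A1" using k by (simp add: numeral_eq_Suc win_Suc_left A add_mset_commute)
    then show ?thesis by (metis rangeI)
  qed
  have A23: "A2 \<in> range (\<lambda>i. win w i 5) \<and> A3 \<in> range (\<lambda>i. win w i 5)"
  proof -
    obtain l where l: "4 \<le> l" "w l = w i0" by (rule letter_recurs)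
    define k where "k = l - 4"
    have k: "w (k + 4) = c" using l occ by (simp add: k_def)
    have "w (k + 3) = a \<and> w (k + 5) = b \<or> w (k + 3) = b \<and> w (k + 5) = a" using tc[of "k + 3"] k s[of k] by simp
    then show ?thesis
    proof
      assume h: "w (k + 3) = a \<and> w (k + 5) = b"
      have "w (k + 6) = a" "w (k + 2) = b" using tb[of "k + 4"] ta[of "k + 2"] h k s[of k] abc by auto
      moreover have "w (k + 7) = d" using ta[of "k + 5"] nw(2)[of "k + 4"] h k calculation s[of k] s[of "k + 1"] s[of "k + 4"] abc
        by (auto simp: numeral_eq_Suc)
      ultimately have "win w (k + 2) 5 = A3" "win w (k + 3) 5 = A2" using h k by (simp_all add: numeral_eq_Suc win_Suc_left A add_mset_commute)
      then show ?thesis by (metis rangeI)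
    next
      assume h: "w (k + 3) = b \<and> w (k + 5) = a"
      have "w (k + 6) = b" "w (k + 2) = a" using ta[of "k + 4"] tb[of "k + 2"] h k s[of k] abc by auto
      moreover have "w (k + 1) = d" using ta[of "k + 1"] nw(1)[of "k + 1"] h k calculation s[of k] abc by auto
      ultimately have "win w (k + 2) 5 = A3" "win w (k + 1) 5 = A2" using h k by (simp_all add: numeral_eq_Suc win_Suc_left A add_mset_commute)
      then show ?thesis by (metis rangeI)
    qed
  qed
  have A4: "A4 \<in> range (\<lambda>i. win w i 5)"
    using occ(6)
  proof
    assume j': "j' = j + 3"
    have "w (j + 4) = a" using td[of "j + 1"] occ j' s[of j] by simp
    then have "win w j 5 = A4" using occ(2-5) j' by (simp add: numeral_eq_Suc win_Suc_left A add_mset_commute)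
    then show ?thesis by (metis rangeI)
  next
    assume j: "j = j' + 1"
    obtain l where l: "2 \<le> l" "\<forall>k<4. w (l + k) = w (j' + k)" using recurs[of 2 4 j'] by metis
    define k where "k = l - 2"
    have kl: "l = k + 2" using l by (simp add: k_def)
    have k: "w (k + 2) = d" "w (k + 3) = a" "w (k + 4) = b" "w (k + 5) = a"
      using l(2)[rule_format, of 0] l(2)[rule_format, of 1] l(2)[rule_format, of 2] l(2)[rule_format, of 3] occ(2-5) unfolding kl j by (simp_all add: numeral_eq_Suc)
    then have "w (k + 1) = a" using td by blast
    then have "win w (k + 1) 5 = A4" using k by (simp add: numeral_eq_Suc win_Suc_left A add_mset_commute)
    then show ?thesis by (metis rangeI)
  qed
  have "{A1, A2, A3, A4} = range (\<lambda>i. win w i 5)"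
  proof (rule card_seteq)
    have "A1 \<noteq> A2" "A1 \<noteq> A3" "A1 \<noteq> A4" "A2 \<noteq> A3" "A2 \<noteq> A4" "A3 \<noteq> A4" using abc by (auto simp: A pair_mset)
    then have "card {A1, A2, A3, A4} = 4" by simp
    then show "card (range (\<lambda>i. win w i 5)) \<le> card {A1, A2, A3, A4}" using card_range_win[of 5] n by simp
  qed (use A1 A23 A4 finite_range_win[of 5] in auto)
  then have A5: "win w i 5 = A1 \<or> win w i 5 = A2 \<or> win w i 5 = A3 \<or> win w i 5 = A4" for i by blast
  have no5: "win w i 5 \<noteq> {#a, a, b, c, c#}" "win w i 5 \<noteq> {#a, a, b, d, d#}" for i
    using A5[of i] abc by (auto simp: A pair_mset)
  have blk: "w (k + 3) = a \<and> w (k + 4) = b \<and> (w (k + 5) = a \<and> w (k + 6) = c \<or> w (k + 5) = c \<and> w (k + 6) = a) \<and>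
      w (k + 7) = b \<and> w (k + 8) = a \<and> w (k + 9) = d" if k: "w (k + 2) = d" for k
  proof -
    have s': "w (k + 6 + 1) = w (k + 7)" "w (k + 6 + 2) = w (k + 8)" "w (k + 7 + 1) = w (k + 8)" "w (k + 7 + 2) = w (k + 9)"
      "w (k + 6 + 3) = w (k + 9)" "w (k + 5 + 3) = w (k + 8)" by (simp_all add: numeral_eq_Suc)
    have 3: "w (k + 3) = a" using td[OF k] by simp
    have 4: "w (k + 4) = b" using ta[of "k + 2"] 3 k s[of k] abc by auto
    have "w (k + 5) = a \<or> w (k + 5) = c" using tb[of "k + 3"] 4 s[of k] by auto
    then show ?thesis
    proof
      assume 5: "w (k + 5) = a"
      have "w (k + 6) = c \<or> w (k + 6) = d" using ta[of "k + 4"] 4 5 s[of k] abc by auto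
      moreover have "w (k + 6) \<noteq> d" using no5(2)[of "k + 2"] k 3 4 5 s[of k] by (auto simp: numeral_eq_Suc win_Suc_left add_mset_commute)
      ultimately have 6: "w (k + 6) = c" by blast
      have 7: "w (k + 7) = b" using tc[of "k + 5"] 5 6 s[of k] abc by auto
      have 8: "w (k + 8) = a" using tb[of "k + 6"] 6 7 s' abc by auto
      have "w (k + 9) = d" using ta[of "k + 7"] nw(2)[of "k + 6"] 6 7 8 s' abc by auto
      then show ?thesis using 3 4 5 6 7 8 by simp
    next
      assume 5: "w (k + 5) = c"
      have 6: "w (k + 6) = a" using tc[of "k + 4"] 4 5 s[of k] abc by auto
      have 7: "w (k + 7) = b" using ta[of "k + 5"] 5 6 s[of k] abc by auto
      have 8: "w (k + 8) = a" using tb[of "k + 6"] nw(1)[of "k + 5"] 5 6 7 s[of k] s' abc by (auto simp: numeral_eq_Suc)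
      have "w (k + 9) = c \<or> w (k + 9) = d" using ta[of "k + 7"] 7 8 s' abc by auto
      moreover have "w (k + 9) \<noteq> c" using no5(1)[of "k + 5"] 5 6 7 8 by (auto simp: numeral_eq_Suc win_Suc_left add_mset_commute)
      ultimately show ?thesis using 3 4 5 6 7 8 by simp
    qed
  qed
  obtain D where D: "2 \<le> D" "w D = w j'" by (rule letter_recurs)
  define D0 where "D0 = D - 2"
  have D0: "D = D0 + 2" using D(1) by (simp add: D0_def)
  have Dk: "w (D0 + 7 * k + 2) = d" for k
  proof (induction k)
    case 0 then show ?case using D occ D0 by simp
  next
    case (Suc k)
    have e: "D0 + 7 * Suc k + 2 = D0 + 7 * k + 9" by simp
    show ?case unfolding e using blk[OF Suc] by blast
  qed
  define at where "at m \<longleftrightarrow> w m = d \<and> w (m + 1) = a \<and> w (m + 2) = b \<and>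
      (w (m + 3) = a \<and> w (m + 4) = c \<or> w (m + 3) = c \<and> w (m + 4) = a) \<and>
      w (m + 5) = b \<and> w (m + 6) = a" for m
  have pat: "at (D + 7 * k)" for k
  proof -
    define l where "l = D0 + 7 * k"
    have "D + 7 * k = l + 2" by (simp add: D0 l_def)
    moreover have "w (l + 2) = d" unfolding l_def by (rule Dk)
    ultimately show ?thesis using blk[of l] by (simp add: at_def numeral_eq_Suc)
  qed
  show False
  proof (rule merged_not_periodic[of D 7 c a])
    fix i assume i: "D \<le> i"
    define k r m where "k = (i - D) div 7" and "r = (i - D) mod 7" and "m = D + 7 * k"
    have im: "i = m + r" using i by (simp add: k_def r_def m_def)
    have "m + 7 = D + 7 * (k + 1)" by (simp add: m_def)
    then have pm: "at m" "at (m + 7)" using pat[of k] pat[of "k + 1"] by (simp_all only: m_def)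
    have "r < 7" by (simp add: r_def)
    then have r: "r = 0 \<or> r = 1 \<or> r = 2 \<or> r = 3 \<or> r = 4 \<or> r = 5 \<or> r = 6" by linarith
    then show "(if w (i + 7) = c then a else w (i + 7)) = (if w i = c then a else w i)"
      using pm abc unfolding im at_def by (elim disjE conjE; simp add: numeral_eq_Suc)
    show "count (win w i 7) c \<le> 2"
      using r pm abc unfolding im at_def by (elim disjE conjE; simp add: numeral_eq_Suc win_Suc_left)
  qed (use abc in auto)
qed

text \<open>
  The walk may now also turn back at \<open>b\<close>. If it does so next to \<open>d\<close>, only four letters are left;
  if it does so nowhere next to \<open>d\<close>, any three letters determine the next one.
\<close>
lemma triangle_with_turn:
  assumes abc: "a \<noteq> b" "a \<noteq> c" "b \<noteq> c" "d \<notin> {a, b, c}"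
    and plain: "\<And>v. v \<notin> {a, b, c} \<Longrightarrow> plain v"
    and tc: "\<And>i. w (i + 1) = c \<Longrightarrow> w i = a \<and> w (i + 2) = b \<or> w i = b \<and> w (i + 2) = a"
    and tb: "\<And>i. w (i + 1) = b \<Longrightarrow> w i = a \<and> w (i + 2) = c \<or> w i = c \<and> w (i + 2) = a \<or> w i = a \<and> w (i + 2) = a"
    and ta: "\<And>i. w (i + 1) = a \<Longrightarrow> w i = b \<and> w (i + 2) = d \<or> w i = d \<and> w (i + 2) = b \<or> w i = b \<and> w (i + 2) = c \<or> w i = c \<and> w (i + 2) = b"
    and no: "\<And>i. win w i 4 \<noteq> {#a, b, c, c#}"
    and r: "\<And>i. win w i 4 = {#a, a, b, d#} \<Longrightarrow> range w \<subseteq> {a, b, c, d}"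
    and occ: "w i0 = c"
  shows False
proof -
  have s: "w (k + 1 + 1) = w (k + 2)" "w (k + 1 + 2) = w (k + 3)" for k by (simp_all add: numeral_eq_Suc)
  have nw: "\<not> (w i = c \<and> w (i + 1) = a \<and> w (i + 2) = b \<and> w (i + 3) = c)"
    "\<not> (w i = c \<and> w (i + 1) = b \<and> w (i + 2) = a \<and> w (i + 3) = c)" for i
    using no[of i] by (auto simp: win_4)
  show False
  proof (cases "\<exists>i. w i = d \<and> w (i + 1) = a \<and> w (i + 2) = b \<and> w (i + 3) = a \<or> w i = a \<and> w (i + 1) = b \<and> w (i + 2) = a \<and> w (i + 3) = d")
    case True
    then obtain i where i: "w i = d \<and> w (i + 1) = a \<and> w (i + 2) = b \<and> w (i + 3) = a \<or> w i = a \<and> w (i + 1) = b \<and> w (i + 2) = a \<and> w (i + 3) = d" ..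
    then have "win w i 4 = {#a, a, b, d#}" by (auto simp: win_4)
    then have rw: "range w \<subseteq> {a, b, c, d}" by (rule r)
    show False
      using i
    proof
      assume "w i = d \<and> w (i + 1) = a \<and> w (i + 2) = b \<and> w (i + 3) = a"
      then show False
        using four_letter_triangle[OF abc tc tb ta no rw occ, of "i + 1" i] s[of i] by simp
    next
      assume "w i = a \<and> w (i + 1) = b \<and> w (i + 2) = a \<and> w (i + 3) = d"
      then show False
        using four_letter_triangle[OF abc tc tb ta no rw occ, of i "i + 3"] by simp
    qed
  next
    case False
    then have F: "\<not> (w k = d \<and> w (k + 1) = a \<and> w (k + 2) = b \<and> w (k + 3) = a)"
      "\<not> (w k = a \<and> w (k + 1) = b \<and> w (k + 2) = a \<and> w (k + 3) = d)" for k by blast+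
    show False
    proof (rule not_determined_3)
      fix i j assume ij: "w i = w j" "w (i + 1) = w (j + 1)" "w (i + 2) = w (j + 2)"
      have b: "w (k + 3) = (if w (k + 1) = c then a else if w k = d then c else a)" if "w (k + 2) = b" for k
        using tb[of "k + 1"] ta[of k] nw(1)[of k] F[of k] that s[of k] abc by auto
      have a: "w (k + 3) = (if w (k + 1) \<noteq> b then b else if w k = c then d else c)" if "w (k + 2) = a" for k
        using ta[of "k + 1"] tb[of k] nw(2)[of k] F[of k] that s[of k] abc by auto
      consider "w (i + 2) = a" | "w (i + 2) = b" | "w (i + 2) = c" | "w (i + 2) \<notin> {a, b, c}" by auto
      then show "w (i + 3) = w (j + 3)"
      proof cases
        case 1 then show ?thesis using a[of i] a[of j] ij by simp
      next
        case 2 then show ?thesis using b[of i] b[of j] ij by simp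
      next
        case 3
        then show ?thesis using tc[of "i + 1"] tc[of "j + 1"] ij s[of i] s[of j] abc by auto
      next
        case 4
        then show ?thesis using plain[of "w (i + 2)"] ij s[of i] s[of j] unfolding plain_def by metis
      qed
    qed
  qed
qed

end

section \<open>Classes of explicit factors\<close>

text \<open>
  The classes of the factors of length \<open>m\<close>, by a recursion that the simplifier can unfold for an
  explicit list.
\<close>
primrec subwins :: "nat \<Rightarrow> 'a list \<Rightarrow> 'a multiset set" where
  "subwins m [] = {}"
| "subwins m (x # xs) = (if m \<le> Suc (length xs) then insert (mset (take m (x # xs))) (subwins m xs) else {})"

lemma mset_take_drop_in_subwins:
  "i + m \<le> length xs \<Longrightarrow> 1 \<le> m \<Longrightarrow> mset (take m (drop i xs)) \<in> subwins m xs"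
proof (induction xs arbitrary: i)
  case (Cons x xs)
  show ?case
  proof (cases i)
    case 0
    then show ?thesis using Cons.prems by simp
  next
    case (Suc j)
    then show ?thesis using Cons.IH[of j] Cons.prems by simp
  qed
qed simp

text \<open>
  If a letter \<open>y\<close> occurs only at positions covered by an explicitly known block, then all classes that
  contain \<open>y\<close> are among the finitely many classes of this block.
\<close>
lemma wins_subwins:
  assumes xs: "block w p (length xs) = xs" and M: "M \<in> wins w m s T" "y \<in># M"
    and occ: "\<And>k. s \<le> k \<Longrightarrow> k < T \<Longrightarrow> w k = y \<Longrightarrow> lo \<le> k \<and> k \<le> hi"
    and lo: "p \<le> s \<or> p + m \<le> lo + 1" and hi: "T \<le> p + length xs \<or> hi + m \<le> p + length xs"
  shows "M \<in> subwins m xs"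
proof -
  obtain i where i: "s \<le> i" "i + m \<le> T" "M = win w i m" using M(1) by (rule in_winsE)
  obtain k where k: "i \<le> k" "k < i + m" "w k = y" using M(2) unfolding i(3) by (auto simp: set_mset_win)
  have "lo \<le> k \<and> k \<le> hi" using occ[of k] k i by simp
  then have ip: "p \<le> i" "i + m \<le> p + length xs" using lo hi k i by linarith+
  have "block w i m = take m (drop (i - p) (block w p (length xs)))"
    using ip by (simp add: block_def drop_map take_map)
  then have "M = mset (take m (drop (i - p) xs))" unfolding i(3) win_def xs by simp
  moreover have "mset (take m (drop (i - p) xs)) \<in> subwins m xs"
    by (rule mset_take_drop_in_subwins) (use ip k in auto)
  ultimately show ?thesis by simp
qed

lemma triple_mset: "{#x, y, z#} = {#u, v, t#} \<longleftrightarrow>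
    x = u \<and> {#y, z#} = {#v, t#} \<or> x = v \<and> {#y, z#} = {#u, t#} \<or> x = t \<and> {#y, z#} = {#u, v#}"
  (is "?l \<longleftrightarrow> ?r")
proof
  assume l: ?l
  have "x \<in># {#u, v, t#}" unfolding l[symmetric] by simp
  then have "x = u \<or> x = v \<or> x = t" by simp
  then show ?r
  proof (elim disjE)
    assume "x = u" then show ?r using l by simp
  next
    assume x: "x = v"
    have "{#v, y, z#} = {#v, u, t#}" using l x add_mset_commute[of u v "{#t#}"] by metis
    then have "{#y, z#} = {#u, t#}" by simp
    then show ?r using x by blast
  next
    assume x: "x = t"
    have "{#t, y, z#} = {#t, u, v#}"
      using l x add_mset_commute[of v t "{#}"] add_mset_commute[of u t "{#v#}"] by metis
    then have "{#y, z#} = {#u, v#}" by simp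
    then show ?r using x by blast
  qed
next
  assume ?r
  then show ?l
  proof (elim disjE conjE)
    assume "x = u" "{#y, z#} = {#v, t#}" then show ?l by simp
  next
    assume "x = v" "{#y, z#} = {#u, t#}" then show ?l by (simp add: add_mset_commute)
  next
    assume "x = t" "{#y, z#} = {#u, v#}" then show ?l by (simp add: add_mset_commute)
  qed
qed

context loopless_word
begin

lemma run_cost:
  assumes "slack 2 s (g + 3) 0" "s \<le> g" "w (g + 3) \<notin> letters w s (g + 3)"
    and "w g \<noteq> w (g + 2)" "slack 3 s (g + 3) k3" "slack 4 s (g + 3) k4"
  shows "\<exists>h\<ge>g + 3. (\<forall>k. g + 3 \<le> k \<longrightarrow> k \<le> h \<longrightarrow> w k \<notin> letters w s k) \<and> w (h + 1) = w (h - 1) \<and>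
    0 < k3 \<and> 0 < k4 \<and> slack 2 s (h + 2) 0 \<and> slack 3 s (h + 2) (k3 - 1) \<and> slack 4 s (h + 2) (k4 - 1)"
  using fresh_run_cost[OF assms(1-4) no_loop_shifted(3) assms(5,6)] .

lemma passI:
  assumes "\<And>y. {#v, y#} \<in> wins w 2 s t \<Longrightarrow> y = l \<or> y = r"
    and "{#l, v, l#} \<notin> wins w 3 s t" "{#r, v, r#} \<notin> wins w 3 s t"
  shows "pass s t v l r"
  unfolding pass_def
proof (intro conjI ballI impI)
  fix M assume M: "M \<in> wins w 2 s t" "v \<in># M"
  then obtain i where "M = win w i 2" by (auto elim: in_winsE)
  then obtain y where y: "M = {#v, y#}" using M(2) by (auto simp: win_2 add_mset_commute)
  then have "y = l \<or> y = r" using assms(1) M(1) by simp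
  then show "M = {#l, v#} \<or> M = {#v, r#}" using y by (auto simp: add_mset_commute)
qed (use assms in auto)

text \<open>
  When no further classes occur in the whole word, the letters of a run are plain.
\<close>
lemma run_plain:
  assumes "\<And>k. g \<le> k \<Longrightarrow> k \<le> h \<Longrightarrow> w k \<notin> letters w s k" "w (h + 1) = w (h - 1)" "s < g" "g \<le> h"
    and "\<And>i. win w i 2 \<in> wins w 2 s (h + 2)" "\<And>i. win w i 3 \<in> wins w 3 s (h + 2)"
    and "g \<le> f" "f \<le> h"
  shows "plain (w f)"
proof -
  obtain l r where "pass s (h + 2) (w f) l r"
    using run_pass[OF assms(1-4) no_loop_shifted(1) assms(7,8)] by blast
  then show ?thesis by (rule pass_plain) (rule assms(5), rule assms(6))
qed

end

text \<open>
  A turn whose path from the return at \<open>s\<close> reaches the triangle \<open>a b c\<close> through a letter \<open>d\<close>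
  outside of it.
\<close>
locale turning_word = loopless_word +
  fixes s p :: nat and a b c d :: 'a
  assumes sp: "s < p" and ret: "w (s + 2) = w s"
    and dist: "s < i \<Longrightarrow> i < j \<Longrightarrow> j \<le> p + 3 \<Longrightarrow> w i \<noteq> w j"
    and pos: "w p = d" "w (p + 1) = a" "w (p + 2) = b" "w (p + 3) = c" "w (p + 4) = a"
begin

lemma abcd: "a \<noteq> b" "a \<noteq> c" "b \<noteq> c" "d \<notin> {a, b, c}"
  using dist[of p "p + 1"] dist[of p "p + 2"] dist[of p "p + 3"] dist[of "p + 1" "p + 2"] dist[of "p + 1" "p + 3"]
    dist[of "p + 2" "p + 3"] pos sp by auto

lemma before: "s \<le> k \<Longrightarrow> k \<le> p \<Longrightarrow> w k \<noteq> b \<and> w k \<noteq> c \<and> (w k = a \<longrightarrow> k = s \<and> p = s + 1)"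
proof -
  have *: "w k \<noteq> b \<and> w k \<noteq> c \<and> (s + 2 \<le> p \<longrightarrow> w k \<noteq> a)" if "s < k" "k \<le> p" for k
    using dist[of k "p + 1"] dist[of k "p + 2"] dist[of k "p + 3"] that pos by auto
  assume k: "s \<le> k" "k \<le> p"
  show ?thesis
  proof (cases "k = s")
    case False
    then show ?thesis using * [of k] dist[of k "p + 1"] k pos by auto
  next
    case True
    show ?thesis
    proof (cases "p = s + 1")
      case True
      then have "w s = a" using ret pos by (simp add: numeral_eq_Suc)
      then show ?thesis using True \<open>k = s\<close> abcd by auto
    next
      case False
      then show ?thesis using *[of "s + 2"] ret \<open>k = s\<close> sp by auto
    qed
  qed
qed

lemma c_fresh: "c \<notin> letters w s (p + 3)"
proof
  assume "c \<in> letters w s (p + 3)"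
  then obtain k where k: "s \<le> k" "k < p + 3" "w k = c" by (auto simp: in_letters_iff)
  then have "k = p + 1 \<or> k = p + 2" using before[of k] by (cases "k \<le> p") auto
  then show False using k(3) pos abcd by auto
qed

lemma slack2: "slack 2 s (p + 5) 0"
proof -
  have "slack 2 s (s + 2) 1" by (rule slack_init) (simp add: letters_def card_insert_if numeral_eq_Suc atLeastLessThanSuc)
  then have 1: "slack 2 s (p + 4) 1" by (rule slack_mono) (use sp in auto)
  have "win w (p + 3) 2 \<notin> wins w 2 s (p + 4)"
  proof
    assume x: "win w (p + 3) 2 \<in> wins w 2 s (p + 4)"
    have "c \<in># win w (p + 3) 2" using pos by (simp add: win_2)
    then obtain i where i: "s \<le> i" "i + 2 \<le> p + 4" "p + 3 < i + 2" "win w (p + 3) 2 = win w i 2"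
      using wins_after[OF x _ c_fresh] by blast
    have "i = p + 2" using i(2,3) by linarith
    then show False using i(4) pos abcd by (simp add: numeral_eq_Suc win_nf)
  qed
  moreover have "w (p + 4) \<in> letters w s (p + 4)" using in_lettersI[of s "p + 1" "p + 4" w] pos sp by simp
  ultimately show ?thesis using slack_event[of 1 s "p + 3" 1] 1 sp by (simp add: numeral_eq_Suc)
qed

lemma slack3: "slack 3 s (p + 5) 1"
proof -
  have "letters w s (s + 3) = {w s, w (s + 1)}" using ret by (simp add: letters_Suc numeral_eq_Suc insert_commute) (simp add: letters_def)
  then have "slack 3 s (s + 3) 1" by (intro slack_init) (simp add: card_insert_if)
  then show ?thesis by (rule slack_mono) (use sp in auto)
qed

lemma slack4: "slack 4 s (p + 5) 1"
proof -
  have "letters w s (s + 4) = {w s, w (s + 1), w (s + 3)}" using ret by (simp add: letters_Suc numeral_eq_Suc insert_commute) (simp add: letters_def)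
  then have "slack 4 s (s + 4) 2" by (intro slack_init) (simp add: card_insert_if)
  then have 1: "slack 4 s (p + 4) 2" by (rule slack_mono) (use sp in auto)
  have "win w (p + 1) 4 \<notin> wins w 4 s (p + 4)"
  proof
    assume x: "win w (p + 1) 4 \<in> wins w 4 s (p + 4)"
    have "c \<in># win w (p + 1) 4" using pos by (simp add: numeral_eq_Suc win_nf)
    then obtain i where i: "s \<le> i" "i + 4 \<le> p + 4" "p + 3 < i + 4" "win w (p + 1) 4 = win w i 4"
      using wins_after[OF x _ c_fresh] by blast
    have "i = p" using i(2,3) by linarith
    then show False using i(4) pos abcd by (simp add: numeral_eq_Suc win_nf)
  qed
  moreover have "w (p + 4) \<in> letters w s (p + 4)" using in_lettersI[of s "p + 1" "p + 4" w] pos sp by simp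
  ultimately show ?thesis using slack_event_4[OF 1, of "p + 1"] sp by (simp add: numeral_eq_Suc)
qed

text \<open>
  The letters on the path to the triangle are passed straight through, as long as the later part of the stretch does not touch them.
\<close>
lemma tail_plain:
  assumes T: "p + 5 \<le> T" and off: "\<And>k l. s < k \<Longrightarrow> k \<le> p \<Longrightarrow> p < l \<Longrightarrow> l < T \<Longrightarrow> w k \<noteq> a \<Longrightarrow> w l \<noteq> w k"
    and 2: "\<And>i. win w i 2 \<in> wins w 2 s T"
    and 3: "\<And>i. w i = w (i + 2) \<Longrightarrow> win w i 3 \<in> wins w 3 s T"
    and k: "s \<le> k" "k \<le> p" and v: "w k \<noteq> a"
  shows "plain (w k)"
proof -
  have "\<exists>l r. pass s T (w f) l r" if f: "s < f" "f \<le> p" and fa: "w f \<noteq> a" for f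
  proof (cases "f = s + 2")
    case True
    have "pass s T (w s) (w (s + 1)) (w (s + 3))"
    proof (rule pass_start)
      fix k assume k: "s \<le> k" "k < T" "w k = w s"
      show "k = s \<or> k = s + 2"
      proof (rule ccontr)
        assume n: "\<not> ?thesis"
        show False
        proof (cases "k \<le> p")
          case True
          then show False using dist[of k "s + 2"] dist[of "s + 2" k] n k f \<open>f = s + 2\<close> ret by (cases k "s + 2" rule: linorder_cases) auto
        next
          case False
          then show False using off[of f k] k f fa \<open>f = s + 2\<close> ret by auto
        qed
      qed
    qed (use T sp ret in auto)
    then show ?thesis using True ret by auto
  next
    case False
    obtain q where q: "f = q + 1" using f by (cases f) auto
    have "pass s T (w (q + 1)) (w q) (w (q + 2))"
    proof (rule pass_single)
      fix k assume k: "s \<le> k" "k < T" "w k = w (q + 1)"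
      show "k = q + 1"
      proof (rule ccontr)
        assume n: "\<not> ?thesis"
        consider "k = s" | "s < k" "k \<le> p" | "p < k" using k by linarith
        then show False
        proof cases
          case 1
          have "s + 2 = f \<or> w (s + 2) \<noteq> w f"
            using dist[of f "s + 2"] dist[of "s + 2" f] f sp by (cases f "s + 2" rule: linorder_cases) auto
          then show False using 1 k ret False q by auto
        next
          case 2
          then show False using dist[of k f] dist[of f k] n k f q by (cases k f rule: linorder_cases) auto
        next
          case 3
          then show False using off[of f k] k f fa q by auto
        qed
      qed
    qed (use f q T in auto)
    then show ?thesis using q by auto
  qed
  moreover obtain f where "s < f" "f \<le> p" "w f = w k"
  proof (cases "k = s")
    case True
    then have "s + 2 \<le> p" using v pos ret sp by (cases "p = s + 1") (auto simp: numeral_eq_Suc)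
    then show thesis using that[of "s + 2"] True ret by simp
  next
    case False then show thesis using that[of k] k by simp
  qed
  ultimately obtain l r where "pass s T (w k) l r" using v by metis
  then show ?thesis by (rule pass_plain) (use 2 3 in blast)+
qed

lemma in_letters_abcd: "p + 4 \<le> t \<Longrightarrow> x \<in> {a, b, c, d} \<Longrightarrow> x \<in> letters w s t"
  using in_lettersI[of s p t w] in_lettersI[of s "p + 1" t w] in_lettersI[of s "p + 2" t w] in_lettersI[of s "p + 3" t w] pos sp
  by auto

text \<open>
  Windows of these lengths that contain the letter start at \<open>p - 1\<close> at the earliest, since \<open>b\<close> and
  \<open>c\<close> first occur at \<open>p + 2\<close> and \<open>p + 3\<close>, and \<open>a\<close> occurs before \<open>p + 1\<close> at most when \<open>s = p - 1\<close>. So only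
  one letter \<open>x\<close> before \<open>d\<close> has to be considered.
\<close>
definition covered :: "'a \<Rightarrow> nat \<Rightarrow> bool" where
  "covered y m \<longleftrightarrow> y = c \<and> m \<le> 4 \<or> y = b \<and> m \<le> 4 \<or> y = a \<and> m \<le> 3"

lemma wins_abc:
  assumes xs: "block w (p - 1) (length xs) = xs" and M: "M \<in> wins w m s T"
    and y: "y \<in># M" "covered y m"
    and hi: "T \<le> p - 1 + length xs \<or> (\<forall>k<T. w k = y \<longrightarrow> k + m \<le> p - 1 + length xs)"
  shows "M \<in> subwins m xs"
proof -
  define H where "H = (if T \<le> p - 1 + length xs then T else p - 1 + length xs - m)"
  have H: "k \<le> H" if "k < T" "w k = y" for k
  proof (cases "T \<le> p - 1 + length xs")
    case False
    then have "k + m \<le> p - 1 + length xs" using hi that by blast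
    then show ?thesis using False by (simp add: H_def)
  qed (use that in \<open>simp add: H_def\<close>)
  have H': "T \<le> p - 1 + length xs \<or> H + m \<le> p - 1 + length xs"
  proof (cases "T \<le> p - 1 + length xs")
    case False
    obtain i where i: "s \<le> i" "i + m \<le> T" "M = win w i m" using M by (rule in_winsE)
    obtain k where k: "i \<le> k" "k < i + m" "w k = y" using y(1) unfolding i(3) by (auto simp: set_mset_win)
    then have "k < T" using i by simp
    then have "k + m \<le> p - 1 + length xs" using False hi k(3) by blast
    then show ?thesis using False by (simp add: H_def)
  qed simp
  show ?thesis
  proof (cases "p = s + 1")
    case True
    show ?thesis
    proof (rule wins_subwins[OF xs M y(1), of 0 H])
      fix k assume "k < T" "w k = y"
      then show "0 \<le> k \<and> k \<le> H" using H by simp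
    qed (use True H' in auto)
  next
    case False
    show ?thesis
    proof (rule wins_subwins[OF xs M y(1), of "if y = a then p + 1 else p + 2" H])
      fix k assume k: "s \<le> k" "k < T" "w k = y"
      have "(if y = a then p + 1 else p + 2) \<le> k"
      proof (rule ccontr)
        assume n: "\<not> ?thesis"
        show False
        proof (cases "k \<le> p")
          case True
          then show False using before[of k] k y(2) False by (auto simp: covered_def)
        next
          case F: False
          then have "k = p + 1" "y \<noteq> a" using n by (auto split: if_splits)
          then show False using k(3) pos(2) by simp
        qed
      qed
      then show "(if y = a then p + 1 else p + 2) \<le> k \<and> k \<le> H" using H k by simp
    qed (use y(2) H' sp abcd in \<open>auto simp: covered_def\<close>)
  qed
qed

definition x where "x = w (p - 1)"

lemma x: "x \<noteq> d" "x \<noteq> b" "x \<noteq> c"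
  using no_loop[of "p - 1"] sp pos before[of "p - 1"] by (auto simp: x_def)

lemma block_x: "block w (p - 1) (Suc (Suc (Suc (Suc (Suc (Suc m)))))) = x # d # a # b # c # a # block w (p + 5) m"
  using pos sp by (simp add: block_Suc x_def numeral_eq_Suc)

lemma wins_5:
  assumes "M \<in> wins w m s (p + 5)" "y \<in># M" "covered y m"
  shows "M \<in> subwins m [x, d, a, b, c, a]"
proof (rule wins_abc[OF _ assms])
  have "p + 5 \<le> p - 1 + length [x, d, a, b, c, a]" using sp by simp
  then show "p + 5 \<le> p - 1 + length [x, d, a, b, c, a] \<or> (\<forall>k<p + 5. w k = y \<longrightarrow> k + m \<le> p - 1 + length [x, d, a, b, c, a])" ..
qed (use block_x[of 0] in \<open>simp add: block_0\<close>)

lemma wins_6: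
  assumes "w (p + 5) = t" "M \<in> wins w m s (p + 6)" "y \<in># M" "covered y m"
  shows "M \<in> subwins m [x, d, a, b, c, a, t]"
proof (rule wins_abc[OF _ assms(2-4)])
  have "p + 6 \<le> p - 1 + length [x, d, a, b, c, a, t]" using sp by simp
  then show "p + 6 \<le> p - 1 + length [x, d, a, b, c, a, t] \<or> (\<forall>k<p + 6. w k = y \<longrightarrow> k + m \<le> p - 1 + length [x, d, a, b, c, a, t])" ..
qed (use block_x[of 1] assms(1) in \<open>simp add: block_0 block_Suc\<close>)

lemma wins_7:
  assumes "w (p + 5) = t" "w (p + 6) = u" "M \<in> wins w m s (p + 7)" "y \<in># M" "covered y m"
  shows "M \<in> subwins m [x, d, a, b, c, a, t, u]"
proof (rule wins_abc[OF _ assms(3-5)])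
  have "p + 7 \<le> p - 1 + length [x, d, a, b, c, a, t, u]" using sp by simp
  then show "p + 7 \<le> p - 1 + length [x, d, a, b, c, a, t, u] \<or> (\<forall>k<p + 7. w k = y \<longrightarrow> k + m \<le> p - 1 + length [x, d, a, b, c, a, t, u])" ..
qed (use block_x[of 2] assms(1,2) in \<open>simp add: block_0 block_Suc numeral_eq_Suc\<close>)

lemmas sw = covered_def pair_mset triple_mset

lemma after_p: "p < l \<Longrightarrow> l < p + 5 \<Longrightarrow> w l \<in> {a, b, c}"
proof -
  assume "p < l" "l < p + 5"
  then have "l = p + 1 \<or> l = p + 2 \<or> l = p + 3 \<or> l = p + 4" by linarith
  then show ?thesis using pos by auto
qed

text \<open>
  Once all letters have been seen, everything off the triangle belongs to the path that led to it.
\<close>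
lemma plain_outside:
  assumes T: "p + 5 \<le> T" and 2: "\<And>i. win w i 2 \<in> wins w 2 s T"
    and 3: "\<And>i. w i = w (i + 2) \<Longrightarrow> win w i 3 \<in> wins w 3 s T"
    and all: "letters w s T = range w" and v: "v \<notin> {a, b, c}"
    and late: "\<And>l. p + 5 \<le> l \<Longrightarrow> l < T \<Longrightarrow> w l \<in> {a, b, c}"
  shows "plain v"
proof -
  have pl: "w l \<in> {a, b, c}" if "p < l" "l < T" for l
    using after_p[of l] late[of l] that by (cases "l < p + 5") auto
  obtain i where "w i \<in> letters w s T" "v = w i \<or> v \<notin> range w" using all by auto
  show ?thesis
  proof (cases "v \<in> range w")
    case False
    then show ?thesis unfolding plain_def by auto
  next
    case True
    then obtain k where k: "s \<le> k" "k < T" "w k = v" using all by (metis in_letters_iff)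
    have kp: "k \<le> p" using pl[of k] k v by (meson linorder_not_less)
    have "plain (w k)"
    proof (rule tail_plain[OF T _ 2 3 k(1) kp])
      fix k l assume kl: "s < k" "k \<le> p" "p < l" "l < T" "w k \<noteq> a"
      show "w l \<noteq> w k"
        using pl[OF kl(3,4)] before[of k] kl(1,2,5) by auto
    qed (use k v in auto)
    then show ?thesis using k by simp
  qed
qed

text \<open>
  For the continuation \<open>d a b c a c\<close> all remaining slack is spent, and \<open>triangle_determined\<close> applies.
\<close>
lemma turn_at_c:
  assumes t: "w (p + 5) = c"
  shows False
proof -
  have old: "w (p + 5) \<in> letters w s (p + 5)" using t in_letters_abcd by simp
  note L5 = wins_5 and L6 = wins_6[OF t]
  have e: "win w (p + 3) 3 = {#c, a, c#}" "win w (p + 2) 4 = {#b, c, a, c#}" using pos t by (simp_all add: numeral_eq_Suc win_nf)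
  have "win w (p + 3) 3 \<notin> wins w 3 s (p + 5)"
    unfolding e by (rule notI, drule L5[where y = c]) (use abcd x  in \<open>auto simp: sw\<close>)
  then have s3: "slack 3 s (p + 6) 0" using slack_event_3[OF slack3, of "p + 3"] old sp by (simp add: numeral_eq_Suc)
  have "win w (p + 2) 4 \<notin> wins w 4 s (p + 5)"
    unfolding e by (rule notI, drule L5[where y = c]) (use abcd x  in \<open>auto simp: sw\<close>)
  then have s4: "slack 4 s (p + 6) 0" using slack_event_4[OF slack4, of "p + 2"] old sp by (simp add: numeral_eq_Suc)
  have s2: "slack 2 s (p + 6) 0" by (rule slack_mono[OF slack2]) (use sp in auto)
  have all: "letters w s (p + 6) = range w" by (rule no_fresh[OF s2 s3]) (use sp in auto)
  have S2: "win w i 2 \<in> wins w 2 s (p + 6)" and S3: "win w i 3 \<in> wins w 3 s (p + 6)" for i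
    using saturated[OF s2 _ all] saturated[OF s3 _ all] by auto
  have S4: "win w i 4 \<in> wins w 4 s (p + 6)" for i by (rule saturated[OF s4 _ all]) simp
  have pc: "pass s (p + 6) c a b"
  proof (rule passI)
    show "y = a \<or> y = b" if "{#c, y#} \<in> wins w 2 s (p + 6)" for y
      using L6[OF that, of c] abcd x by (auto simp: sw)
  next
    show "{#a, c, a#} \<notin> wins w 3 s (p + 6)" by (rule notI, drule L6[where y = c]) (use abcd x  in \<open>auto simp: sw\<close>)
    show "{#b, c, b#} \<notin> wins w 3 s (p + 6)" by (rule notI, drule L6[where y = c]) (use abcd x  in \<open>auto simp: sw\<close>)
  qed
  have pb: "pass s (p + 6) b a c"
  proof (rule passI)
    show "y = a \<or> y = c" if "{#b, y#} \<in> wins w 2 s (p + 6)" for y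
      using L6[OF that, of b] abcd x by (auto simp: sw)
  next
    show "{#a, b, a#} \<notin> wins w 3 s (p + 6)" by (rule notI, drule L6[where y = b]) (use abcd x  in \<open>auto simp: sw\<close>)
    show "{#c, b, c#} \<notin> wins w 3 s (p + 6)" by (rule notI, drule L6[where y = b]) (use abcd x  in \<open>auto simp: sw\<close>)
  qed
  have Na: "y = d \<or> y = b \<or> y = c" if "{#a, y#} \<in> wins w 2 s (p + 6)" for y
    using L6[OF that, of a] abcd x by (auto simp: sw)
  have a3: "{#u, y#} = {#x, d#} \<or> {#u, y#} = {#d, b#} \<or> {#u, y#} = {#b, c#} \<or> {#u, y#} = {#c, c#}"
    if "{#a, u, y#} \<in> wins w 3 s (p + 6)" for u y
    using L6[OF that, of a] abcd x by (auto simp: sw)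
  have nba: "{#a, w i#} \<in> wins w 2 s (p + 6) \<and> {#a, w (i + 2)#} \<in> wins w 2 s (p + 6) \<and> {#a, w i, w (i + 2)#} \<in> wins w 3 s (p + 6)"
    if "w (i + 1) = a" for i
    using S2[of i] S2[of "i + 1"] S3[of i] that by (simp add: numeral_eq_Suc win_nf add_mset_commute)
  have tc: "w i = a \<and> w (i + 2) = b \<or> w i = b \<and> w (i + 2) = a" if "w (i + 1) = c" for i
    by (rule pass_through[OF pc that S2 S2 S3])
  have n4: "{#a, b, b, c#} \<notin> wins w 4 s (p + 6)" by (rule notI, drule L6[where y = c]) (use abcd x  in \<open>auto simp: sw\<close>)
  show False
  proof (rule triangle_determined[of a b c d c])
    fix v assume v: "v \<notin> {a, b, c}"
    show "plain v"
    proof (rule plain_outside[OF _ S2 S3 all v])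
      fix l assume "p + 5 \<le> l" "l < p + 6"
      then have "l = p + 5" by simp
      then show "w l \<in> {a, b, c}" using t by simp
    qed simp
  next
    fix i assume "w (i + 1) = b"
    then show "w i = a \<and> w (i + 2) = c \<or> w i = c \<and> w (i + 2) = a" by (rule pass_through[OF pb _ S2 S2 S3])
  next
    fix i assume i: "w (i + 1) = a"
    show "w (i + 2) = c \<or> w (i + 2) = d" if "w i = b"
      using a3[of "w i" "w (i + 2)"] Na[of "w (i + 2)"] nba[OF i] that abcd x by (auto simp: pair_mset)
    show "w (i + 2) = b \<or> w (i + 2) = c" if "w i = c"
      using a3[of "w i" "w (i + 2)"] Na[of "w (i + 2)"] nba[OF i] that abcd x by (auto simp: pair_mset)
  next
    have "w (i + 2) = b" if "w (i + 1) = a" "w i \<noteq> b" "w i \<noteq> c" for i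
      using a3[of "w i" "w (i + 2)"] Na[of "w i"] Na[of "w (i + 2)"] nba[OF that(1)] that abcd x by (auto simp: pair_mset)
    then show "w (i + 2) = w (j + 2)" if "w (i + 1) = a" "w (j + 1) = a" "w i = w j" "w i \<noteq> b" "w i \<noteq> c" for i j
      using that by simp
  next
    fix i
    show "\<not> (w i = c \<and> w (i + 1) = b \<and> w (i + 2) = a \<and> w (i + 3) = c)"
    proof
      assume h: "w i = c \<and> w (i + 1) = b \<and> w (i + 2) = a \<and> w (i + 3) = c"
      then have "w (i + 4) = b" using tc[of "i + 2"] abcd by (simp add: numeral_eq_Suc)
      then have "win w (i + 1) 4 = {#a, b, b, c#}" using h by (simp add: numeral_eq_Suc win_nf)
      then show False using n4 S4[of "i + 1"] by simp
    qed
    show "\<not> (w i = b \<and> w (i + 1) = c \<and> w (i + 2) = a \<and> w (i + 3) = b)"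
    proof
      assume h: "w i = b \<and> w (i + 1) = c \<and> w (i + 2) = a \<and> w (i + 3) = b"
      then have "win w i 4 = {#a, b, b, c#}" by (simp add: win_4)
      then show False using n4 S4[of i] by simp
    qed
  qed (use abcd tc in auto)
qed

end

section \<open>Continuations after a long approach to the triangle\<close>

context turning_word
begin

text \<open>
  For the continuation \<open>d a b c a d\<close> the triangle is left the way it was entered; its direction stays free,
  which is the situation of \<open>triangle_merged\<close>.
\<close>
lemma back_to_d:
  assumes t: "w (p + 5) = d"
  shows False
proof -
  note L5 = wins_5 and L6 = wins_6[OF t]
  have old: "w (p + 5) \<in> letters w s (p + 5)" using t in_letters_abcd by simp
  have e: "win w (p + 3) 3 = {#c, a, d#}" using pos t by (simp add: numeral_eq_Suc win_nf)
  have "win w (p + 3) 3 \<notin> wins w 3 s (p + 5)" unfolding e by (rule notI, drule L5[where y = c]) (use abcd x in \<open>auto simp: sw\<close>)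
  then have s3: "slack 3 s (p + 6) 0" using slack_event_3[OF slack3, of "p + 3"] old sp by (simp add: numeral_eq_Suc)
  have s2: "slack 2 s (p + 6) 0" by (rule slack_mono[OF slack2]) (use sp in auto)
  have all: "letters w s (p + 6) = range w" by (rule no_fresh[OF s2 s3]) (use sp in auto)
  have S2: "win w i 2 \<in> wins w 2 s (p + 6)" and S3: "win w i 3 \<in> wins w 3 s (p + 6)" for i
    using saturated[OF s2 _ all] saturated[OF s3 _ all] by auto
  have all5: "letters w s (p + 5) = range w"
    using all letters_Suc[of s "p + 5" w] old sp by (simp add: numeral_eq_Suc insert_absorb)
  have S2': "win w i 2 \<in> wins w 2 s (p + 5)" for i by (rule saturated[OF slack2 _ all5]) simp
  have S3': "win w i 3 \<in> wins w 3 s (p + 5)" if r: "w i = w (i + 2)" for i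
  proof -
    obtain k where k: "s \<le> k" "k + 3 \<le> p + 6" "win w i 3 = win w k 3" using S3[of i] by (rule in_winsE)
    have "win w i 3 \<noteq> win w (p + 3) 3" unfolding e using r abcd by (auto simp: win_3 sw)
    then have "k \<noteq> p + 3" using k(3) by auto
    then show ?thesis unfolding k(3) using k(1,2) by (intro in_winsI) auto
  qed
  define u where "u = w (p + 6)"
  have "{#d, u#} \<in> wins w 2 s (p + 5)" using S2'[of "p + 5"] t by (simp add: numeral_eq_Suc win_nf u_def)
  then have ub: "u \<noteq> b" using L5[of "{#d, u#}" 2 b] abcd x by (auto simp: sw)
  have e4: "win w (p + 3) 4 = {#c, a, d, u#}" using pos t by (simp add: numeral_eq_Suc win_nf u_def)
  have "win w (p + 3) 4 \<notin> wins w 4 s (p + 6)"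
    unfolding e4 by (rule notI, drule L6[where y = c]) (use abcd x ub in \<open>auto simp: sw\<close>)
  then have s4: "slack 4 s (p + 7) 0"
    using slack_event_4[OF slack4, of "p + 3"] all sp by (simp add: numeral_eq_Suc)
  have all7: "letters w s (p + 7) = range w"
    using all letters_mono[of "p + 6" "p + 7" w s] by (auto simp: letters_def)
  have S4: "win w i 4 \<in> wins w 4 s (p + 7)" for i by (rule saturated[OF s4 _ all7]) simp
  note L7 = wins_7[OF t u_def[symmetric]]
  have pc: "pass s (p + 6) c a b"
  proof (rule passI)
    show "y = a \<or> y = b" if "{#c, y#} \<in> wins w 2 s (p + 6)" for y
      using L6[OF that, of c] abcd x  by (auto simp: sw)
  next
    show "{#a, c, a#} \<notin> wins w 3 s (p + 6)" by (rule notI, drule L6[where y = c]) (use abcd x  in \<open>auto simp: sw\<close>)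
    show "{#b, c, b#} \<notin> wins w 3 s (p + 6)" by (rule notI, drule L6[where y = c]) (use abcd x  in \<open>auto simp: sw\<close>)
  qed
  have pb: "pass s (p + 6) b a c"
  proof (rule passI)
    show "y = a \<or> y = c" if "{#b, y#} \<in> wins w 2 s (p + 6)" for y
      using L6[OF that, of b] abcd x  by (auto simp: sw)
  next
    show "{#a, b, a#} \<notin> wins w 3 s (p + 6)" by (rule notI, drule L6[where y = b]) (use abcd x  in \<open>auto simp: sw\<close>)
    show "{#c, b, c#} \<notin> wins w 3 s (p + 6)" by (rule notI, drule L6[where y = b]) (use abcd x  in \<open>auto simp: sw\<close>)
  qed
  have nba: "{#a, w i#} \<in> wins w 2 s (p + 6) \<and> {#a, w (i + 2)#} \<in> wins w 2 s (p + 6) \<and> {#a, w i, w (i + 2)#} \<in> wins w 3 s (p + 6)"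
    if "w (i + 1) = a" for i
    using S2[of i] S2[of "i + 1"] S3[of i] that by (simp add: numeral_eq_Suc win_nf add_mset_commute)
  have Na: "y \<in> {b, c, d}" if "{#a, y#} \<in> wins w 2 s (p + 6)" for y
    using L6[OF that, of a] abcd x by (auto simp: sw)
  have a3: "{#a, y, y#} \<notin> wins w 3 s (p + 6)" for y
    by (rule notI, drule L6[where y = a]) (use abcd x in \<open>auto simp: sw\<close>)
  have n4: "M \<notin> wins w 4 s (p + 7)" if "M = {#a, b, b, c#} \<or> M = {#a, b, c, c#}" for M
    using L7[of M 4 c] that abcd x ub by (auto simp: sw)
  show False
  proof (rule triangle_merged[of a b c d])
    fix v assume v: "v \<notin> {a, b, c}"
    show "plain v" by (rule plain_outside[OF _ S2' S3' all5 v]) auto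
  next
    fix i assume "w (i + 1) = c"
    then show "w i = a \<and> w (i + 2) = b \<or> w i = b \<and> w (i + 2) = a" by (rule pass_through[OF pc _ S2 S2 S3])
  next
    fix i assume "w (i + 1) = b"
    then show "w i = a \<and> w (i + 2) = c \<or> w i = c \<and> w (i + 2) = a" by (rule pass_through[OF pb _ S2 S2 S3])
  next
    fix i assume i: "w (i + 1) = a"
    show "w i \<in> {b, c, d} \<and> w (i + 2) \<in> {b, c, d} \<and> w i \<noteq> w (i + 2)"
      using Na[of "w i"] Na[of "w (i + 2)"] a3[of "w i"] nba[OF i] by metis
  next
    fix i
    show "\<not> (w i = c \<and> w (i + 1) = b \<and> w (i + 2) = a \<and> w (i + 3) = c)"
    proof
      assume h: "w i = c \<and> w (i + 1) = b \<and> w (i + 2) = a \<and> w (i + 3) = c"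
      then have "win w i 4 = {#a, b, c, c#}" by (simp add: win_4)
      then show False using n4 S4[of i] by simp
    qed
    show "\<not> (w i = b \<and> w (i + 1) = c \<and> w (i + 2) = a \<and> w (i + 3) = b)"
    proof
      assume h: "w i = b \<and> w (i + 1) = c \<and> w (i + 2) = a \<and> w (i + 3) = b"
      then have "win w i 4 = {#a, b, b, c#}" by (simp add: win_4)
      then show False using n4 S4[of i] by simp
    qed
  qed (use abcd pos in auto)
qed

text \<open>
  The continuation \<open>d a b c a b a\<close> leads to \<open>triangle_with_turn\<close>.
\<close>
lemma turn_at_b:
  assumes t: "w (p + 5) = b" "w (p + 6) = a"
    and s4: "slack 4 s (p + 6) 0"
  shows False
proof -
  note L6 = wins_6[OF t(1)] and L7 = wins_7[OF t]
  have old: "w (p + 6) \<in> letters w s (p + 6)" using t in_letters_abcd by simp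
  have e: "win w (p + 4) 3 = {#a, b, a#}" using pos t by (simp add: numeral_eq_Suc win_nf)
  have "win w (p + 4) 3 \<notin> wins w 3 s (p + 6)" unfolding e by (rule notI, drule L6[where y = b]) (use abcd x in \<open>auto simp: sw\<close>)
  then have s3: "slack 3 s (p + 7) 0" using slack_event_3[OF slack3, of "p + 4"] old sp by (simp add: numeral_eq_Suc)
  have s2: "slack 2 s (p + 7) 0" by (rule slack_mono[OF slack2]) (use sp in auto)
  have all: "letters w s (p + 7) = range w" by (rule no_fresh[OF s2 s3]) (use sp in auto)
  have S2: "win w i 2 \<in> wins w 2 s (p + 7)" and S3: "win w i 3 \<in> wins w 3 s (p + 7)" for i
    using saturated[OF s2 _ all] saturated[OF s3 _ all] by auto
  have s4': "slack 4 s (p + 7) 0" by (rule slack_mono[OF s4]) (use sp in auto)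
  have S4: "win w i 4 \<in> wins w 4 s (p + 7)" for i by (rule saturated[OF s4' _ all]) simp
  have pc: "pass s (p + 7) c a b"
  proof (rule passI)
    show "y = a \<or> y = b" if "{#c, y#} \<in> wins w 2 s (p + 7)" for y
      using L7[OF that, of c] abcd x  by (auto simp: sw)
  next
    show "{#a, c, a#} \<notin> wins w 3 s (p + 7)" by (rule notI, drule L7[where y = c]) (use abcd x  in \<open>auto simp: sw\<close>)
    show "{#b, c, b#} \<notin> wins w 3 s (p + 7)" by (rule notI, drule L7[where y = c]) (use abcd x  in \<open>auto simp: sw\<close>)
  qed
  have nba: "{#a, w i#} \<in> wins w 2 s (p + 7) \<and> {#a, w (i + 2)#} \<in> wins w 2 s (p + 7) \<and> {#a, w i, w (i + 2)#} \<in> wins w 3 s (p + 7)"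
    if "w (i + 1) = a" for i
    using S2[of i] S2[of "i + 1"] S3[of i] that by (simp add: numeral_eq_Suc win_nf add_mset_commute)
  have nbb: "{#b, w i#} \<in> wins w 2 s (p + 7) \<and> {#b, w (i + 2)#} \<in> wins w 2 s (p + 7) \<and> {#b, w i, w (i + 2)#} \<in> wins w 3 s (p + 7)"
    if "w (i + 1) = b" for i
    using S2[of i] S2[of "i + 1"] S3[of i] that by (simp add: numeral_eq_Suc win_nf add_mset_commute)
  have Na: "y \<in> {b, c, d}" if "{#a, y#} \<in> wins w 2 s (p + 7)" for y
    using L7[OF that, of a] abcd x by (auto simp: sw)
  have Nb: "y \<in> {a, c}" if "{#b, y#} \<in> wins w 2 s (p + 7)" for y
    using L7[OF that, of b] abcd x by (auto simp: sw)
  have b3: "{#b, c, c#} \<notin> wins w 3 s (p + 7)" by (rule notI, drule L7[where y = b]) (use abcd x in \<open>auto simp: sw\<close>)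
  have a3: "{#u, y#} = {#x, d#} \<or> {#u, y#} = {#d, b#} \<or> {#u, y#} = {#b, c#} \<or> {#u, y#} = {#a, b#}"
    if "{#a, u, y#} \<in> wins w 3 s (p + 7)" for u y
    using L7[OF that, of a] abcd x by (auto simp: sw)
  have n4: "{#a, b, c, c#} \<notin> wins w 4 s (p + 7)" by (rule notI, drule L7[where y = c]) (use abcd x in \<open>auto simp: sw\<close>)
  have d4: "x = a" if "{#a, a, b, d#} \<in> wins w 4 s (p + 7)"
    using L7[OF that, of b] abcd x by (auto simp: sw)
  show False
  proof (rule triangle_with_turn[of a b c d "p + 3"])
    fix v assume v: "v \<notin> {a, b, c}"
    show "plain v"
    proof (rule plain_outside[OF _ S2 S3 all v])
      fix l assume "p + 5 \<le> l" "l < p + 7"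
      then have "l = p + 5 \<or> l = p + 6" by linarith
      then show "w l \<in> {a, b, c}" using t by auto
    qed simp
  next
    fix i assume "w (i + 1) = c"
    then show "w i = a \<and> w (i + 2) = b \<or> w i = b \<and> w (i + 2) = a" by (rule pass_through[OF pc _ S2 S2 S3])
  next
    fix i assume i: "w (i + 1) = b"
    show "w i = a \<and> w (i + 2) = c \<or> w i = c \<and> w (i + 2) = a \<or> w i = a \<and> w (i + 2) = a"
      using Nb[of "w i"] Nb[of "w (i + 2)"] nbb[OF i] b3 by auto
  next
    fix i assume i: "w (i + 1) = a"
    show "w i = b \<and> w (i + 2) = d \<or> w i = d \<and> w (i + 2) = b \<or> w i = b \<and> w (i + 2) = c \<or> w i = c \<and> w (i + 2) = b"
      using Na[of "w i"] Na[of "w (i + 2)"] a3[of "w i" "w (i + 2)"] nba[OF i] abcd x by (auto simp: pair_mset)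
  next
    fix i show "win w i 4 \<noteq> {#a, b, c, c#}" using S4[of i] n4 by auto
  next
    fix i assume "win w i 4 = {#a, a, b, d#}"
    then have "w (p - 1) = a" using d4 S4[of i] by (simp add: x_def)
    then have p: "p = s + 1" using before[of "p - 1"] sp by auto
    have "w k \<in> {a, b, c, d}" if H: "s \<le> k" "k < p + 7" for k
    proof -
      consider "k = s" | "k = p" | "p < k" "k < p + 5" | "k = p + 5" | "k = p + 6" using H p by linarith
      then show ?thesis
      proof cases
        case 1 then show ?thesis using \<open>w (p - 1) = a\<close> p by simp
      next
        case 3 then show ?thesis using after_p[of k] by auto
      qed (use pos t in auto)
    qed
    note K = this
    show "range w \<subseteq> {a, b, c, d}" unfolding all[symmetric]
    proof
      fix y assume "y \<in> letters w s (p + 7)"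
      then obtain k where "s \<le> k" "k < p + 7" "w k = y" unfolding in_letters_iff by blast
      then show "y \<in> {a, b, c, d}" using K[of k] by simp
    qed
  qed (use abcd pos in auto)
qed

text \<open>
  The class \<open>{a, b, b, c}\<close> uses up the slack for length 4, so that neither a new letter nor another round
  can follow.
\<close>
lemma not_b_after:
  assumes t: "w (p + 5) = b"
  shows False
proof -
  note L5 = wins_5 and L6 = wins_6[OF t]
  have old: "w (p + 5) \<in> letters w s (p + 5)" using t in_letters_abcd by simp
  have e: "win w (p + 2) 4 = {#b, c, a, b#}" using pos t by (simp add: numeral_eq_Suc win_nf)
  have "win w (p + 2) 4 \<notin> wins w 4 s (p + 5)" unfolding e by (rule notI, drule L5[where y = c]) (use abcd x in \<open>auto simp: sw\<close>)
  then have s4: "slack 4 s (p + 6) 0" using slack_event_4[OF slack4, of "p + 2"] old sp by (simp add: numeral_eq_Suc)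
  have s2: "slack 2 s (p + 6) 0" by (rule slack_mono[OF slack2]) (use sp in auto)
  have s3: "slack 3 s (p + 6) 1" by (rule slack_mono[OF slack3]) (use sp in auto)
  show False
  proof (cases "w (p + 6) \<in> letters w s (p + 6)")
    case True
    have "win w (p + 5) 2 \<in> wins w 2 s (p + 6)"
      using slack_old[OF s2, of "p + 5"] True sp by (simp add: numeral_eq_Suc)
    then have "{#b, w (p + 6)#} \<in> wins w 2 s (p + 6)" using t by (simp add: numeral_eq_Suc win_nf)
    then have "w (p + 6) = a \<or> w (p + 6) = c" using L6[of "{#b, w (p + 6)#}" 2 b] abcd x by (auto simp: sw)
    then show False
    proof
      assume "w (p + 6) = a"
      then show False using turn_at_b[OF t _ s4] by simp
    next
      assume u: "w (p + 6) = c"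
      have "win w (p + 3) 4 \<in> wins w 4 s (p + 6)"
        using slack_old_4[OF s4, of "p + 3"] True sp by (simp add: numeral_eq_Suc)
      moreover have "win w (p + 3) 4 = {#c, a, b, c#}" using pos t u by (simp add: numeral_eq_Suc win_nf)
      ultimately show False using L6[of "{#c, a, b, c#}" 4 c] abcd x by (auto simp: sw)
    qed
  next
    case False
    have "w (p + 3) \<noteq> w (p + 5)" using pos t abcd by simp
    then show False
      using run_cost[of s "p + 3" 1 0] s2 s3 s4 False sp by (simp add: numeral_eq_Suc)
  qed
qed

text \<open>
  A second branch at \<open>a\<close> uses up all slack at its end. All letters of the two branches are plain, and
  three letters determine the next one.
\<close>
lemma no_second_tail:
  assumes fr: "w (p + 5) \<notin> letters w s (p + 5)"
  shows False
proof -
  define q where "q = w (p + 5)"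
  define r where "r = w (p + 6)"
  have fr': "w (p + 2 + 3) \<notin> letters w s (p + 2 + 3)" "slack 2 s (p + 2 + 3) 0" "slack 3 s (p + 2 + 3) 1" "slack 4 s (p + 2 + 3) 1"
    using fr slack2 slack3 slack4 by (simp_all add: numeral_eq_Suc)
  have ne: "w (p + 2) \<noteq> w (p + 2 + 2)" using pos abcd by (simp add: numeral_eq_Suc)
  have "s \<le> p + 2" using sp by simp
  from run_cost[OF fr'(2) this fr'(1) ne fr'(3,4)]
  obtain h where h': "p + 2 + 3 \<le> h" "\<forall>k. p + 2 + 3 \<le> k \<longrightarrow> k \<le> h \<longrightarrow> w k \<notin> letters w s k" "w (h + 1) = w (h - 1)"
    and sl: "slack 2 s (h + 2) 0" "slack 3 s (h + 2) (1 - 1)" "slack 4 s (h + 2) (1 - 1)"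
    by blast
  have h1: "p + 5 \<le> h" using h'(1) by simp
  have h2: "w k \<notin> letters w s k" if "p + 5 \<le> k" "k \<le> h" for k using h'(2) that by simp
  note h = h1 h2 h'(3)
  have s2: "slack 2 s (h + 2) 0" and s3: "slack 3 s (h + 2) 0" and s4: "slack 4 s (h + 2) 0" using sl by simp_all
  have all: "letters w s (h + 2) = range w" by (rule no_fresh[OF s2 s3]) (use sp h in auto)
  have S2: "win w i 2 \<in> wins w 2 s (h + 2)" and S3: "win w i 3 \<in> wins w 3 s (h + 2)" for i
    using saturated[OF s2 _ all] saturated[OF s3 _ all] by auto
  have S4: "win w i 4 \<in> wins w 4 s (h + 2)" for i by (rule saturated[OF s4 _ all]) simp
  have run: "h = p + 5 \<and> k = p + 6" if "p + 5 \<le> k" "k \<le> h + 1" "w k \<in> letters w s (p + 5)" for k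
    using run_letters[OF h(2,3,1) _ that] sp by simp
  have known: "{a, b, c, d, x} \<subseteq> letters w s (p + 5)"
    using in_letters_abcd[of "p + 5"] in_lettersI[of s "p - 1" "p + 5" w] sp by (simp add: x_def)
  have qf: "q \<notin> letters w s (p + 5)" unfolding q_def by (rule fr)
  have q: "q \<notin> {a, b, c, d, x}" using known qf by blast
  have r: "r = a \<or> r \<notin> {a, b, c, d, x, q}"
  proof (cases "h = p + 5")
    case True
    have "w (h + 1) = r" "w (h - 1) = a" using True pos by (simp_all add: r_def numeral_eq_Suc)
    then show ?thesis using h(3) by simp
  next
    case False
    then have "r \<notin> letters w s (p + 6)" unfolding r_def using h(1) by (intro h(2)) auto
    moreover have "letters w s (p + 5) \<subseteq> letters w s (p + 6)" by (rule letters_mono) simp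
    moreover have "q \<in> letters w s (p + 6)" unfolding q_def by (rule in_lettersI) (use sp in auto)
    ultimately show ?thesis using known by blast
  qed
  have L: "M \<in> subwins m [x, d, a, b, c, a, q, r]" if M: "M \<in> wins w m s (h + 2)" "y \<in># M" "covered y m" for M m y
  proof (rule wins_abc[OF _ M])
    have len: "p - 1 + length [x, d, a, b, c, a, q, r] = p + 7" using sp by simp
    show "h + 2 \<le> p - 1 + length [x, d, a, b, c, a, q, r] \<or> (\<forall>k<h + 2. w k = y \<longrightarrow> k + m \<le> p - 1 + length [x, d, a, b, c, a, q, r])"
      unfolding len
    proof (cases "h = p + 5")
      case False
      have "k + m \<le> p + 7" if k: "k < h + 2" "w k = y" for k
      proof -
        have "y \<in> letters w s (p + 5)" using M(3) in_letters_abcd[of "p + 5" y] by (auto simp: covered_def)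
        then have kp: "k < p + 5" using run[of k] k False by (cases "k < p + 5") auto
        show ?thesis
        proof (cases "k = p + 4")
          case True
          then have "y = a" using k(2) pos(5) by simp
          then show ?thesis using M(3) abcd(1,2) True by (simp add: covered_def)
        next
          case False
          then show ?thesis using kp M(3) by (auto simp: covered_def)
        qed
      qed
      then show "h + 2 \<le> p + 7 \<or> (\<forall>k<h + 2. w k = y \<longrightarrow> k + m \<le> p + 7)" by blast
    qed simp
  qed (use block_x[of 2] in \<open>simp add: block_0 block_Suc numeral_eq_Suc q_def r_def\<close>)
  have pc: "pass s (h + 2) c a b"
  proof (rule passI)
    show "y = a \<or> y = b" if "{#c, y#} \<in> wins w 2 s (h + 2)" for y
      using L[OF that, of c] abcd x q r by (auto simp: sw)
  next
    show "{#a, c, a#} \<notin> wins w 3 s (h + 2)" by (rule notI, drule L[where y = c]) (use abcd x q r in \<open>auto simp: sw\<close>)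
    show "{#b, c, b#} \<notin> wins w 3 s (h + 2)" by (rule notI, drule L[where y = c]) (use abcd x q r in \<open>auto simp: sw\<close>)
  qed
  have pb: "pass s (h + 2) b a c"
  proof (rule passI)
    show "y = a \<or> y = c" if "{#b, y#} \<in> wins w 2 s (h + 2)" for y
      using L[OF that, of b] abcd x q r by (auto simp: sw)
  next
    show "{#a, b, a#} \<notin> wins w 3 s (h + 2)" by (rule notI, drule L[where y = b]) (use abcd x q r in \<open>auto simp: sw\<close>)
    show "{#c, b, c#} \<notin> wins w 3 s (h + 2)" by (rule notI, drule L[where y = b]) (use abcd x q r in \<open>auto simp: sw\<close>)
  qed
  have nba: "{#a, w i#} \<in> wins w 2 s (h + 2) \<and> {#a, w (i + 2)#} \<in> wins w 2 s (h + 2) \<and> {#a, w i, w (i + 2)#} \<in> wins w 3 s (h + 2)"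
    if "w (i + 1) = a" for i
    using S2[of i] S2[of "i + 1"] S3[of i] that by (simp add: numeral_eq_Suc win_nf add_mset_commute)
  have Na: "y = d \<or> y = b \<or> y = c \<or> y = q" if "{#a, y#} \<in> wins w 2 s (h + 2)" for y
    using L[OF that, of a] abcd x q r by (auto simp: sw)
  have a3: "{#u, y#} = {#x, d#} \<or> {#u, y#} = {#d, b#} \<or> {#u, y#} = {#b, c#} \<or> {#u, y#} = {#c, q#} \<or> {#u, y#} = {#q, r#}"
    if "{#a, u, y#} \<in> wins w 3 s (h + 2)" for u y
    using L[OF that, of a] abcd x q r by (auto simp: sw)
  have n4: "M \<notin> wins w 4 s (h + 2)" if "M = {#a, b, b, c#} \<or> M = {#a, b, c, c#}" for M
    using L[of M 4 c] that abcd x q r by (auto simp: sw)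
  have plain: "plain v" if v: "v \<notin> {a, b, c}" for v
  proof (cases "v \<in> range w")
    case False
    then show ?thesis unfolding plain_def by auto
  next
    case True
    then obtain k where k: "s \<le> k" "k < h + 2" "w k = v" using all by (metis in_letters_iff)
    consider "k \<le> p" | "p < k" "k < p + 5" | "p + 5 \<le> k" "k \<le> h" | "k = h + 1" using k by linarith
    then show ?thesis
    proof cases
      case 1
      have "plain (w k)"
      proof (rule tail_plain[OF _ _ S2 S3 k(1) 1])
        fix k l assume kl: "s < k" "k \<le> p" "p < l" "l < h + 2" "w k \<noteq> a"
        show "w l \<noteq> w k"
        proof
          assume e: "w l = w k"
          show False
          proof (cases "l < p + 5")
            case True then show False using after_p[of l] before[of k] kl e by auto
          next
            case False
            have "w l \<in> letters w s (p + 5)" unfolding e using kl by (intro in_lettersI) auto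
            then have "h = p + 5 \<and> l = p + 6" using run[of l] kl False by simp
            then show False using h(3) pos e kl by (simp add: numeral_eq_Suc)
          qed
        qed
      qed (use h k v in auto)
      then show ?thesis using k by simp
    next
      case 2 then show ?thesis using after_p[of k] k v by auto
    next
      case 3
      then show ?thesis using run_plain[OF h(2,3) _ h(1) S2 S3 3] sp k by simp
    next
      case 4
      then have vk: "v = w (h - 1)" using h(3) k by simp
      show ?thesis
      proof (cases "h = p + 5")
        case True then show ?thesis using vk pos v by (simp add: numeral_eq_Suc)
      next
        case False
        then have "plain (w (h - 1))" by (intro run_plain[OF h(2,3) _ h(1) S2 S3]) (use sp h(1) in auto)
        then show ?thesis using vk by simp
      qed
    qed
  qed
  show False
  proof (rule triangle_determined[of a b c d q])
    fix v assume "v \<notin> {a, b, c}" then show "plain v" by (rule plain)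
  next
    fix i assume "w (i + 1) = c"
    then show "w i = a \<and> w (i + 2) = b \<or> w i = b \<and> w (i + 2) = a" by (rule pass_through[OF pc _ S2 S2 S3])
  next
    fix i assume "w (i + 1) = b"
    then show "w i = a \<and> w (i + 2) = c \<or> w i = c \<and> w (i + 2) = a" by (rule pass_through[OF pb _ S2 S2 S3])
  next
    fix i assume i: "w (i + 1) = a"
    show "w (i + 2) = c \<or> w (i + 2) = d" if "w i = b"
      using a3[of "w i" "w (i + 2)"] nba[OF i] that abcd x q r by (auto simp: pair_mset)
    show "w (i + 2) = b \<or> w (i + 2) = q" if "w i = c"
      using a3[of "w i" "w (i + 2)"] nba[OF i] that abcd x q r by (auto simp: pair_mset)
  next
    have "w (i + 2) = (if w i = d then b else c)" if "w (i + 1) = a" "w i \<noteq> b" "w i \<noteq> c" for i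
      using a3[of "w i" "w (i + 2)"] Na[of "w i"] Na[of "w (i + 2)"] nba[OF that(1)] that abcd x q r by (auto simp: pair_mset)
    then show "w (i + 2) = w (j + 2)" if "w (i + 1) = a" "w (j + 1) = a" "w i = w j" "w i \<noteq> b" "w i \<noteq> c" for i j
      using that by simp
  next
    fix i
    show "\<not> (w i = c \<and> w (i + 1) = b \<and> w (i + 2) = a \<and> w (i + 3) = c)"
    proof
      assume h: "w i = c \<and> w (i + 1) = b \<and> w (i + 2) = a \<and> w (i + 3) = c"
      then have "win w i 4 = {#a, b, c, c#}" by (simp add: win_4)
      then show False using n4 S4[of i] by simp
    qed
    show "\<not> (w i = b \<and> w (i + 1) = c \<and> w (i + 2) = a \<and> w (i + 3) = b)"
    proof
      assume h: "w i = b \<and> w (i + 1) = c \<and> w (i + 2) = a \<and> w (i + 3) = b"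
      then have "win w i 4 = {#a, b, b, c#}" by (simp add: win_4)
      then show False using n4 S4[of i] by simp
    qed
  qed (use abcd in auto)
qed

lemma no_long_turn: False
proof (cases "w (p + 5) \<in> letters w s (p + 5)")
  case False
  then show False by (rule no_second_tail)
next
  case True
  have "win w (p + 4) 2 \<in> wins w 2 s (p + 5)"
    using slack_old[OF slack2, of "p + 4"] True sp by (simp add: numeral_eq_Suc)
  then have "{#a, w (p + 5)#} \<in> wins w 2 s (p + 5)" using pos by (simp add: numeral_eq_Suc win_nf)
  then have "w (p + 5) = b \<or> w (p + 5) = c \<or> w (p + 5) = d"
    using wins_5[of "{#a, w (p + 5)#}" 2 a] abcd x by (auto simp: sw)
  then show False using not_b_after turn_at_c back_to_d by blast
qed

end

section \<open>Starting inside the triangle\<close>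

text \<open>
  The turn in which the return at \<open>s\<close> already belongs to the triangle.
\<close>
locale short_turn = loopless_word +
  fixes s :: nat and a b c :: 'a
  assumes abc: "a \<noteq> b" "a \<noteq> c" "b \<noteq> c"
    and pos: "w s = b" "w (s + 1) = a" "w (s + 2) = b" "w (s + 3) = c" "w (s + 4) = a"
begin

lemma letters_5: "letters w s (s + 5) = {a, b, c}"
  using pos by (simp add: letters_Suc numeral_eq_Suc insert_commute) (auto simp: letters_def)

lemma c_fresh: "c \<notin> letters w s (s + 3)"
proof -
  have "letters w s (s + 3) = {a, b}"
    using pos by (simp add: letters_Suc numeral_eq_Suc insert_commute) (auto simp: letters_def)
  then show ?thesis using abc by simp
qed

lemma slack2: "slack 2 s (s + 5) 0"
proof -
  have "slack 2 s (s + 2) 1" by (rule slack_init) (simp add: letters_def card_insert_if numeral_eq_Suc atLeastLessThanSuc)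
  then have 1: "slack 2 s (s + 4) 1" by (rule slack_mono) auto
  have "win w (s + 3) 2 \<notin> wins w 2 s (s + 4)"
  proof
    assume x: "win w (s + 3) 2 \<in> wins w 2 s (s + 4)"
    have "c \<in># win w (s + 3) 2" using pos by (simp add: win_2)
    then obtain i where i: "s \<le> i" "i + 2 \<le> s + 4" "s + 3 < i + 2" "win w (s + 3) 2 = win w i 2"
      using wins_after[OF x _ c_fresh] by blast
    have "i = s + 2" using i(2,3) by linarith
    then show False using i(4) pos abc by (simp add: numeral_eq_Suc win_nf)
  qed
  moreover have "w (s + 4) \<in> letters w s (s + 4)" using in_lettersI[of s "s + 1" "s + 4" w] pos by simp
  ultimately show ?thesis using slack_event[of 1 s "s + 3" 1] 1 by (simp add: numeral_eq_Suc)
qed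

lemma slack3: "slack 3 s (s + 5) 1"
proof -
  have "letters w s (s + 3) = {a, b}"
    using pos by (simp add: letters_Suc numeral_eq_Suc insert_commute) (auto simp: letters_def)
  then have "slack 3 s (s + 3) 1" by (intro slack_init) (simp add: card_insert_if)
  then show ?thesis by (rule slack_mono) auto
qed

lemma slack4: "slack 4 s (s + 5) 1"
proof -
  have "letters w s (s + 4) = {a, b, c}"
    using pos by (simp add: letters_Suc numeral_eq_Suc insert_commute) (auto simp: letters_def)
  then have 1: "slack 4 s (s + 4) 2" by (intro slack_init) (simp add: card_insert_if)
  have "win w (s + 1) 4 \<notin> wins w 4 s (s + 4)"
  proof
    assume "win w (s + 1) 4 \<in> wins w 4 s (s + 4)"
    then obtain i where i: "s \<le> i" "i + 4 \<le> s + 4" "win w (s + 1) 4 = win w i 4" by (rule in_winsE)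
    have "i = s" using i(1,2) by linarith
    then show False using i(3) pos abc by (simp add: numeral_eq_Suc win_nf)
  qed
  moreover have "w (s + 4) \<in> letters w s (s + 4)" using in_lettersI[of s "s + 1" "s + 4" w] pos by simp
  ultimately show ?thesis using slack_event_4[OF 1, of "s + 1"] by (simp add: numeral_eq_Suc)
qed

text \<open>
  Until a fourth letter appears, the walk keeps running around the triangle in the same direction.
\<close>
lemma rotation:
  assumes g: "letters w s g = {a, b, c}" and k: "s + 1 \<le> k" "k + 2 < g"
  shows "w k = a \<and> w (k + 1) = b \<and> w (k + 2) = c \<or> w k = b \<and> w (k + 1) = c \<and> w (k + 2) = a \<or>
    w k = c \<and> w (k + 1) = a \<and> w (k + 2) = b" (is "?R k")
  using k
proof (induction k rule: less_induct)
  case (less k)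
  have base: "?R (s + 1)" "?R (s + 2)" using pos by (simp_all add: numeral_eq_Suc)
  show ?case
  proof (cases "k \<le> s + 2")
    case True
    then have "k = s + 1 \<or> k = s + 2" using less.prems by linarith
    then show ?thesis using base by blast
  next
    case False
    define l where "l = k - 1"
    have l: "k = l + 1" "s + 2 \<le> l" "l + 3 < g" using False less.prems by (auto simp: l_def)
    have Rl: "?R l" using less.IH[of l] l by simp
    have sub: "w (l + 3) \<in> {a, b, c}" unfolding g[symmetric] using l by (intro in_lettersI) auto
    have "w (l + 3) \<noteq> w (l + 1)"
    proof
      assume e: "w (l + 3) = w (l + 1)"
      have "win w (l + 1) 3 \<notin> wins w 3 s (l + 3)"
      proof
        assume "win w (l + 1) 3 \<in> wins w 3 s (l + 3)"
        then obtain j where j: "s \<le> j" "j + 3 \<le> l + 3" "win w (l + 1) 3 = win w j 3" by (rule in_winsE)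
        have m: "{#w (l + 1), w (l + 2), w (l + 1)#} = win w j 3" using j(3) e by (simp add: numeral_eq_Suc win_nf)
        show False
        proof (cases "j = s")
          case True
          then have "{#w (l + 1), w (l + 2), w (l + 1)#} = {#b, a, b#}" using m pos by (simp add: win_3)
          then show False using Rl abc by (elim disjE conjE) (simp_all add: pair_mset triple_mset)
        next
          case False
          then have "?R j" using less.IH[of j] j l by simp
          then have "{#w (l + 1), w (l + 2), w (l + 1)#} = {#a, b, c#}"
            using m by (elim disjE conjE) (simp_all add: win_3 add_mset_commute)
          then show False using Rl abc by (elim disjE conjE) (simp_all add: pair_mset triple_mset)
        qed
      qed
      moreover have "w (l + 3) \<in> letters w s (l + 3)" unfolding e using l by (intro in_lettersI) auto
      ultimately have "slack 3 s (l + 4) 0" using slack_event_3[OF slack3, of "l + 1"] l by (simp add: numeral_eq_Suc)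
      moreover have "slack 2 s (l + 4) 0" by (rule slack_mono[OF slack2]) (use l in auto)
      ultimately have "letters w s (l + 4) = range w" by (intro no_fresh) (use l in auto)
      then have "range w \<subseteq> {a, b, c}" using g letters_mono[of "l + 4" g w s] l by auto
      then have "card (range w) \<le> card {a, b, c}" by (intro card_mono) auto
      then show False using card_range n4 abc by simp
    qed
    moreover have "w (l + 3) \<noteq> w (l + 2)" by (rule no_loop_shifted)
    ultimately show ?thesis using Rl sub l(1) by (auto simp: numeral_eq_Suc)
  qed
qed

text \<open>
  The branch leaves the triangle at \<open>a\<close> after one round and uses up all slack at its end.
  Then \<open>triangle_determined\<close> applies: the walk re-enters the triangle at \<open>a\<close> in one direction only.
\<close>
lemma tail_at_a:
  assumes fr: "w (s + 5) \<notin> letters w s (s + 5)"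
  shows False
proof -
  have sg: "s \<le> s + 2" by simp
  have fr': "w (s + 2 + 3) \<notin> letters w s (s + 2 + 3)" "slack 2 s (s + 2 + 3) 0" "slack 3 s (s + 2 + 3) 1" "slack 4 s (s + 2 + 3) 1"
    using fr slack_mono[OF slack2, of "s + 5"] slack_mono[OF slack3, of "s + 5"] slack_mono[OF slack4, of "s + 5"] by (simp_all add: numeral_eq_Suc)
  have ne: "w (s + 2) \<noteq> w (s + 2 + 2)" using pos abc by (simp add: numeral_eq_Suc)
  from run_cost[OF fr'(2) sg fr'(1) ne fr'(3,4)]
  obtain h where h': "s + 2 + 3 \<le> h" "\<forall>k. s + 2 + 3 \<le> k \<longrightarrow> k \<le> h \<longrightarrow> w k \<notin> letters w s k" "w (h + 1) = w (h - 1)"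
    and sl: "slack 2 s (h + 2) 0" "slack 3 s (h + 2) (1 - 1)" "slack 4 s (h + 2) (1 - 1)"
    by blast
  have h1: "s + 5 \<le> h" using h'(1) by simp
  have h2: "w k \<notin> letters w s k" if "s + 5 \<le> k" "k \<le> h" for k using h'(2) that by simp
  note h = h1 h2 h'(3)
  have s2: "slack 2 s (h + 2) 0" and s3: "slack 3 s (h + 2) 0" and s4: "slack 4 s (h + 2) 0" using sl by simp_all
  have all: "letters w s (h + 2) = range w" by (rule no_fresh[OF s2 s3]) (use h in auto)
  have S2: "win w i 2 \<in> wins w 2 s (h + 2)" and S3: "win w i 3 \<in> wins w 3 s (h + 2)"
    and S4: "win w i 4 \<in> wins w 4 s (h + 2)" for i
    using saturated[OF s2 _ all] saturated[OF s3 _ all] saturated[OF s4 _ all] by auto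
  have run: "h = s + 5 \<and> k = s + 5 + 1" if "s + 5 \<le> k" "k \<le> h + 1" "w k \<in> letters w s (s + 5)" for k
    using run_letters[OF h(2,3,1) _ that] by simp
  have lg: "letters w s (s + 5) = {a, b, c}" using pos by (simp add: letters_Suc numeral_eq_Suc insert_commute) (auto simp: letters_def)
  define q where "q = w (s + 5)"
  define r where "r = w (s + 5 + 1)"
  have q: "q \<notin> {a, b, c}" unfolding lg[symmetric] q_def by (rule fr)
  have hr: "h = s + 5 \<Longrightarrow> r = a"
  proof -
    assume "h = s + 5"
    then have "w (h + 1) = r" "w (h - 1) = a" using pos by (simp_all add: r_def numeral_eq_Suc)
    then show "r = a" using h(3) by simp
  qed
  have r': "h \<noteq> s + 5 \<Longrightarrow> r \<notin> {a, b, c, q}"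
  proof -
    assume "h \<noteq> s + 5"
    then have "r \<notin> letters w s (s + 5 + 1)" unfolding r_def using h(1) by (intro h(2)) auto
    moreover have "letters w s (s + 5 + 1) = insert q {a, b, c}" using letters_Suc[of s "s + 5" w] lg by (simp add: q_def)
    ultimately show ?thesis by blast
  qed
  have r: "r = a \<or> r \<notin> {a, b, c, q}" using hr r' by blast
  have blk: "block w s 7 = [b, a, b, c, a, q, r]"
    using pos by (simp add: block_Suc block_0 numeral_eq_Suc q_def r_def)
  have L: "M \<in> subwins m [b, a, b, c, a, q, r]"
    if M: "M \<in> wins w m s (h + 2)" "y \<in># M" "y \<in> {a, b, c} \<and> m \<le> 3 \<or> m = 4 \<and> y \<in> {c}" for M m y
  proof (rule wins_subwins[OF _ M(1,2)])
    show "0 \<le> k \<and> k \<le> (if h = s + 5 then h + 1 else s + 7 - m)" if k: "s \<le> k" "k < h + 2" "w k = y" for k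
    proof (cases "h = s + 5")
      case True
      then show ?thesis using k by simp
    next
      case False
      have yl: "y \<in> letters w s (s + 5)" unfolding lg using M(3) by auto
      have kg: "k < s + 5"
      proof (rule ccontr)
        assume "\<not> ?thesis"
        then show False using run[of k] k yl False by simp
      qed
      have "m = 4 \<Longrightarrow> k \<le> s + 7 - 4"
      proof -
        assume "m = 4"
        then have "y \<in> {c}" using M(3) by auto
        moreover have "k = s + 5 - 1 \<Longrightarrow> w k = a" using pos by (simp add: numeral_eq_Suc)
        ultimately show ?thesis using kg k(3) abc by (cases "k = s + 5 - 1") auto
      qed
      then show ?thesis using kg False M(3) by auto
    qed
    show "h + 2 \<le> s + length [b, a, b, c, a, q, r] \<or> (if h = s + 5 then h + 1 else s + 7 - m) + m \<le> s + length [b, a, b, c, a, q, r]"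
      using M(3) by auto
  qed (use blk in \<open>simp_all add: numeral_eq_Suc\<close>)
  have pb: "pass s (h + 2) b a c"
  proof (rule passI)
    show "y = a \<or> y = c" if "{#b, y#} \<in> wins w 2 s (h + 2)" for y
      using L[OF that, of b] abc q r by (auto simp: pair_mset triple_mset)
  next
    show "{#a, b, a#} \<notin> wins w 3 s (h + 2)" by (rule notI, drule L[where y = b]) (use abc q r in \<open>auto simp: pair_mset triple_mset\<close>)
    show "{#c, b, c#} \<notin> wins w 3 s (h + 2)" by (rule notI, drule L[where y = b]) (use abc q r in \<open>auto simp: pair_mset triple_mset\<close>)
  qed
  have pc: "pass s (h + 2) c a b"
  proof (rule passI)
    show "y = a \<or> y = b" if "{#c, y#} \<in> wins w 2 s (h + 2)" for y
      using L[OF that, of c] abc q r by (auto simp: pair_mset triple_mset)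
  next
    show "{#a, c, a#} \<notin> wins w 3 s (h + 2)" by (rule notI, drule L[where y = c]) (use abc q r in \<open>auto simp: pair_mset triple_mset\<close>)
    show "{#b, c, b#} \<notin> wins w 3 s (h + 2)" by (rule notI, drule L[where y = c]) (use abc q r in \<open>auto simp: pair_mset triple_mset\<close>)
  qed
  have nba: "{#a, w i#} \<in> wins w 2 s (h + 2) \<and> {#a, w (i + 2)#} \<in> wins w 2 s (h + 2) \<and> {#a, w i, w (i + 2)#} \<in> wins w 3 s (h + 2)"
    if "w (i + 1) = a" for i
    using S2[of i] S2[of "i + 1"] S3[of i] that by (simp add: numeral_eq_Suc win_nf add_mset_commute)
  have Na: "y = b \<or> y = c \<or> y = q" if "{#a, y#} \<in> wins w 2 s (h + 2)" for y
    using L[OF that, of a] abc q r by (auto simp: pair_mset)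
  have a3: "{#u, y#} = {#b, b#} \<or> {#u, y#} = {#b, c#} \<or> {#u, y#} = {#c, q#} \<or> {#u, y#} = {#q, r#}"
    if "{#a, u, y#} \<in> wins w 3 s (h + 2)" for u y
    using L[OF that, of a] abc q r by (auto simp: pair_mset triple_mset)
  have n4: "M \<notin> wins w 4 s (h + 2)" if "M = {#a, b, c, c#}" for M
    using L[of M 4 c] that abc q r by (auto simp: pair_mset triple_mset)
  have plain: "plain v" if v: "v \<notin> {a, b, c}" for v
  proof (cases "v \<in> range w")
    case False
    then show ?thesis unfolding plain_def by auto
  next
    case True
    then obtain k where k: "s \<le> k" "k < h + 2" "w k = v" using all by (metis in_letters_iff)
    have kg: "s + 5 \<le> k"
    proof (rule ccontr)
      assume "\<not> ?thesis"
      then have "v \<in> letters w s (s + 5)" using k by (auto intro: in_lettersI)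
      then show False using v lg by simp
    qed
    show ?thesis
    proof (cases "k = h + 1")
      case False
      then show ?thesis using run_plain[OF h(2,3) _ h(1) S2 S3 kg] k by simp
    next
      case True
      then have vk: "v = w (h - 1)" using h(3) k by simp
      have hg: "h \<noteq> s + 5" using vk v pos by (auto simp: numeral_eq_Suc)
      then have "plain (w (h - 1))" by (intro run_plain[OF h(2,3) _ h(1) S2 S3]) (use h(1) in auto)
      then show ?thesis using vk by simp
    qed
  qed
  have tb: "w i = a \<and> w (i + 2) = c \<or> w i = c \<and> w (i + 2) = a" if "w (i + 1) = b" for i
    by (rule pass_through[OF pb that S2 S2 S3])
  show False
  proof (rule triangle_determined[of a c b q b])
    fix v assume "v \<notin> {a, c, b}" then show "plain v" using plain[of v] by auto
  next
    fix i assume "w (i + 1) = c"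
    then show "w i = a \<and> w (i + 2) = b \<or> w i = b \<and> w (i + 2) = a" by (rule pass_through[OF pc _ S2 S2 S3])
  next
    fix i assume i: "w (i + 1) = a"
    show "w (i + 2) = b \<or> w (i + 2) = q" if "w i = c"
      using a3[of "w i" "w (i + 2)"] nba[OF i] that abc q r by (auto simp: pair_mset)
    show "w (i + 2) = c \<or> w (i + 2) = b" if "w i = b"
      using a3[of "w i" "w (i + 2)"] nba[OF i] that abc q r by (auto simp: pair_mset)
  next
    have "w (i + 2) = c" if "w (i + 1) = a" "w i \<noteq> c" "w i \<noteq> b" for i
      using a3[of "w i" "w (i + 2)"] Na[of "w i"] Na[of "w (i + 2)"] nba[OF that(1)] that abc q r by (auto simp: pair_mset)
    then show "w (i + 2) = w (j + 2)" if "w (i + 1) = a" "w (j + 1) = a" "w i = w j" "w i \<noteq> c" "w i \<noteq> b" for i j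
      using that by simp
  next
    fix i
    show "\<not> (w i = b \<and> w (i + 1) = c \<and> w (i + 2) = a \<and> w (i + 3) = b)"
    proof
      assume h: "w i = b \<and> w (i + 1) = c \<and> w (i + 2) = a \<and> w (i + 3) = b"
      then have "w (i + 4) = c" using tb[of "i + 2"] abc by (simp add: numeral_eq_Suc)
      then have "win w (i + 1) 4 = {#a, b, c, c#}" using h by (simp add: numeral_eq_Suc win_nf)
      then show False using n4 S4[of "i + 1"] by simp
    qed
    show "\<not> (w i = c \<and> w (i + 1) = b \<and> w (i + 2) = a \<and> w (i + 3) = c)"
    proof
      assume h: "w i = c \<and> w (i + 1) = b \<and> w (i + 2) = a \<and> w (i + 3) = c"
      then have "win w i 4 = {#a, b, c, c#}" by (simp add: win_4)
      then show False using n4 S4[of i] by simp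
    qed
  qed (use abc tb in auto)
qed

text \<open>
  The branch leaves the triangle at \<open>b\<close>, one step after the first round, and uses up all slack at its
  end. This is \<open>triangle_with_turn\<close> with \<open>a\<close> and \<open>b\<close> exchanged, because of the initial \<open>b a b\<close>.
\<close>
lemma tail_at_b:
  assumes t5: "w (s + 5) = b" and fr: "w (s + 6) \<notin> letters w s (s + 6)"
  shows False
proof -
  have sg: "s \<le> s + 3" by simp
  have fr': "w (s + 3 + 3) \<notin> letters w s (s + 3 + 3)" "slack 2 s (s + 3 + 3) 0" "slack 3 s (s + 3 + 3) 1" "slack 4 s (s + 3 + 3) 1"
    using fr slack_mono[OF slack2, of "s + 6"] slack_mono[OF slack3, of "s + 6"] slack_mono[OF slack4, of "s + 6"] by (simp_all add: numeral_eq_Suc)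
  have ne: "w (s + 3) \<noteq> w (s + 3 + 2)" using pos t5 abc by (simp add: numeral_eq_Suc)
  from run_cost[OF fr'(2) sg fr'(1) ne fr'(3,4)]
  obtain h where h': "s + 3 + 3 \<le> h" "\<forall>k. s + 3 + 3 \<le> k \<longrightarrow> k \<le> h \<longrightarrow> w k \<notin> letters w s k" "w (h + 1) = w (h - 1)"
    and sl: "slack 2 s (h + 2) 0" "slack 3 s (h + 2) (1 - 1)" "slack 4 s (h + 2) (1 - 1)"
    by blast
  have h1: "s + 6 \<le> h" using h'(1) by simp
  have h2: "w k \<notin> letters w s k" if "s + 6 \<le> k" "k \<le> h" for k using h'(2) that by simp
  note h = h1 h2 h'(3)
  have s2: "slack 2 s (h + 2) 0" and s3: "slack 3 s (h + 2) 0" and s4: "slack 4 s (h + 2) 0" using sl by simp_all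
  have all: "letters w s (h + 2) = range w" by (rule no_fresh[OF s2 s3]) (use h in auto)
  have S2: "win w i 2 \<in> wins w 2 s (h + 2)" and S3: "win w i 3 \<in> wins w 3 s (h + 2)"
    and S4: "win w i 4 \<in> wins w 4 s (h + 2)" for i
    using saturated[OF s2 _ all] saturated[OF s3 _ all] saturated[OF s4 _ all] by auto
  have run: "h = s + 6 \<and> k = s + 6 + 1" if "s + 6 \<le> k" "k \<le> h + 1" "w k \<in> letters w s (s + 6)" for k
    using run_letters[OF h(2,3,1) _ that] by simp
  have lg: "letters w s (s + 6) = {a, b, c}" using pos t5 by (simp add: letters_Suc numeral_eq_Suc insert_commute) (auto simp: letters_def)
  define q where "q = w (s + 6)"
  define r where "r = w (s + 6 + 1)"
  have q: "q \<notin> {a, b, c}" unfolding lg[symmetric] q_def by (rule fr)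
  have hr: "h = s + 6 \<Longrightarrow> r = b"
  proof -
    assume "h = s + 6"
    then have "w (h + 1) = r" "w (h - 1) = b" using pos t5 by (simp_all add: r_def numeral_eq_Suc)
    then show "r = b" using h(3) by simp
  qed
  have r': "h \<noteq> s + 6 \<Longrightarrow> r \<notin> {a, b, c, q}"
  proof -
    assume "h \<noteq> s + 6"
    then have "r \<notin> letters w s (s + 6 + 1)" unfolding r_def using h(1) by (intro h(2)) auto
    moreover have "letters w s (s + 6 + 1) = insert q {a, b, c}" using letters_Suc[of s "s + 6" w] lg by (simp add: q_def)
    ultimately show ?thesis by blast
  qed
  have r: "r = b \<or> r \<notin> {a, b, c, q}" using hr r' by blast
  have blk: "block w s 8 = [b, a, b, c, a, b, q, r]"
    using pos t5 by (simp add: block_Suc block_0 numeral_eq_Suc q_def r_def)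
  have L: "M \<in> subwins m [b, a, b, c, a, b, q, r]"
    if M: "M \<in> wins w m s (h + 2)" "y \<in># M" "y \<in> {a, b, c} \<and> m \<le> 3 \<or> m = 4 \<and> y \<in> {a, c}" for M m y
  proof (rule wins_subwins[OF _ M(1,2)])
    show "0 \<le> k \<and> k \<le> (if h = s + 6 then h + 1 else s + 8 - m)" if k: "s \<le> k" "k < h + 2" "w k = y" for k
    proof (cases "h = s + 6")
      case True
      then show ?thesis using k by simp
    next
      case False
      have yl: "y \<in> letters w s (s + 6)" unfolding lg using M(3) by auto
      have kg: "k < s + 6"
      proof (rule ccontr)
        assume "\<not> ?thesis"
        then show False using run[of k] k yl False by simp
      qed
      have "m = 4 \<Longrightarrow> k \<le> s + 8 - 4"
      proof -
        assume "m = 4"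
        then have "y \<in> {a, c}" using M(3) by auto
        moreover have "k = s + 6 - 1 \<Longrightarrow> w k = b" using pos t5 by (simp add: numeral_eq_Suc)
        ultimately show ?thesis using kg k(3) abc by (cases "k = s + 6 - 1") auto
      qed
      then show ?thesis using kg False M(3) by auto
    qed
    show "h + 2 \<le> s + length [b, a, b, c, a, b, q, r] \<or> (if h = s + 6 then h + 1 else s + 8 - m) + m \<le> s + length [b, a, b, c, a, b, q, r]"
      using M(3) by auto
  qed (use blk in \<open>simp_all add: numeral_eq_Suc\<close>)
  have pc: "pass s (h + 2) c b a"
  proof (rule passI)
    show "y = b \<or> y = a" if "{#c, y#} \<in> wins w 2 s (h + 2)" for y
      using L[OF that, of c] abc q r by (auto simp: pair_mset triple_mset)
  next
    show "{#b, c, b#} \<notin> wins w 3 s (h + 2)" by (rule notI, drule L[where y = c]) (use abc q r in \<open>auto simp: pair_mset triple_mset\<close>)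
    show "{#a, c, a#} \<notin> wins w 3 s (h + 2)" by (rule notI, drule L[where y = c]) (use abc q r in \<open>auto simp: pair_mset triple_mset\<close>)
  qed
  have nba: "{#a, w i#} \<in> wins w 2 s (h + 2) \<and> {#a, w (i + 2)#} \<in> wins w 2 s (h + 2) \<and> {#a, w i, w (i + 2)#} \<in> wins w 3 s (h + 2)"
    if "w (i + 1) = a" for i
    using S2[of i] S2[of "i + 1"] S3[of i] that by (simp add: numeral_eq_Suc win_nf add_mset_commute)
  have nbb: "{#b, w i#} \<in> wins w 2 s (h + 2) \<and> {#b, w (i + 2)#} \<in> wins w 2 s (h + 2) \<and> {#b, w i, w (i + 2)#} \<in> wins w 3 s (h + 2)"
    if "w (i + 1) = b" for i
    using S2[of i] S2[of "i + 1"] S3[of i] that by (simp add: numeral_eq_Suc win_nf add_mset_commute)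
  have Na: "y = b \<or> y = c" if "{#a, y#} \<in> wins w 2 s (h + 2)" for y
    using L[OF that, of a] abc q r by (auto simp: pair_mset)
  have a3: "{#a, c, c#} \<notin> wins w 3 s (h + 2)"
    by (rule notI, drule L[where y = a]) (use abc q r in \<open>auto simp: pair_mset triple_mset\<close>)
  have Nb: "y = a \<or> y = c \<or> y = q" if "{#b, y#} \<in> wins w 2 s (h + 2)" for y
    using L[OF that, of b] abc q r by (auto simp: pair_mset)
  have b3: "{#u, y#} = {#a, b#} \<or> {#u, y#} = {#a, c#} \<or> {#u, y#} = {#a, q#} \<or> {#u, y#} = {#q, r#}"
    if "{#b, u, y#} \<in> wins w 3 s (h + 2)" for u y
    using L[OF that, of b] abc q r by (auto simp: pair_mset triple_mset)
  have n4: "{#b, a, c, c#} \<notin> wins w 4 s (h + 2)"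
    by (rule notI, drule L[where y = c]) (use abc q r in \<open>auto simp: pair_mset triple_mset\<close>)
  have d4: "r = b" if "{#b, b, a, q#} \<in> wins w 4 s (h + 2)"
    using L[OF that, of a] abc q r by (auto simp: pair_mset triple_mset)
  have plain: "plain v" if v: "v \<notin> {a, b, c}" for v
  proof (cases "v \<in> range w")
    case False
    then show ?thesis unfolding plain_def by auto
  next
    case True
    then obtain k where k: "s \<le> k" "k < h + 2" "w k = v" using all by (metis in_letters_iff)
    have kg: "s + 6 \<le> k"
    proof (rule ccontr)
      assume "\<not> ?thesis"
      then have "v \<in> letters w s (s + 6)" using k by (auto intro: in_lettersI)
      then show False using v lg by simp
    qed
    show ?thesis
    proof (cases "k = h + 1")
      case False
      then show ?thesis using run_plain[OF h(2,3) _ h(1) S2 S3 kg] k by simp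
    next
      case True
      then have vk: "v = w (h - 1)" using h(3) k by simp
      have hg: "h \<noteq> s + 6" using vk v pos t5 by (auto simp: numeral_eq_Suc)
      then have "plain (w (h - 1))" by (intro run_plain[OF h(2,3) _ h(1) S2 S3]) (use h(1) in auto)
      then show ?thesis using vk by simp
    qed
  qed
  show False
  proof (rule triangle_with_turn[of b a c q "s + 3"])
    fix v assume "v \<notin> {b, a, c}" then show "plain v" using plain[of v] by auto
  next
    fix i assume "w (i + 1) = c"
    then show "w i = b \<and> w (i + 2) = a \<or> w i = a \<and> w (i + 2) = b" by (rule pass_through[OF pc _ S2 S2 S3])
  next
    fix i assume i: "w (i + 1) = a"
    show "w i = b \<and> w (i + 2) = c \<or> w i = c \<and> w (i + 2) = b \<or> w i = b \<and> w (i + 2) = b"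
      using Na[of "w i"] Na[of "w (i + 2)"] nba[OF i] a3 by auto
  next
    fix i assume i: "w (i + 1) = b"
    show "w i = a \<and> w (i + 2) = q \<or> w i = q \<and> w (i + 2) = a \<or> w i = a \<and> w (i + 2) = c \<or> w i = c \<and> w (i + 2) = a"
      using Nb[of "w i"] Nb[of "w (i + 2)"] b3[of "w i" "w (i + 2)"] nbb[OF i] abc q r by (auto simp: pair_mset)
  next
    fix i show "win w i 4 \<noteq> {#b, a, c, c#}" using S4[of i] n4 by auto
  next
    fix i assume "win w i 4 = {#b, b, a, q#}"
    then have rb: "r = b" using d4 S4[of i] by simp
    then have "h = s + 6" using r' by blast
    then have "letters w s (s + 6 + 2) = range w" using all by simp
    moreover have "letters w s (s + 6 + 2) = insert r (insert q {a, b, c})"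
      using letters_Suc[of s "s + 6" w] letters_Suc[of s "s + 6 + 1" w] lg by (simp add: q_def r_def numeral_eq_Suc)
    ultimately show "range w \<subseteq> {b, a, c, q}" using rb by auto
  qed (use abc q pos in auto)
qed

lemma no_short_turn: False
proof -
  have "letters w s (s + 5) \<noteq> range w"
  proof
    assume "letters w s (s + 5) = range w"
    then have "card (range w) = card {a, b, c}" using letters_5 by simp
    then show False using card_range n4 abc by simp
  qed
  then obtain g where g: "s + 5 \<le> g" "w g \<notin> letters w s g" "letters w s g = {a, b, c}"
    using next_fresh[of s "s + 5"] letters_5 by auto
  note R = rotation[OF g(3)]
  define m where "m = g - 3"
  have m: "g = m + 3" "s + 2 \<le> m" using g(1) by (auto simp: m_def)
  have ne: "w m \<noteq> w (m + 2)" using R[of m] m abc by auto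
  have s2: "slack 2 s (m + 3) 0" and s3: "slack 3 s (m + 3) 1" and s4: "slack 4 s (m + 3) 1"
    by (rule slack_mono[OF slack2] slack_mono[OF slack3] slack_mono[OF slack4]; use m in simp)+
  have fr: "w (m + 3) \<notin> letters w s (m + 3)" using g(2) m by simp
  have "\<not> s + 7 \<le> g"
  proof
    assume g7: "s + 7 \<le> g"
    have 5: "w (s + 5) = b" using R[of "s + 3"] g7 pos abc by (auto simp: numeral_eq_Suc)
    have 6: "w (s + 6) = c" using R[of "s + 4"] g7 pos abc by (auto simp: numeral_eq_Suc)
    have "win w (s + 3) 4 \<notin> wins w 4 s (s + 6)"
    proof
      assume x: "win w (s + 3) 4 \<in> wins w 4 s (s + 6)"
      have e: "win w (s + 3) 4 = {#c, a, b, c#}" using pos 5 6 by (simp add: numeral_eq_Suc win_nf)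
      obtain i where i: "s \<le> i" "i + 4 \<le> s + 6" "{#c, a, b, c#} = win w i 4" using x unfolding e by (rule in_winsE)
      have "i = s \<or> i = s + 1 \<or> i = s + 2" using i(1,2) by linarith
      then show False using i(3) pos 5 abc by (elim disjE) (simp_all add: numeral_eq_Suc win_nf)
    qed
    moreover have "w (s + 6) \<in> letters w s (s + 6)" unfolding 6 using in_lettersI[of s "s + 3" "s + 6" w] pos by simp
    ultimately have "slack 4 s (s + 7) 0" using slack_event_4[OF slack4, of "s + 3"] by (simp add: numeral_eq_Suc)
    then have s40: "slack 4 s (m + 3) 0" by (rule slack_mono) (use g7 m in auto)
    have "s \<le> m" using m by simp
    from run_cost[OF s2 this fr ne s3 s40] show False by blast
  qed
  then have "g = s + 5 \<or> g = s + 6" using g(1) by linarith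
  then show False
  proof
    assume "g = s + 5" then show False using tail_at_a g(2) by simp
  next
    assume g6: "g = s + 6"
    then have "w (s + 5) = b" using R[of "s + 3"] pos abc by (auto simp: numeral_eq_Suc)
    then show False using tail_at_b g(2) g6 by simp
  qed
qed

end

context loopless_word
begin

lemma loopless_impossible: False
proof -
  obtain s e where "turn s e" using has_turn by blast
  then have t: "s + 3 \<le> e" "w (s + 2) = w s" "w (e + 1) = w (e - 2)"
    "\<And>i j. s < i \<Longrightarrow> i < j \<Longrightarrow> j \<le> e \<Longrightarrow> w i \<noteq> w j" by (auto simp: turn_def)
  define p where "p = e - 3"
  have p: "e = p + 3" "s \<le> p" using t(1) by (auto simp: p_def)
  have c: "w (p + 4) = w (p + 1)" using t(3) p by (simp add: numeral_eq_Suc)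
  show False
  proof (cases "p = s")
    case True
    interpret short_turn w n s "w (s + 1)" "w s" "w (s + 3)"
      by unfold_locales (use t(2) t(4)[of "s + 1" "s + 2"] t(4)[of "s + 1" "s + 3"] t(4)[of "s + 2" "s + 3"] c True p in auto)
    show False by (rule no_short_turn)
  next
    case False
    interpret turning_word w n s p "w (p + 1)" "w (p + 2)" "w (p + 3)" "w p"
      by unfold_locales (use t c False p in auto)
    show False by (rule no_long_turn)
  qed
qed

end

section \<open>Words with a doubled letter: depth of the branches\<close>

locale loop_word = const_word +
  fixes a :: 'a
  assumes ex_loop: "\<exists>i. w i = a \<and> w (i + 1) = a"
begin

lemma loop_after: "\<exists>s\<ge>T. w s = a \<and> w (s + 1) = a"
proof -
  obtain i where i: "w i = a" "w (i + 1) = a" using ex_loop by blast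
  obtain j where "T \<le> j" "win w j 2 = win w i 2" by (rule recurs_win)
  then have "T \<le> j \<and> w j = a \<and> w (j + 1) = a" using i by (auto simp: win_2 pair_mset)
  then show ?thesis by blast
qed

text \<open>
  The factor \<open>a a\<close> has as many pairs as letters.
\<close>
lemma loop_slack2:
  assumes "w s = a" "w (s + 1) = a" "s + 2 \<le> t"
  shows "slack 2 s t 0"
proof -
  have "letters w s (s + 2) = {a}" using assms by (simp add: letters_Suc numeral_eq_Suc) (simp add: letters_def)
  then have "slack 2 s (s + 2) 0" by (intro slack_init) simp
  then show ?thesis by (rule slack_mono) (use assms in auto)
qed

text \<open>
  A second doubled letter would be a new pair that is completed by an old letter.
\<close>
lemma only_loop:
  assumes "w j = w (j + 1)"
  shows "w j = a"
proof (rule ccontr)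
  assume na: "w j \<noteq> a"
  define b where "b = w j"
  obtain s where s: "w s = a" "w (s + 1) = a" using ex_loop by blast
  obtain k where k: "s \<le> k" "win w k 2 = win w j 2" by (rule recurs_win)
  have ex: "s \<le> k \<and> win w k 2 = {#b, b#}" using k assms by (simp add: win_2 b_def)
  obtain i where i: "s \<le> i \<and> win w i 2 = {#b, b#}" "\<forall>l<i. \<not> (s \<le> l \<and> win w l 2 = {#b, b#})"
    using ex exists_least_iff[of "\<lambda>i. s \<le> i \<and> win w i 2 = {#b, b#}"] by blast
  have wb: "w i = b" "w (i + 1) = b" using i(1) by (auto simp: win_2 pair_mset)
  then have "i \<noteq> s" using s na b_def by auto
  then have si: "s + 1 \<le> i" using i(1) by simp
  have "w (i + 1) \<in> letters w s (i + 1)" using in_lettersI[of s i "i + 1" w] wb i(1) by simp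
  then have "win w i 2 \<in> wins w 2 s (i + 1)"
    by (intro slack_old[OF loop_slack2[OF s order_refl]]) (use si in auto)
  then obtain l where "s \<le> l" "l + 2 \<le> i + 1" "win w i 2 = win w l 2" by (rule in_winsE)
  then show False using i by (metis Suc_eq_plus1 add_2_eq_Suc' less_Suc_eq_le not_less_eq Suc_le_mono)
qed

text \<open>
  Without slack for triples the turn at the end of a run must not complete a new triple, so it must have
  the form \<open>a a f a\<close>.
\<close>
lemma tight_fresh:
  assumes s: "w s = a" "w (s + 1) = a" and s3: "slack 3 s t 0" and t: "s + 3 \<le> t" "t \<le> f" and f: "w f \<notin> letters w s f"
  shows "w (f - 2) = a \<and> w (f - 1) = a \<and> w (f + 1) = a"
proof -
  obtain h where h: "f \<le> h" "\<And>k. f \<le> k \<Longrightarrow> k \<le> h \<Longrightarrow> w k \<notin> letters w s k" "w (Suc h) \<in> letters w s (Suc h)"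
    using run_end[OF f] t by auto
  have fh: "w h \<notin> letters w s h" using h(1,2) by simp
  have "win w h 2 \<in> wins w 2 s (h + 1)"
    by (rule slack_old[OF loop_slack2[OF s order_refl]]) (use h t in auto)
  then have b: "w (Suc h) = w (h - 1)" using fresh_turn[OF fh] t h(1) by simp
  define q where "q = h - 2"
  have q: "h = q + 2" "s + 1 \<le> q" using t h(1) by (auto simp: q_def)
  have "win w (q + 1) (Suc 2) \<in> wins w (Suc 2) s (q + 1 + 2)"
    by (rule slack_0_known[where t = t]) (use s3 t h q in \<open>auto simp: numeral_eq_Suc\<close>)
  then have k: "win w (h - 1) 3 \<in> wins w 3 s (Suc h)" using q by (simp add: numeral_eq_Suc)
  have eq: "w (h - 2) = w (h - 1)"
  proof (rule ccontr)
    assume "w (h - 2) \<noteq> w (h - 1)"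
    then show False using fresh_turn_new_class[OF fh _ b] k t h(1) by simp
  qed
  have "h = f"
  proof (rule ccontr)
    assume "h \<noteq> f"
    then have "w (h - 1) \<notin> letters w s (h - 1)" using h(1,2) by simp
    moreover have "w (h - 2) \<in> letters w s (h - 1)" using q by (intro in_lettersI) auto
    ultimately show False using eq by simp
  qed
  moreover have "w (h - 2) = a" using only_loop[of "h - 2"] eq q by (simp add: numeral_eq_Suc)
  ultimately show ?thesis using eq b by simp
qed

lemma wins_stable:
  assumes "slack m s T 0" "T \<le> T'" "letters w s T' = letters w s T" "s + m \<le> T'" "1 \<le> m"
  shows "wins w m s T' = wins w m s T"
proof -
  have "card (wins w m s T') \<le> card (wins w m s T)"
    using card_wins_le[OF assms(4,5)] assms(1,3) by (simp add: slack_def)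
  then show ?thesis using card_seteq[OF finite_wins wins_mono[OF assms(2)]] by metis
qed

lemma letters_stable:
  assumes "\<And>k. T \<le> k \<Longrightarrow> k < T' \<Longrightarrow> w k \<in> letters w s k" "s \<le> T" "T \<le> T'"
  shows "letters w s T' = letters w s T"
  using assms(3,1)
proof (induction T' rule: dec_induct)
  case (step t)
  have "w t \<in> letters w s t" by (rule step.prems) (use step in auto)
  moreover have "letters w s t = letters w s T" using step.IH step.prems by simp
  ultimately show ?case using letters_Suc[of s t w] step(1) assms(2) by (simp add: insert_absorb)
qed simp

lemma no_a4_before_fresh:
  assumes s: "s \<le> g" and f: "w (g + 2) \<notin> letters w s (g + 2)" and g: "w g = a" "w (g + 1) = a" "w (g + 3) = a"
    and ne: "g = s \<or> w (g - 1) \<noteq> a"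
  shows "win w g 4 \<notin> wins w 4 s (g + 3)"
proof
  assume k: "win w g 4 \<in> wins w 4 s (g + 3)"
  have "w (g + 2) \<in># win w g 4" by (simp add: win_4)
  then obtain i where i: "s \<le> i" "i + 4 \<le> g + 3" "g + 2 < i + 4" "win w g 4 = win w i 4" using wins_after[OF k _ f] by blast
  have "g = i + 1" using i(2,3) by linarith
  then show False using i(1,4) ne g by (auto simp: numeral_eq_Suc win_nf)
qed

text \<open>
  The first letter that never occurs next to \<open>a\<close>, seen from the last \<open>a a\<close> before it.
\<close>
lemma far_letter_after_loop:
  assumes far: "z \<in> range w" "{#a, z#} \<notin> range (\<lambda>i. win w i 2)"
  shows "\<exists>s z. w s = a \<and> w (s + 1) = a \<and> s + 3 \<le> z \<and> w z \<notin> letters w s z \<and> {#a, w z#} \<notin> range (\<lambda>i. win w i 2) \<and>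
    (\<forall>k. s < k \<longrightarrow> k \<le> z \<longrightarrow> \<not> (w k = a \<and> w (k + 1) = a)) \<and>
    (\<forall>k. s \<le> k \<longrightarrow> k < z \<longrightarrow> {#a, w k#} \<in> range (\<lambda>i. win w i 2))"
proof -
  obtain s0 where s0: "w s0 = a" "w (s0 + 1) = a" using ex_loop by blast
  have aa: "{#a, a#} \<in> range (\<lambda>i. win w i 2)" using s0 by (auto simp: win_2 intro!: image_eqI[of _ _ s0])
  obtain k where "s0 \<le> k" "w k = z" using far(1) letter_recurs[of s0] by (metis rangeE)
  then have "s0 \<le> k \<and> {#a, w k#} \<notin> range (\<lambda>i. win w i 2)" using far by simp
  then obtain z' where z': "s0 \<le> z' \<and> {#a, w z'#} \<notin> range (\<lambda>i. win w i 2)"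
    "\<forall>i<z'. \<not> (s0 \<le> i \<and> {#a, w i#} \<notin> range (\<lambda>i. win w i 2))"
    using exists_least_iff[of "\<lambda>k. s0 \<le> k \<and> {#a, w k#} \<notin> range (\<lambda>i. win w i 2)"] by blast
  define P where "P y \<longleftrightarrow> y < z' \<and> w y = a \<and> w (y + 1) = a" for y
  have za: "w z' \<noteq> a" using z'(1) aa by auto
  then have P0: "P s0" using z'(1) s0 unfolding P_def by (metis le_neq_implies_less)
  define s where "s = (GREATEST y. P y)"
  have bd: "\<And>y. P y \<Longrightarrow> y \<le> z'" by (simp add: P_def)
  have s: "P s" "\<And>y. P y \<Longrightarrow> y \<le> s"
    unfolding s_def using GreatestI_nat[of P, OF P0 bd] Greatest_le_nat[of P, OF _ bd] by blast+
  have ss: "s0 \<le> s" using s(2)[OF P0] .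
  have sa: "w s = a" "w (s + 1) = a" "s < z'" using s(1) by (auto simp: P_def)
  have "z' \<noteq> s + 1" using sa za by auto
  moreover have "z' \<noteq> s + 2"
  proof
    assume "z' = s + 2"
    then have "win w (s + 1) 2 = {#a, w z'#}" using sa by (simp add: win_2)
    then show False using z'(1) by (metis rangeI)
  qed
  ultimately have 3: "s + 3 \<le> z'" using sa(3) by linarith
  have near: "{#a, w k#} \<in> range (\<lambda>i. win w i 2)" if "s \<le> k" "k < z'" for k using z'(2) that ss by auto
  have fr: "w z' \<notin> letters w s z'"
  proof
    assume "w z' \<in> letters w s z'"
    then obtain k where "s \<le> k" "k < z'" "w k = w z'" by (auto simp: in_letters_iff)
    then show False using near[of k] z'(1) by simp
  qed
  have "\<not> (w k = a \<and> w (k + 1) = a)" if "s < k" "k \<le> z'" for k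
    using s(2)[of k] that za by (cases "k = z'") (auto simp: P_def)
  then show ?thesis using sa 3 fr z'(1) near by blast
qed

text \<open>
  The common final situation of a branch \<open>a x z\<close>, with \<open>f\<close> a further neighbour of \<open>a\<close> or equal to \<open>x\<close>: the
  walk goes from \<open>a a\<close> to \<open>x\<close> and to \<open>f\<close> in turn, and three letters determine the next one.
\<close>
lemma loop_final:
  fixes x z f :: 'a
  defines "P \<equiv> \<lambda>m. range (\<lambda>i. win w i m)"
  assumes xz: "x \<noteq> a" "z \<noteq> a" "z \<noteq> x" "f \<noteq> a" "f \<noteq> z"
    and Ea: "\<And>y. {#a, y#} \<in> P 2 \<Longrightarrow> y = a \<or> y = x \<or> y = f"
    and A3: "\<And>u v. {#a, u, v#} \<in> P 3 \<Longrightarrow> {#u, v#} = {#a, x#} \<or> {#u, v#} = {#x, z#} \<or> {#u, v#} = {#a, f#}"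
    and Ex: "\<And>y. {#x, y#} \<in> P 2 \<Longrightarrow> y = a \<or> y = z"
    and Rx: "{#x, z, z#} \<notin> P 3"
    and Ef: "\<And>y. f \<noteq> x \<Longrightarrow> {#f, y#} \<in> P 2 \<Longrightarrow> y = a"
    and n4: "{#a, a, a, x#} \<notin> P 4" "f \<noteq> x \<Longrightarrow> {#a, a, x, x#} \<notin> P 4" "f \<noteq> x \<Longrightarrow> {#a, a, f, f#} \<notin> P 4"
    and others: "\<And>y i j. y \<notin> {a, x, f} \<Longrightarrow> w i = w j \<Longrightarrow> w (i + 1) = y \<Longrightarrow> w (j + 1) = y \<Longrightarrow> w (i + 2) = w (j + 2)"
  shows False
proof -
  have E: "{#w (k + 2), w (k + 1)#} \<in> P 2" "{#w (k + 2), w (k + 3)#} \<in> P 2" "{#w (k + 1), w k#} \<in> P 2" for k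
    unfolding P_def by (rule image_eqI[of _ _ "k + 1"] image_eqI[of _ _ "k + 2"] image_eqI[of _ _ k];
      simp add: numeral_eq_Suc win_nf add_mset_commute)+
  have T3: "{#w (k + 2), w (k + 1), w (k + 3)#} \<in> P 3" "{#w (k + 1), w k, w (k + 2)#} \<in> P 3"
     "{#w (k + 2), w (k + 1), w k#} \<in> P 3" for k
    unfolding P_def by (rule image_eqI[of _ _ "k + 1"] image_eqI[of _ _ k] image_eqI[of _ _ k];
      simp add: numeral_eq_Suc win_nf add_mset_commute)+
  have T4: "{#w k, w (k + 1), w (k + 2), w (k + 3)#} \<in> P 4" for k
    unfolding P_def by (rule image_eqI[of _ _ k]; simp add: win_4)
  have D: "w (k + 3) = (if w (k + 1) \<noteq> a then a else if f = x then x else if w k = x then f else x)" if y: "w (k + 2) = a" for k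
  proof (cases "w (k + 1) = a")
    case False
    have v: "w (k + 1) = x \<or> w (k + 1) = f" using Ea[of "w (k + 1)"] E(1)[of k] y False by auto
    have t: "w (k + 3) \<noteq> z" using Ea[of "w (k + 3)"] E(2)[of k] y xz by auto
    show ?thesis using A3[of "w (k + 1)" "w (k + 3)"] T3(1)[of k] y v t xz False by (auto simp: pair_mset)
  next
    case True
    have t: "w (k + 3) = x \<or> w (k + 3) = f" using A3[of "w (k + 1)" "w (k + 3)"] T3(1)[of k] y True xz by (auto simp: pair_mset)
    have u: "w k = x \<or> w k = f" using A3[of "w (k + 1)" "w k"] T3(3)[of k] y True xz by (auto simp: pair_mset)
    have 4: "{#a, a, w k, w (k + 3)#} \<in> P 4" using T4[of k] y True by (simp add: add_mset_commute)
    show ?thesis using t u 4 n4(2,3) True by auto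
  qed
  have Dx: "w (k + 3) = (if w (k + 1) = z then a else z)" if y: "w (k + 2) = x" for k
  proof -
    have v: "w (k + 1) = a \<or> w (k + 1) = z" using Ex[of "w (k + 1)"] E(1)[of k] y by simp
    have t: "w (k + 3) = a \<or> w (k + 3) = z" using Ex[of "w (k + 3)"] E(2)[of k] y by simp
    show ?thesis
    proof (cases "w (k + 1) = z")
      case True
      then show ?thesis using Rx T3(1)[of k] y t by auto
    next
      case False
      then have va: "w (k + 1) = a" using v by simp
      have uz: "w k \<noteq> z" using Ea[of "w k"] E(3)[of k] va xz by auto
      have ua: "w k = a" using A3[of "w k" x] T3(2)[of k] va y xz uz by (auto simp: pair_mset)
      have "w (k + 3) \<noteq> a"
      proof
        assume "w (k + 3) = a"
        then have "{#a, a, a, x#} \<in> P 4" using T4[of k] ua va y by (simp add: add_mset_commute)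
        then show False using n4(1) by simp
      qed
      then show ?thesis using t False by simp
    qed
  qed
  obtain i j where ij: "\<forall>l<3. w (i + l) = w (j + l)" "w (i + 3) \<noteq> w (j + 3)" using branching[of 0 3] by blast
  have e: "w i = w j" "w (i + 1) = w (j + 1)" "w (i + 2) = w (j + 2)"
    using ij(1)[rule_format, of 0] ij(1)[rule_format, of 1] ij(1)[rule_format, of 2] by simp_all
  consider "w (i + 2) = a" | "w (i + 2) = x" | "w (i + 2) = f" "f \<noteq> x" | "w (i + 2) \<notin> {a, x, f}" by auto
  then show False
  proof cases
    case 1
    have "w (j + 2) = a" using 1 e(3) by simp
    have "w (i + 3) = w (j + 3)" unfolding D[OF 1] D[OF \<open>w (j + 2) = a\<close>] e(1,2) by (rule refl)
    then show False using ij(2) by simp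
  next
    case 2
    have "w (j + 2) = x" using 2 e(3) by simp
    have "w (i + 3) = w (j + 3)" unfolding Dx[OF 2] Dx[OF \<open>w (j + 2) = x\<close>] e(2) by (rule refl)
    then show False using ij(2) by simp
  next
    case 3
    have "w (i + 3) = a" using Ef[OF 3(2), of "w (i + 3)"] E(2)[of i] 3(1) by simp
    moreover have "w (j + 3) = a" using Ef[OF 3(2), of "w (j + 3)"] E(2)[of j] 3(1) e(3) by simp
    ultimately show False using ij(2) by simp
  next
    case 4
    have "w (i + 1 + 2) = w (j + 1 + 2)"
      by (rule others[OF 4]) (use e in \<open>simp_all add: numeral_eq_Suc\<close>)
    then show False using ij(2) by (simp add: numeral_eq_Suc)
  qed
qed

text \<open>
  The case in which the walk turns back at \<open>x\<close>, the first letter after \<open>a a\<close>, before it gets to depth two: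
  the factors \<open>a a x a\<close> and the later run exhaust the slack, and the next \<open>a a\<close> cannot be paid.
\<close>
lemma no_deep_branch_2:
  assumes s: "w s = a" "w (s + 1) = a" and z: "s + 3 \<le> z" "w z \<notin> letters w s z" "{#a, w z#} \<notin> range (\<lambda>i. win w i 2)"
    and noaa: "\<And>k. s < k \<Longrightarrow> k \<le> z \<Longrightarrow> \<not> (w k = a \<and> w (k + 1) = a)"
    and 3: "w (s + 3) = a"
  shows False
proof -
  have ns3: False if "slack 3 s t 0" "s + 3 \<le> t" "t \<le> z" for t
  proof -
    have "w (z - 2) = a" "w (z - 1) = a" using tight_fresh[OF s that(1,2,3) z(2)] by simp_all
    moreover have "z - 2 + 1 = z - 1" "s < z - 2" "z - 2 \<le> z" using z(1) by auto
    ultimately show False using noaa[of "z - 2"] by simp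
  qed
  define x y where "x = w (s + 2)" and "y = w (s + 4)"
  have x: "x \<noteq> a" using noaa[of "s + 1"] s z(1) by (simp add: x_def numeral_eq_Suc)
  have l3: "letters w s (s + 3) = {a, x}" using s by (simp add: letters_Suc numeral_eq_Suc insert_commute x_def) (simp add: letters_def)
  have l4: "letters w s (s + 4) = {a, x}" using l3 letters_Suc[of s "s + 3" w] 3 by (simp add: numeral_eq_Suc)
  have sl3: "slack 3 s (s + 3) 1" using l3 by (intro slack_init) (simp add: card_insert_if)
  have sl4: "slack 4 s (s + 4) 1" using l4 by (intro slack_init) (simp add: card_insert_if)
  have aa: "{#a, a#} \<in> range (\<lambda>i. win w i 2)" using s by (auto simp: win_2 intro!: image_eqI[of _ _ s])
  have "z \<noteq> s + 3" using z(3) aa 3 by auto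
  moreover have "z \<noteq> s + 4"
  proof
    assume "z = s + 4"
    then have "win w (s + 3) 2 = {#a, w z#}" using 3 by (simp add: numeral_eq_Suc win_nf)
    then show False using z(3) by (metis rangeI)
  qed
  ultimately have z5: "s + 5 \<le> z" using z(1) by linarith
  have y: "y \<noteq> a" using noaa[of "s + 3"] 3 z5 by (simp add: y_def numeral_eq_Suc)
  have yx: "y \<noteq> x"
  proof
    assume e: "y = x"
    have "win w (s + 2) 3 \<notin> wins w 3 s (s + 4)"
    proof
      assume "win w (s + 2) 3 \<in> wins w 3 s (s + 4)"
      then obtain i where i: "s \<le> i" "i + 3 \<le> s + 4" "win w (s + 2) 3 = win w i 3" by (rule in_winsE)
      have "i = s \<or> i = s + 1" using i(1,2) by linarith
      then show False using i(3) s 3 e x unfolding x_def y_def by (elim disjE) (simp_all add: numeral_eq_Suc win_nf)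
    qed
    moreover have "w (s + 4) \<in> letters w s (s + 4)" using e l4 by (simp add: y_def)
    ultimately have "slack 3 s (s + 5) 0" using slack_event_3[OF sl3, of "s + 2"] by (simp add: numeral_eq_Suc)
    then show False using ns3[of "s + 5"] z5 by simp
  qed
  have yf: "w (s + 4) \<notin> letters w s (s + 4)" using y yx l4 by (simp add: y_def)
  have f5: "w (s + 5) \<notin> letters w s (s + 5)"
  proof
    assume o: "w (s + 5) \<in> letters w s (s + 5)"
    have "win w (s + 4) 2 \<in> wins w 2 s (s + 4 + 1)"
      by (rule slack_old[OF loop_slack2[OF s order_refl]]) (use o in \<open>auto simp: numeral_eq_Suc\<close>)
    then have t: "w (s + 5) = a" using fresh_turn[OF yf] 3 by (simp add: numeral_eq_Suc)
    have "win w (s + 3) 3 \<notin> wins w 3 s (s + 5)"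
    proof
      assume k: "win w (s + 3) 3 \<in> wins w 3 s (s + 5)"
      have "w (s + 4) \<in># win w (s + 3) 3" by (simp add: numeral_eq_Suc win_nf)
      then obtain i where i: "s \<le> i" "i + 3 \<le> s + 5" "s + 4 < i + 3" "win w (s + 3) 3 = win w i 3" using wins_after[OF k _ yf] by blast
      have "i = s + 2" using i(2,3) by linarith
      then show False using i(4) 3 t x y yx unfolding x_def y_def by (simp add: numeral_eq_Suc win_nf)
    qed
    then have "slack 3 s (s + 6) 0" using slack_event_3[OF sl3, of "s + 3"] o by (simp add: numeral_eq_Suc)
    moreover have "z \<noteq> s + 5" using z(3) aa t by auto
    ultimately show False using ns3[of "s + 6"] z5 by simp
  qed
  have "w (s + 2) \<noteq> w (s + 2 + 2)" "w (s + 2 + 1) \<noteq> w (s + 2 + 2)" using yx y 3 by (simp_all add: numeral_eq_Suc x_def y_def)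
  moreover have "slack 2 s (s + 2 + 3) 0" by (rule loop_slack2[OF s]) simp
  moreover have "slack 3 s (s + 2 + 3) 1" by (rule slack_mono[OF sl3]) auto
  moreover have "slack 4 s (s + 2 + 3) 1" by (rule slack_mono[OF sl4]) auto
  moreover have "w (s + 2 + 3) \<notin> letters w s (s + 2 + 3)" using f5 by (simp add: numeral_eq_Suc)
  moreover have "s \<le> s + 2" by simp
  ultimately obtain h where h': "s + 2 + 3 \<le> h" "\<forall>k. s + 2 + 3 \<le> k \<longrightarrow> k \<le> h \<longrightarrow> w k \<notin> letters w s k" "w (h + 1) = w (h - 1)"
    and sl: "slack 3 s (h + 2) (1 - 1)" "slack 4 s (h + 2) (1 - 1)"
    using fresh_run_cost[of s "s + 2" 1 1] by blast
  have h1: "s + 5 \<le> h" using h'(1) by simp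
  have h2: "w k \<notin> letters w s k" if "s + 5 \<le> k" "k \<le> h" for k using h'(2) that by simp
  have s3: "slack 3 s (h + 2) 0" and s4: "slack 4 s (h + 2) 0" using sl by simp_all
  have run_a: "w k \<noteq> a" if "s + 4 \<le> k" "k \<le> h" for k
  proof (cases "k = s + 4")
    case False
    then have "w k \<notin> letters w s k" using h2 that by simp
    moreover have "a \<in> letters w s k" using in_lettersI[of s s k w] s that by simp
    ultimately show ?thesis by auto
  qed (use y in \<open>simp add: y_def\<close>)
  have occ: "k \<le> s + 3" if "s \<le> k" "k < h + 2" "w k = a" for k
  proof (rule ccontr)
    assume "\<not> ?thesis"
    then show False using run_a[of k] run_a[of "h - 1"] h'(3) h1 that by (cases "k = h + 1") auto
  qed
  define u v where "u = w (s + 5)" and "v = w (s + 6)"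
  have uv: "u \<noteq> a" "v \<noteq> a" using occ[of "s + 5"] occ[of "s + 6"] h1 by (auto simp: u_def v_def)
  have blk: "block w s (length [a, a, x, a, y, u, v]) = [a, a, x, a, y, u, v]"
    using s 3 by (simp add: block_Suc block_0 numeral_eq_Suc x_def y_def u_def v_def)
  have L: "M \<in> subwins m [a, a, x, a, y, u, v]" if M: "M \<in> wins w m s (h + 2)" "a \<in># M" "m \<le> 4" for M m
    by (rule wins_subwins[OF blk M(1,2), of 0 "s + 3"]) (use occ M(3) in auto)
  (* g is the next doubled a. Neither lengths 3 nor 4 have slack left, but the letters around it form a new class. *)
  obtain j where j: "h + 2 \<le> j \<and> w j = a \<and> w (j + 1) = a" using loop_after by blast
  obtain g where g: "h + 2 \<le> g \<and> w g = a \<and> w (g + 1) = a" "\<forall>i<g. \<not> (h + 2 \<le> i \<and> w i = a \<and> w (i + 1) = a)"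
    using j exists_least_iff[of "\<lambda>j. h + 2 \<le> j \<and> w j = a \<and> w (j + 1) = a"] by blast
  have old: "w k \<in> letters w s k" if "h + 2 \<le> k" "k < g + 2" for k
  proof (rule ccontr)
    assume f: "w k \<notin> letters w s k"
    have aa: "w (k - 2) = a" "w (k - 1) = a" using tight_fresh[OF s s3 _ that(1) f] h1 by simp_all
    define l where "l = k - 2"
    have l: "k = l + 2" "s + 5 \<le> l" "l < g" using that h1 by (auto simp: l_def)
    have la: "w l = a" "w (l + 1) = a" using aa l by (simp_all add: numeral_eq_Suc)
    have "\<not> l < h + 2" using occ[of l] la(1) l by auto
    then show False using g(2) la l(3) by auto
  qed
  have ls: "letters w s (g + 2) = letters w s (h + 2)" by (rule letters_stable) (use old h1 g in auto)
  have w3: "wins w 3 s (g + 2) = wins w 3 s (h + 2)" by (rule wins_stable[OF s3 _ ls]) (use g h1 in auto)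
  define q r where "q = g - 1" and "r = w (g - 1)"
  have q: "g = q + 1" "s + 5 < q" "h + 1 \<le> q" using g h1 by (auto simp: q_def)
  have ra: "r \<noteq> a"
  proof
    assume "r = a"
    then have "w q = a" by (simp add: r_def q_def)
    moreover have "w (q + 1) = a" using q(1) g(1) by simp
    moreover have "\<not> q < h + 2" using occ[of q] \<open>w q = a\<close> q(2) by auto
    ultimately show False using g(2) q(1) by auto
  qed
  have "win w q 3 \<in> wins w 3 s (g + 2)" by (rule in_winsI) (use q in auto)
  moreover have wq: "win w q 3 = {#r, a, a#}" using g q by (simp add: numeral_eq_Suc win_nf r_def)
  ultimately have "{#r, a, a#} \<in> wins w 3 s (h + 2)" using w3 by simp
  then have rx: "r = x" using L[of "{#r, a, a#}" 3] x y uv ra by (auto simp: pair_mset triple_mset)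
  show False
  proof (cases "w (g + 2) \<in> letters w s (g + 2)")
    case False
    have t: "w (g + 3) = a" using tight_fresh[OF s s3 _ _ False] h1 g by (simp add: numeral_eq_Suc)
    have "win w g 4 \<notin> wins w 4 s (g + 3)"
      by (rule no_a4_before_fresh) (use False g t ra q h1 in \<open>auto simp: r_def\<close>)
    moreover have "w (g + 3) \<in> letters w s (g + 3)" unfolding t using in_lettersI[of s g "g + 3" w] g h1 by simp
    ultimately show False using slack_event_4[OF s4, of g] g h1 by simp
  next
    case True
    have ls3: "letters w s (g + 3) = letters w s (h + 2)" using ls True letters_Suc[of s "g + 2" w] q by (simp add: numeral_eq_Suc insert_absorb)
    have "wins w 3 s (g + 3) = wins w 3 s (h + 2)" by (rule wins_stable[OF s3 _ ls3]) (use g h1 in auto)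
    moreover have "win w g 3 \<in> wins w 3 s (g + 3)" by (rule in_winsI) (use q in auto)
    ultimately have "{#a, a, w (g + 2)#} \<in> wins w 3 s (h + 2)" using g by (simp add: win_3)
    then have t: "w (g + 2) = x" using L[of "{#a, a, w (g + 2)#}" 3] x y uv by (auto simp: pair_mset triple_mset)
    have "wins w 4 s (g + 3) = wins w 4 s (h + 2)" by (rule wins_stable[OF s4 _ ls3]) (use g h1 in auto)
    moreover have "win w q 4 \<in> wins w 4 s (g + 3)" by (rule in_winsI) (use q in auto)
    moreover have "win w q 4 = {#x, a, a, x#}" using g q t rx by (simp add: numeral_eq_Suc win_nf r_def)
    ultimately show False using L[of "{#x, a, a, x#}" 4] x y yx uv by (auto simp: pair_mset triple_mset)
  qed
qed

text \<open>
  The case in which the walk goes on from \<open>a a x\<close> to a new letter \<open>z\<close>. After the run there is no slack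
  for triples and one unit for length 4. It is used up just after the walk has come back to \<open>a a\<close>.
\<close>
lemma no_deep_branch_1:
  assumes s: "w s = a" "w (s + 1) = a" and x2: "w (s + 2) \<noteq> a" and f3: "w (s + 3) \<notin> letters w s (s + 3)"
  shows False
proof -
  define x z where "x = w (s + 2)" and "z = w (s + 3)"
  have x: "x \<noteq> a" using x2 by (simp add: x_def)
  have l3: "letters w s (s + 3) = {a, x}" using s by (simp add: letters_Suc numeral_eq_Suc insert_commute x_def) (simp add: letters_def)
  have z: "z \<noteq> a" "z \<noteq> x" using f3 l3 by (auto simp: z_def)
  have sl3: "slack 3 s (s + 3) 1" using l3 by (intro slack_init) (simp add: card_insert_if)
  have sl4: "slack 4 s (s + 3) 2" using l3 by (simp add: slack_def card_insert_if)
  have "w s \<noteq> w (s + 2)" "w (s + 1) \<noteq> w (s + 2)" using s x2 by auto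
  then obtain h where h: "s + 3 \<le> h" "\<forall>k. s + 3 \<le> k \<longrightarrow> k \<le> h \<longrightarrow> w k \<notin> letters w s k" "w (h + 1) = w (h - 1)"
    and sl: "slack 3 s (h + 2) (1 - 1)" "slack 4 s (h + 2) (2 - 1)"
    using fresh_run_cost[of s s 1 2] loop_slack2[OF s, of "s + 3"] f3 sl3 sl4 by auto
  have h2: "w k \<notin> letters w s k" if "s + 3 \<le> k" "k \<le> h" for k using h(2) that by simp
  have s3: "slack 3 s (h + 2) 0" and s4: "slack 4 s (h + 2) 1" using sl by simp_all
  have run_a: "w k \<noteq> a" if "s + 2 \<le> k" "k \<le> h" for k
  proof (cases "k = s + 2")
    case False
    then have "w k \<notin> letters w s k" using h2 that by simp
    moreover have "a \<in> letters w s k" using in_lettersI[of s s k w] s that by simp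
    ultimately show ?thesis by auto
  qed (use x2 in simp)
  have occ: "k \<le> s + 1" if "s \<le> k" "k < h + 2" "w k = a" for k
  proof (rule ccontr)
    assume "\<not> ?thesis"
    then show False using run_a[of k] run_a[of "h - 1"] h(1,3) that by (cases "k = h + 1") auto
  qed
  define v where "v = w (s + 4)"
  have v: "v = x \<or> v \<notin> {a, x, z}" and xocc: "k = s + 2 \<or> k = s + 4 \<and> h = s + 3" if "s \<le> k" "k < h + 2" "w k = x" for k
  proof -
    show "v = x \<or> v \<notin> {a, x, z}"
    proof (cases "h = s + 3")
      case True
      then show ?thesis using h(3) by (simp add: v_def x_def numeral_eq_Suc)
    next
      case False
      then have "w (s + 4) \<notin> letters w s (s + 4)" using h2[of "s + 4"] h(1) by simp
      moreover have "letters w s (s + 4) = {a, x, z}" using l3 letters_Suc[of s "s + 3" w] by (auto simp: numeral_eq_Suc z_def)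
      ultimately show ?thesis by (simp add: v_def)
    qed
    have fresh_x: "w l \<noteq> x" if "s + 3 \<le> l" "l \<le> h" for l
      using h2[OF that] in_lettersI[of s "s + 2" l w] that unfolding x_def by fastforce
    consider "k = s" | "k = s + 1" | "k = s + 2" | "s + 3 \<le> k" "k \<le> h" | "k = h + 1" using \<open>s \<le> k\<close> \<open>k < h + 2\<close> by linarith
    then show "k = s + 2 \<or> k = s + 4 \<and> h = s + 3"
    proof cases
      case 5
      then have "w (h - 1) = x" using h(3) \<open>w k = x\<close> by simp
      moreover have "s + 3 \<le> h - 1" if "h \<noteq> s + 3" using that h(1) by linarith
      ultimately have "h = s + 3" using fresh_x[of "h - 1"] by (cases "h = s + 3") auto
      then show ?thesis using 5 by simp
    qed (use \<open>w k = x\<close> s x fresh_x in auto)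
  qed
  have "x = w (s + 2)" "s + 2 < h + 2" using h(1) by (simp_all add: x_def)
  then have v: "v = x \<or> v \<notin> {a, x, z}" using v[of "s + 2"] by simp
  have blk: "block w s (length [a, a, x, z]) = [a, a, x, z]" "block w s (length [a, a, x, z, v]) = [a, a, x, z, v]"
    using s by (simp_all add: block_Suc block_0 numeral_eq_Suc x_def z_def v_def)
  have L: "M \<in> subwins m [a, a, x, z]" if M: "M \<in> wins w m s (h + 2)" "a \<in># M" "m \<le> 3" for M m
    by (rule wins_subwins[OF blk(1) M(1,2), of 0 "s + 1"]) (use occ M(3) in auto)
  have Lx: "M \<in> subwins m [a, a, x, z, v]" if M: "M \<in> wins w m s (h + 2)" "x \<in># M" "m \<le> 3" for M m
  proof (rule wins_subwins[OF blk(2) M(1,2), of 0 "if h = s + 3 then s + 4 else s + 2"])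
    fix k assume "s \<le> k" "k < h + 2" "w k = x"
    then show "0 \<le> k \<and> k \<le> (if h = s + 3 then s + 4 else s + 2)" using xocc[of k] by auto
  qed (use M(3) in auto)
  have Ea: "y = a \<or> y = x" if "{#a, y#} \<in> wins w 2 s (h + 2)" for y
    using L[OF that] x z by (auto simp: pair_mset)
  have A3: "{#u, y#} = {#a, x#} \<or> {#u, y#} = {#x, z#}" if "{#a, u, y#} \<in> wins w 3 s (h + 2)" for u y
    using L[OF that] x z by (auto simp: pair_mset triple_mset)
  have Ex: "y = a \<or> y = z" if "{#x, y#} \<in> wins w 2 s (h + 2)" for y
    using Lx[OF that] x z v by (auto simp: pair_mset)
  have Rx: "{#x, z, z#} \<notin> wins w 3 s (h + 2)"
    using Lx[of "{#x, z, z#}" 3] x z v by (auto simp: pair_mset triple_mset)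
  have no3: "win w i 3 \<noteq> {#a, a, a#}" if "s \<le> i" for i
  proof
    assume i0: "win w i 3 = {#a, a, a#}"
    have ex: "s \<le> i \<and> win w i 3 = {#a, a, a#}" using that i0 by simp
    obtain i where i: "s \<le> i \<and> win w i 3 = {#a, a, a#}" "\<forall>l<i. \<not> (s \<le> l \<and> win w l 3 = {#a, a, a#})"
      using ex exists_least_iff[of "\<lambda>i. s \<le> i \<and> win w i 3 = {#a, a, a#}"] by blast
    show False
    proof (cases "i + 3 \<le> h + 2")
      case True
      then have "{#a, a, a#} \<in> wins w 3 s (h + 2)" using in_winsI[of s i 3 "h + 2" w] i(1) by simp
      then show False using A3[of a a] x z by (auto simp: pair_mset)
    next
      case False
      have wi: "w i = a" "w (i + 2) = a" using i(1) by (simp_all add: win_3 triple_mset pair_mset)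
      have "w (i + 2) \<in> letters w s (i + 2)" unfolding wi(2) wi(1)[symmetric] by (rule in_lettersI) (use i(1) in auto)
      then have "win w i (Suc 2) \<in> wins w (Suc 2) s (i + 2)"
        by (intro slack_0_known[where t = "h + 2"]) (use s3 False h(1) in \<open>auto simp: numeral_eq_Suc\<close>)
      then have "win w i 3 \<in> wins w 3 s (i + 2)" by (simp add: numeral_eq_Suc)
      then obtain l where l: "s \<le> l" "l + 3 \<le> i + 2" "win w i 3 = win w l 3" by (rule in_winsE)
      have "l < i" using l(2) by linarith
      moreover have "win w l 3 = {#a, a, a#}" using l(3) i(1) by simp
      ultimately show False using i(2) l(1) by blast
    qed
  qed
  (* g is the first return to a. The known pairs and triples force it to come from x and to begin a doubled a. *)
  obtain j where j: "h + 2 \<le> j \<and> w j = a" using loop_after by blast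
  obtain g where g: "h + 2 \<le> g \<and> w g = a" "\<forall>i<g. \<not> (h + 2 \<le> i \<and> w i = a)"
    using j exists_least_iff[of "\<lambda>j. h + 2 \<le> j \<and> w j = a"] by blast
  define m where "m = g - 3"
  have m: "g = m + 3" "s + 2 \<le> m" "h \<le> m + 1" using g(1) h(1) by (auto simp: m_def)
  have na: "w k \<noteq> a" if "s + 2 \<le> k" "k < g" for k
    using occ[of k] g(2) that by (cases "k < h + 2") auto
  have old: "w k \<in> letters w s k" if "h + 2 \<le> k" "k < g + 2" for k
  proof (rule ccontr)
    assume f: "w k \<notin> letters w s k"
    have "w (k - 2) = a" using tight_fresh[OF s s3 _ that(1) f] h(1) by simp
    moreover have "s + 2 \<le> k - 2" "k - 2 < g" using that h(1) by linarith+
    ultimately show False using na by blast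
  qed
  have ls: "letters w s (g + 2) = letters w s (h + 2)" by (rule letters_stable) (use old h(1) g in auto)
  have s2: "slack 2 s (h + 2) 0" by (rule loop_slack2[OF s]) (use h(1) in simp)
  have w2: "wins w 2 s (g + 2) = wins w 2 s (h + 2)" by (rule wins_stable[OF s2 _ ls]) (use g h in auto)
  have w3: "wins w 3 s (g + 2) = wins w 3 s (h + 2)" by (rule wins_stable[OF s3 _ ls]) (use g h in auto)
  have "win w (m + 2) 2 \<in> wins w 2 s (g + 2)" "win w g 2 \<in> wins w 2 s (g + 2)" "win w (m + 2) 3 \<in> wins w 3 s (g + 2)"
    by (rule in_winsI; use m in simp)+
  moreover have "win w (m + 2) 2 = {#a, w (m + 2)#}" "win w g 2 = {#a, w (g + 1)#}" "win w (m + 2) 3 = {#a, w (m + 2), w (g + 1)#}"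
    using g m by (simp_all add: numeral_eq_Suc win_nf add_mset_commute)
  ultimately have r: "w (m + 2) = x" and g1: "w (g + 1) = a"
    using Ea[of "w (m + 2)"] Ea[of "w (g + 1)"] A3[of "w (m + 2)" "w (g + 1)"] na[of "m + 2"] m x z w2 w3 by (auto simp: pair_mset)
  have m1: "w (m + 1) \<noteq> x" using only_loop[of "m + 1"] r x by (auto simp: numeral_eq_Suc)
  have ga: "w g = a" using g(1) by simp
  have four: "i = s \<or> i = m + 1 \<or> m + 2 \<le> i \<or> (i = s + 1 \<and> win w i 4 = {#a, x, z, v#} \<or> a \<notin># win w i 4 \<or> i = m \<and> win w i 4 = {#w m, w (m + 1), x, a#})" if i: "s \<le> i" for i
  proof -
    consider "i = s" | "i = s + 1" | "s + 2 \<le> i" "i + 3 < g" | "i = m" "s + 2 \<le> i" | "m + 1 \<le> i" using i m by linarith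
    then show ?thesis
    proof cases
      case 2 then show ?thesis using s by (simp add: numeral_eq_Suc win_nf x_def z_def v_def)
    next
      case 3
      then have "a \<notin># win w i 4" using na[of i] na[of "i + 1"] na[of "i + 2"] na[of "i + 3"] by (auto simp: win_4)
      then show ?thesis by blast
    next
      case 4 then show ?thesis using r ga m by (simp add: numeral_eq_Suc win_nf)
    qed auto
  qed
  have vs: "v \<noteq> a" using v x by auto
  have ms: "w m \<noteq> a" "w (m + 1) \<noteq> a" using na[of m] na[of "m + 1"] m by auto
  have w4s: "win w s 4 = {#a, a, x, z#}" using s by (simp add: numeral_eq_Suc win_nf x_def z_def)
  have w4m: "win w (m + 1) 4 = {#w (m + 1), x, a, a#}" using r ga g1 m by (simp add: numeral_eq_Suc win_nf)
  have xaax: "{#x, a, a, x#} \<notin> wins w 4 s (g + 2)"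
  proof
    assume "{#x, a, a, x#} \<in> wins w 4 s (g + 2)"
    then obtain i where i: "s \<le> i" "i + 4 \<le> g + 2" "{#x, a, a, x#} = win w i 4" by (rule in_winsE)
    have "i < m + 2" using i(2) m by simp
    moreover have "a \<in># win w i 4" unfolding i(3)[symmetric] by simp
    ultimately consider "i = s" | "i = m + 1" | "{#x, a, a, x#} = {#a, x, z, v#}" | "{#x, a, a, x#} = {#w m, w (m + 1), x, a#}"
      using four[OF i(1)] i(3) by auto
    then show False
    proof cases
      case 1 then show False using i(3) w4s z by simp
    next
      case 2 then show False using i(3) w4m m1 by simp
    next
      case 3 then show False using vs z x by (auto simp: pair_mset triple_mset)
    next
      case 4 then show False using ms x by (auto simp: pair_mset triple_mset)
    qed
  qed
  (* After x a a the walk goes back to x or on to a new letter. Both ways use up the slack for length 4 and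
     end in the same situation, with f = x in the first case. *)
  have fin: False
    if T: "g + 3 \<le> T" and sT: "slack 4 s T 0" and fx: "f = x \<or> f \<notin> letters w s (h + 2)"
      and e2: "\<And>M. M \<in> wins w 2 s T \<Longrightarrow> M \<in> wins w 2 s (h + 2) \<or> M = {#a, f#}"
      and e3: "\<And>M. M \<in> wins w 3 s T \<Longrightarrow> M \<in> wins w 3 s (h + 2) \<or> M = {#a, a, f#}"
      and lT: "letters w s T \<subseteq> insert f (letters w s (h + 2))"
      and q4: "{#a, a, a, x#} \<notin> wins w 4 s T" "f \<noteq> x \<Longrightarrow> {#a, a, x, x#} \<notin> wins w 4 s T" "f \<noteq> x \<Longrightarrow> {#a, a, f, f#} \<notin> wins w 4 s T"
    for T f
  proof -
    have all: "letters w s T = range w"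
    proof (rule ccontr)
      assume "letters w s T \<noteq> range w"
      then obtain k where k: "T \<le> k" "w k \<notin> letters w s k" using next_fresh[of s T] T m by auto
      have t: "w (k - 2) = a" "w (k - 1) = a" "w (k + 1) = a" using tight_fresh[OF s s3 _ _ k(2)] k(1) T g(1) h(1) by auto
      define l where "l = k - 2"
      have l: "k = l + 2" "g + 1 \<le> l" using k(1) T by (auto simp: l_def)
      have la: "w l = a" "w (l + 1) = a" "w (l + 3) = a" using t l by (simp_all add: numeral_eq_Suc)
      have "w (l - 1) \<noteq> a"
      proof
        assume "w (l - 1) = a"
        then have "win w (l - 1) 3 = {#a, a, a#}" using la l(2) by (simp add: win_3)
        moreover have "s \<le> l - 1" using l(2) m by linarith
        ultimately show False using no3 by blast
      qed
      then have "win w l 4 \<notin> wins w 4 s (l + 3)"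
        by (intro no_a4_before_fresh) (use la l k(2) m in auto)
      moreover have "w (l + 3) \<in> letters w s (l + 3)" unfolding la(3) using in_lettersI[of s l "l + 3" w] la l m by simp
      ultimately show False using slack_event_4[OF sT, of l] l k(1) T m by simp
    qed
    have S2: "win w i 2 \<in> wins w 2 s T" for i by (rule saturated[OF loop_slack2[OF s] _ all]) (use T m in auto)
    have S3: "win w i 3 \<in> wins w 3 s T" for i by (rule saturated[OF slack_mono[OF s3] _ all]) (use T g h(1) in auto)
    have S4: "win w i 4 \<in> wins w 4 s T" for i by (rule saturated[OF sT _ all]) simp
    have nf: "f \<noteq> a" "f \<noteq> z"
      using fx x z in_lettersI[of s s "h + 2" w] in_lettersI[of s "s + 3" "h + 2" w] s h(1) by (auto simp: z_def)
    have P2: "M \<in> wins w 2 s (h + 2) \<or> M = {#a, f#}" if "M \<in> range (\<lambda>i. win w i 2)" for M using that S2 e2 by auto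
    have P3: "M \<in> wins w 3 s (h + 2) \<or> M = {#a, a, f#}" if "M \<in> range (\<lambda>i. win w i 3)" for M using that S3 e3 by auto
    have P4: "M \<in> wins w 4 s T" if "M \<in> range (\<lambda>i. win w i 4)" for M using that S4 by auto
    show False
    proof (rule loop_final[of x z f])
      show "y = a \<or> y = x \<or> y = f" if "{#a, y#} \<in> range (\<lambda>i. win w i 2)" for y
        using P2[OF that] Ea[of y] nf by (auto simp: pair_mset)
      show "{#u, y#} = {#a, x#} \<or> {#u, y#} = {#x, z#} \<or> {#u, y#} = {#a, f#}" if "{#a, u, y#} \<in> range (\<lambda>i. win w i 3)" for u y
        using P3[OF that] A3[of u y] by auto
      show "y = a \<or> y = z" if "{#x, y#} \<in> range (\<lambda>i. win w i 2)" for y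
        using P2[OF that] Ex[of y] x by (auto simp: pair_mset)
      show "{#x, z, z#} \<notin> range (\<lambda>i. win w i 3)"
        using P3[of "{#x, z, z#}"] Rx x z by (auto simp: pair_mset triple_mset)
      show "y = a" if fx': "f \<noteq> x" and e: "{#f, y#} \<in> range (\<lambda>i. win w i 2)" for y
      proof -
        have "{#f, y#} \<notin> wins w 2 s (h + 2)"
        proof
          assume "{#f, y#} \<in> wins w 2 s (h + 2)"
          then have "f \<in> letters w s (h + 2)" by (rule in_winsE) (metis win_mem_letters union_single_eq_member)
          then show False using fx fx' by simp
        qed
        then show ?thesis using P2[OF e] nf by (auto simp: pair_mset)
      qed
      show "{#a, a, a, x#} \<notin> range (\<lambda>i. win w i 4)" using P4 q4(1) by blast
      show "{#a, a, x, x#} \<notin> range (\<lambda>i. win w i 4)" if "f \<noteq> x" using P4 q4(2)[OF that] by blast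
      show "{#a, a, f, f#} \<notin> range (\<lambda>i. win w i 4)" if "f \<noteq> x" using P4 q4(3)[OF that] by blast
    next
      fix y i j assume y: "y \<notin> {a, x, f}" and ij: "w i = w j" "w (i + 1) = y" "w (j + 1) = y"
      have "y \<in> letters w s (h + 2)" using lT all y ij by auto
      then obtain k where k: "s \<le> k" "k < h + 2" "w k = y" unfolding in_letters_iff by blast
      have "k \<noteq> s" "k \<noteq> s + 1" "k \<noteq> s + 2" using k(3) y s by (auto simp: x_def)
      then have k3: "s + 3 \<le> k" using k(1) by linarith
      obtain k' where k': "s + 3 \<le> k'" "k' \<le> h" "w k' = y"
      proof (cases "k = h + 1")
        case True
        then have y': "y = w (h - 1)" using k(3) h(3) by simp
        have "h \<noteq> s + 3" using y' y by (auto simp: x_def)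
        then have "s + 3 \<le> h - 1" "h - 1 \<le> h" using h(1) by linarith+
        then show thesis using that[of "h - 1"] y' by simp
      next
        case False then show thesis using that[of k] k k3 by simp
      qed
      have "\<exists>l r. pass (s + 1) (h + 2) (w k') l r"
      proof (rule run_pass[OF _ h(3) _ h(1) _ k'(1,2)])
        show "w l \<notin> letters w (s + 1) l" if "s + 3 \<le> l" "l \<le> h" for l
          using h2[OF that] by (auto simp: letters_def)
        show "w l \<noteq> w (l + 1)" if "s + 1 \<le> l" "l + 1 < h + 2" for l
          using only_loop[of l] occ[of "l + 1"] that by auto
      qed simp
      then obtain l r where pass: "pass (s + 1) (h + 2) y l r" using k'(3) by auto
      have shrink: "win w t m \<in> wins w m (s + 1) (h + 2)" if "m = 2 \<or> m = 3" "y \<in># win w t m" for t m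
      proof -
        have "win w t m \<in> wins w m s (h + 2)"
          using that P2[of "win w t 2"] P3[of "win w t 3"] y by auto
        then obtain l where l: "s \<le> l" "l + m \<le> h + 2" "win w t m = win w l m" by (rule in_winsE)
        have "l \<noteq> s"
        proof
          assume "l = s"
          then have "win w t m = {#a, a#} \<or> win w t m = {#a, a, x#}" using l(3) that(1) s by (auto simp: win_2 win_3 x_def)
          then show False using that(2) y by auto
        qed
        then show ?thesis unfolding l(3) using l(1,2) by (intro in_winsI) auto
      qed
      have "w t = l \<and> w (t + 2) = r \<or> w t = r \<and> w (t + 2) = l" if t: "w (t + 1) = y" for t
        by (rule pass_through[OF pass t]) (rule shrink; use t in \<open>simp add: win_2 win_3\<close>)+
      from this[OF ij(2)] this[OF ij(3)] show "w (i + 2) = w (j + 2)" using ij(1) by auto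
    qed (use x z nf in auto)
  qed
  have sg: "s \<le> g" using m by simp
  show False
  proof (cases "w (g + 2) \<in> letters w s (g + 2)")
    case True
    have ls3: "letters w s (g + 3) = letters w s (h + 2)" using ls True letters_Suc[of s "g + 2" w] sg by (simp add: numeral_eq_Suc insert_absorb)
    have w3': "wins w 3 s (g + 3) = wins w 3 s (h + 2)" by (rule wins_stable[OF s3 _ ls3]) (use g h in auto)
    have w2': "wins w 2 s (g + 3) = wins w 2 s (h + 2)" by (rule wins_stable[OF s2 _ ls3]) (use g h in auto)
    have "win w g 3 \<in> wins w 3 s (g + 3)" by (rule in_winsI) (use sg in auto)
    then have t: "w (g + 2) = x" using A3[of a "w (g + 2)"] w3' ga g1 x z by (auto simp: win_3 pair_mset)
    have e: "win w (m + 2) 4 = {#x, a, a, x#}" using r ga g1 t m by (simp add: numeral_eq_Suc win_nf)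
    have "win w (m + 2) 4 \<notin> wins w 4 s (m + 2 + 3)" using xaax m unfolding e by (simp add: numeral_eq_Suc)
    moreover have "w (m + 2 + 3) \<in> letters w s (m + 2 + 3)" using True m by (simp add: numeral_eq_Suc)
    ultimately have s40: "slack 4 s (g + 3) 0" using slack_event_4[OF s4, of "m + 2"] m h(1) g(1) by (simp add: numeral_eq_Suc)
    show False
    proof (rule fin[of "g + 3" x])
      show "{#a, a, a, x#} \<notin> wins w 4 s (g + 3)"
      proof
        assume "{#a, a, a, x#} \<in> wins w 4 s (g + 3)"
        then obtain i where i: "s \<le> i" "i + 4 \<le> g + 3" "{#a, a, a, x#} = win w i 4" by (rule in_winsE)
        have "i = m + 2 \<or> i < m + 2" using i(2) m by linarith
        moreover have "a \<in># win w i 4" unfolding i(3)[symmetric] by simp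
        ultimately consider "i = s" | "i = m + 1" | "i = m + 2" | "{#a, a, a, x#} = {#a, x, z, v#}" | "{#a, a, a, x#} = {#w m, w (m + 1), x, a#}"
          using four[OF i(1)] i(3) by auto
        then show False
          by cases (use i(3) w4s w4m e z x vs ms m1 in \<open>auto simp: pair_mset triple_mset\<close>)
      qed
    qed (use s40 w2' w3' ls3 in auto)
  next
    case False
    define f where "f = w (g + 2)"
    have f: "f \<notin> letters w s (g + 2)" using False by (simp add: f_def)
    have t: "w (g + 3) = a" using tight_fresh[OF s s3 _ _ False] h(1) g(1) by (simp add: numeral_eq_Suc)
    have fn: "f \<noteq> x" "f \<noteq> a" "f \<noteq> z" "f \<noteq> v" "f \<noteq> w m" "f \<noteq> w (m + 1)"
    proof -
      have F: "f \<noteq> w k" if "s \<le> k" "k < g + 2" for k using f in_lettersI[of s k "g + 2" w] that by auto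
      show "f \<noteq> x" "f \<noteq> z" "f \<noteq> v" "f \<noteq> w m" "f \<noteq> w (m + 1)"
        unfolding x_def z_def v_def by (rule F; use m in simp)+
      show "f \<noteq> a" using F[of s] s(1) sg by simp
    qed
    have "win w g 4 \<notin> wins w 4 s (g + 3)"
      by (rule no_a4_before_fresh) (use False ga g1 t sg na[of "g - 1"] m in auto)
    moreover have "w (g + 3) \<in> letters w s (g + 3)" unfolding t using in_lettersI[of s g "g + 3" w] ga sg by simp
    ultimately have s40: "slack 4 s (g + 4) 0" using slack_event_4[OF s4, of g] g(1) h(1) by simp
    have lf: "letters w s (g + 4) = insert f (letters w s (h + 2))"
    proof -
      have "letters w s (g + 3) = insert f (letters w s (g + 2))" using letters_Suc[of s "g + 2" w] sg by (simp add: numeral_eq_Suc f_def)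
      moreover have "letters w s (g + 4) = insert a (letters w s (g + 3))" using letters_Suc[of s "g + 3" w] sg t by (simp add: numeral_eq_Suc)
      moreover have "a \<in> letters w s (h + 2)" using in_lettersI[of s s "h + 2" w] s(1) h(1) by simp
      ultimately show ?thesis using ls by (simp add: insert_absorb insert_commute)
    qed
    have e4: "win w (m + 2) 4 = {#x, a, a, f#}" "win w g 4 = {#a, a, f, a#}"
      using r ga g1 t m by (simp_all add: numeral_eq_Suc win_nf f_def)
    have cases4: "M = {#a, a, x, z#} \<or> M = {#w (m + 1), x, a, a#} \<or> M = {#x, a, a, f#} \<or> M = {#a, a, f, a#} \<or>
        M = {#a, x, z, v#} \<or> M = {#w m, w (m + 1), x, a#}" if M: "M \<in> wins w 4 s (g + 4)" "a \<in># M" for M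
    proof -
      obtain i where i: "s \<le> i" "i + 4 \<le> g + 4" "M = win w i 4" using M(1) by (rule in_winsE)
      have "i = m + 2 \<or> i = g \<or> i < m + 2" using i(2) m by linarith
      then show ?thesis using four[OF i(1)] i(3) M(2) w4s w4m e4 by auto
    qed
    show False
    proof (rule fin[of "g + 4" f])
      show "M \<in> wins w 2 s (h + 2) \<or> M = {#a, f#}" if "M \<in> wins w 2 s (g + 4)" for M
      proof -
        obtain i where i: "s \<le> i" "i + 2 \<le> g + 4" "M = win w i 2" using \<open>M \<in> wins w 2 s (g + 4)\<close> by (rule in_winsE)
        consider "i + 2 \<le> g + 2" | "i = g + 1" | "i = g + 2" using i(2) by linarith
        then show ?thesis
        proof cases
          case 1 then show ?thesis using in_winsI[OF i(1) 1, of w] w2 i(3) by simp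
        qed (use i(3) g1 t in \<open>simp_all add: numeral_eq_Suc win_nf f_def add_mset_commute\<close>)
      qed
      show "M \<in> wins w 3 s (h + 2) \<or> M = {#a, a, f#}" if "M \<in> wins w 3 s (g + 4)" for M
      proof -
        obtain i where i: "s \<le> i" "i + 3 \<le> g + 4" "M = win w i 3" using \<open>M \<in> wins w 3 s (g + 4)\<close> by (rule in_winsE)
        consider "i + 3 \<le> g + 2" | "i = g" | "i = g + 1" using i(2) by linarith
        then show ?thesis
        proof cases
          case 1 then show ?thesis using in_winsI[OF i(1) 1, of w] w3 i(3) by simp
        qed (use i(3) ga g1 t in \<open>simp_all add: numeral_eq_Suc win_nf f_def add_mset_commute\<close>)
      qed
      show "{#a, a, a, x#} \<notin> wins w 4 s (g + 4)" "{#a, a, x, x#} \<notin> wins w 4 s (g + 4)" "{#a, a, f, f#} \<notin> wins w 4 s (g + 4)"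
        using cases4[of "{#a, a, a, x#}"] cases4[of "{#a, a, x, x#}"] cases4[of "{#a, a, f, f#}"] x z vs ms m1 fn
        by (auto simp: pair_mset triple_mset)
      show "f = x \<or> f \<notin> letters w s (h + 2)" using f ls by simp
    qed (use s40 lf in auto)
  qed
qed

text \<open>
  The \<open>n\<close> classes of length 2 are therefore the pairs of \<open>a\<close> with the \<open>n\<close> letters.
\<close>
lemma all_near:
  assumes "z \<in> range w"
  shows "{#a, z#} \<in> range (\<lambda>i. win w i 2)"
proof (rule ccontr)
  assume "{#a, z#} \<notin> range (\<lambda>i. win w i 2)"
  from far_letter_after_loop[OF assms this] obtain s z where s: "w s = a" "w (s + 1) = a" and z: "s + 3 \<le> z" "w z \<notin> letters w s z" "{#a, w z#} \<notin> range (\<lambda>i. win w i 2)"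
    and noaa: "\<forall>k. s < k \<longrightarrow> k \<le> z \<longrightarrow> \<not> (w k = a \<and> w (k + 1) = a)" by blast
  have x: "w (s + 2) \<noteq> a" using noaa[rule_format, of "s + 1"] s z by (simp add: numeral_eq_Suc)
  show False
  proof (cases "w (s + 3) \<in> letters w s (s + 3)")
    case False then show False by (rule no_deep_branch_1[OF s x])
  next
    case True
    have l2: "letters w s (s + 2) = {a}" using s by (simp add: letters_Suc numeral_eq_Suc) (simp add: letters_def)
    have "win w (s + 2) 2 \<in> wins w 2 s (s + 2 + 1)"
      by (rule slack_old[OF loop_slack2[OF s order_refl]]) (use True in \<open>auto simp: numeral_eq_Suc\<close>)
    then have "w (s + 3) = a" using fresh_turn[of "s + 2" s] x l2 s by (simp add: numeral_eq_Suc)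
    then show False using no_deep_branch_2[OF s z] noaa by blast
  qed
qed

section \<open>Words with a doubled letter: the star\<close>

lemma star: "w i = a \<or> w (i + 1) = a"
proof -
  let ?f = "\<lambda>z. {#a, z#}"
  have "?f ` range w \<subseteq> range (\<lambda>i. win w i 2)" using all_near by blast
  moreover have "card (?f ` range w) = n" using card_range by (subst card_image) (auto simp: inj_on_def)
  ultimately have "?f ` range w = range (\<lambda>i. win w i 2)"
    using card_seteq[OF finite_range_win[of 2]] card_range_win[of 2] by simp
  then obtain z where "win w i 2 = {#a, z#}" by blast
  then show ?thesis by (auto simp: win_2 pair_mset)
qed

text \<open>
  The classes of windows after the letter \<open>a\<close> has been deleted from them. There are at most \<open>n\<close>.
\<close>
definition rest :: "nat \<Rightarrow> 'a multiset set" where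
  "rest m = range (\<lambda>i. filter_mset (\<lambda>y. y \<noteq> a) (win w i m))"

lemma restI: "filter_mset (\<lambda>y. y \<noteq> a) (win w i m) = M \<Longrightarrow> M \<in> rest m"
  by (auto simp: rest_def)

lemma rest_eq:
  assumes "S \<subseteq> rest m" "card S = n" "1 \<le> m"
  shows "rest m = S"
proof -
  have r: "rest m = filter_mset (\<lambda>y. y \<noteq> a) ` range (\<lambda>i. win w i m)" by (auto simp: rest_def)
  have "card (rest m) \<le> n" unfolding r using card_image_le[OF finite_range_win[OF assms(3)]] card_range_win[OF assms(3)] by metis
  moreover have "finite (rest m)" unfolding r using finite_range_win[OF assms(3)] by simp
  ultimately show ?thesis using card_seteq[of "rest m" S] assms by simp
qed

lemma rest_win:
  assumes "{k. i \<le> k \<and> k < i + m \<and> w k \<noteq> a} = K"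
  shows "filter_mset (\<lambda>y. y \<noteq> a) (win w i m) = image_mset w (mset_set K)"
proof -
  have "win w i m = image_mset w (mset_set {i..<i + m})" by (simp add: win_def block_def flip: mset_upt)
  moreover have "{k \<in> {i..<i + m}. w k \<noteq> a} = K" using assms by auto
  ultimately show ?thesis by (simp flip: image_mset_filter_mset_swap)
qed

lemma card_others: "card (range w - {a}) = n - 1" "finite (range w - {a})"
proof -
  have "a \<in> range w" using ex_loop by auto
  then show "card (range w - {a}) = n - 1" using card_range by simp
qed (use finite_range in simp)

lemma card_singles: "card ((\<lambda>u. {#u#}) ` A) = card A"
  by (rule card_image) (simp add: inj_on_def)

text \<open>
  If the shortest block of \<open>a\<close> between other letters has length \<open>g\<close>, windows that are longer by two, or
  by three if \<open>g \<ge> 2\<close>, can show any single other letter, and also the pair around a shortest block. This already makes \<open>n\<close>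
  multisets.
\<close>
lemma rest_least_gap:
  assumes p: "w p \<noteq> a" "w (p + g + 1) \<noteq> a"
    and sep: "\<And>i j. i < j \<Longrightarrow> w i \<noteq> a \<Longrightarrow> w j \<noteq> a \<Longrightarrow> i + g < j"
    and g: "1 \<le> g" and m: "m = g + 2 \<or> m = g + 3 \<and> 2 \<le> g"
  shows "rest m = insert {#w p, w (p + g + 1)#} ((\<lambda>u. {#u#}) ` (range w - {a}))"
proof (rule rest_eq)
  have "{#u#} \<in> rest m" if u: "u \<in> range w - {a}" for u
  proof -
    obtain q where q: "g \<le> q" "w q = u" using u letter_recurs[of g] by (metis DiffD1 rangeE)
    have "k = q" if k: "q - g \<le> k" "k < q - g + m" "w k \<noteq> a" for k
    proof (rule ccontr)
      assume "k \<noteq> q"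
      then consider "k < q" | "q < k" by linarith
      then show False
      proof cases
        case 1
        then have "k + g < q" using sep[OF 1] k q u by auto
        then show False using k(1) by linarith
      next
        case 2
        then have "q + g < k" using sep[OF 2] k q u by auto
        then show False using k(2) q(1) m g by linarith
      qed
    qed
    moreover have "q < q - g + m" using q(1) m by linarith
    ultimately have "{k. q - g \<le> k \<and> k < q - g + m \<and> w k \<noteq> a} = {q}" using q u by auto
    then have "filter_mset (\<lambda>y. y \<noteq> a) (win w (q - g) m) = image_mset w (mset_set {q})" by (rule rest_win)
    also have "\<dots> = {#u#}" using q by simp
    finally show ?thesis by (rule restI)
  qed
  moreover have "{#w p, w (p + g + 1)#} \<in> rest m"
  proof -
    have "k = p \<or> k = p + g + 1" if k: "p \<le> k" "k < p + m" "w k \<noteq> a" for k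
    proof (rule ccontr)
      assume ne: "\<not> ?thesis"
      then have "p < k" using k(1) by simp
      then have "p + g < k" using sep[of p k] p k by simp
      then have "p + g + 1 < k" using ne by simp
      then have "p + g + 1 + g < k" using sep[of "p + g + 1" k] p k by simp
      then show False using k(2) m g by linarith
    qed
    then have "{k. p \<le> k \<and> k < p + m \<and> w k \<noteq> a} = {p, p + g + 1}" using p m by auto
    then have "filter_mset (\<lambda>y. y \<noteq> a) (win w p m) = image_mset w (mset_set {p, p + g + 1})" by (rule rest_win)
    also have "\<dots> = {#w p, w (p + g + 1)#}" by simp
    finally show ?thesis by (rule restI)
  qed
  ultimately show "insert {#w p, w (p + g + 1)#} ((\<lambda>u. {#u#}) ` (range w - {a})) \<subseteq> rest m" by blast
  have "{#w p, w (p + g + 1)#} \<notin> (\<lambda>u. {#u#}) ` (range w - {a})" by auto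
  then show "card (insert {#w p, w (p + g + 1)#} ((\<lambda>u. {#u#}) ` (range w - {a}))) = n"
    using card_others n4 by (simp add: card_singles)
qed (use m in auto)

lemma third_letter: "\<exists>u \<in> range w. u \<noteq> a \<and> u \<noteq> s \<and> u \<noteq> t"
proof (rule ccontr)
  assume "\<not> ?thesis"
  then have "range w \<subseteq> {a, s, t}" by auto
  then have "card (range w) \<le> card {a, s, t}" by (rule card_mono[rotated]) simp
  also have "\<dots> \<le> 3" by (simp add: card_insert_if)
  finally show False using card_range n4 by simp
qed

text \<open>
  If \<open>g\<close> were at least 2, the multisets for lengths \<open>g + 2\<close> and \<open>g + 3\<close> would both be known completely. A
  third letter can then be followed neither by a block of length \<open>g\<close> nor by one of length \<open>g + 1\<close>,
  because of the pairs, nor by a longer one, because no multiset is empty.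
\<close>
lemma least_gap_1:
  "\<exists>p. w p \<noteq> a \<and> w (p + 2) \<noteq> a \<and> rest 3 = insert {#w p, w (p + 2)#} ((\<lambda>u. {#u#}) ` (range w - {a}))"
proof -
  define Q where "Q d \<longleftrightarrow> (\<exists>p. w p \<noteq> a \<and> w (p + d + 1) \<noteq> a)" for d
  obtain u where u: "u \<in> range w" "u \<noteq> a" using third_letter by blast
  obtain k where k: "w k = u" using u by blast
  obtain l where l: "k + 1 \<le> l" "w l = u" using u(1) letter_recurs[of "k + 1"] by (metis rangeE)
  have "Q (l - k - 1)" unfolding Q_def using k l u by (intro exI[of _ k]) simp
  then obtain g where g: "Q g" "\<forall>d<g. \<not> Q d" using exists_least_iff[of Q] by blast
  obtain p where p: "w p \<noteq> a" "w (p + g + 1) \<noteq> a" using g(1) Q_def by blast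
  have sep: "i + g < j" if ij: "i < j" "w i \<noteq> a" "w j \<noteq> a" for i j
  proof (rule ccontr)
    assume "\<not> ?thesis"
    then have "j - i - 1 < g" using ij(1) by linarith
    moreover have "Q (j - i - 1)" unfolding Q_def using ij by (intro exI[of _ i]) simp
    ultimately show False using g(2) by blast
  qed
  have g1: "1 \<le> g" using p star[of p] by (cases g) auto
  note R = rest_least_gap[OF p sep g1]
  have "g = 1"
  proof (rule ccontr)
    assume "g \<noteq> 1"
    then have g2: "2 \<le> g" using g1 by simp
    obtain u where u: "u \<in> range w" "u \<noteq> a" "u \<noteq> w p" "u \<noteq> w (p + g + 1)" using third_letter by blast
    then obtain q where q: "w q = u" by blast
    have nopair: "{#u, v#} \<notin> rest m" if "m = g + 2 \<or> m = g + 3" for m v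
      using R[of m] that g2 u by (auto simp: pair_mset)
    have gap: "w k = a" if "q < k" "k \<le> q + g" for k
      using sep[of q k] that q u by auto
    have 1: "w (q + g + 1) = a"
    proof (rule ccontr)
      assume n: "w (q + g + 1) \<noteq> a"
      have "k = q \<or> k = q + g + 1" if k: "q \<le> k" "k < q + (g + 2)" "w k \<noteq> a" for k
      proof (rule ccontr)
        assume ne: "\<not> ?thesis"
        then have "q < k" "k \<le> q + g" using ne k(1,2) by linarith+
        then show False using gap k(3) by blast
      qed
      then have "{k. q \<le> k \<and> k < q + (g + 2) \<and> w k \<noteq> a} = {q, q + g + 1}" using q u n by auto
      then have "filter_mset (\<lambda>y. y \<noteq> a) (win w q (g + 2)) = image_mset w (mset_set {q, q + g + 1})" by (rule rest_win)
      also have "\<dots> = {#u, w (q + g + 1)#}" using q by simp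
      finally have "{#u, w (q + g + 1)#} \<in> rest (g + 2)" by (rule restI)
      then show False using nopair by blast
    qed
    have 2: "w (q + g + 2) = a"
    proof (rule ccontr)
      assume n: "w (q + g + 2) \<noteq> a"
      have "k = q \<or> k = q + g + 2" if k: "q \<le> k" "k < q + (g + 3)" "w k \<noteq> a" for k
      proof (rule ccontr)
        assume ne: "\<not> ?thesis"
        have "k \<noteq> q + g + 1" using k(3) 1 by auto
        then have "q < k" "k \<le> q + g" using ne k(1,2) by linarith+
        then show False using gap k(3) by blast
      qed
      then have "{k. q \<le> k \<and> k < q + (g + 3) \<and> w k \<noteq> a} = {q, q + g + 2}" using q u n by auto
      then have "filter_mset (\<lambda>y. y \<noteq> a) (win w q (g + 3)) = image_mset w (mset_set {q, q + g + 2})" by (rule rest_win)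
      also have "\<dots> = {#u, w (q + g + 2)#}" using q by simp
      finally have "{#u, w (q + g + 2)#} \<in> rest (g + 3)" by (rule restI)
      then show False using nopair by blast
    qed
    have "w k = a" if k: "q + 1 \<le> k" "k < q + 1 + (g + 2)" for k
    proof -
      have "k \<le> q + g \<or> k = q + g + 1 \<or> k = q + g + 2" using k(2) by linarith
      then show ?thesis using gap[of k] k(1) 1 2 by auto
    qed
    then have "{k. q + 1 \<le> k \<and> k < q + 1 + (g + 2) \<and> w k \<noteq> a} = {}" by blast
    then have "filter_mset (\<lambda>y. y \<noteq> a) (win w (q + 1) (g + 2)) = image_mset w (mset_set {})" by (rule rest_win)
    then have "{#} \<in> rest (g + 2)" by (intro restI) simp
    then show False using R[of "g + 2"] by auto
  qed
  then show ?thesis using p R[of "g + 2"] by (auto simp: numeral_eq_Suc)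
qed

text \<open>
  With \<open>g = 1\<close>, blocks of \<open>a\<close> have length 1 or 2, and those of length 1 occur only between two
  particular letters \<open>s\<close> and \<open>t\<close>. Length 4 then shows that there is exactly one more letter \<open>r\<close>, and length 5
  that four letters determine the next one.
\<close>
lemma star_impossible: False
proof -
  obtain p where p: "w p \<noteq> a" "w (p + 2) \<noteq> a" and R3: "rest 3 = insert {#w p, w (p + 2)#} ((\<lambda>u. {#u#}) ` (range w - {a}))"
    using least_gap_1 by blast
  have E1: "\<not> (w i = a \<and> w (i + 1) = a \<and> w (i + 2) = a)" for i
  proof
    assume "w i = a \<and> w (i + 1) = a \<and> w (i + 2) = a"
    then have "{#} \<in> rest 3" by (intro restI[of i]) (simp add: win_3)
    then show False using R3 by auto
  qed
  have E2: "{#w i, w (i + 2)#} = {#w p, w (p + 2)#}" if "w i \<noteq> a" "w (i + 2) \<noteq> a" for i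
  proof -
    have "w (i + 1) = a" using star[of i] that by simp
    then have "{#w i, w (i + 2)#} \<in> rest 3" using that by (intro restI[of i]) (simp add: win_3)
    then show ?thesis using R3 by auto
  qed
  define C where "C = {w p, w (p + 2)}"
  have C: "w i \<in> C" "w (i + 2) \<in> C" if "w i \<noteq> a" "w (i + 2) \<noteq> a" for i
    using E2[OF that] by (auto simp: C_def pair_mset)
  have P4: "{#w i, w (i + 2)#} \<in> rest 4" if "w i \<noteq> a" "w (i + 2) \<noteq> a" for i
  proof -
    have "w (i + 1) = a" "w (i + 3) = a" using star[of i] star[of "i + 2"] that by (simp_all add: numeral_eq_Suc)
    then show ?thesis using that by (intro restI[of i]) (simp add: win_4)
  qed
  have Q4: "{#w i, w (i + 3)#} \<in> rest 4" if "w i \<noteq> a" "w (i + 3) \<noteq> a" for i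
  proof -
    have "w (i + 1) = a" "w (i + 2) = a" using star[of i] star[of "i + 2"] that by (simp_all add: numeral_eq_Suc)
    then show ?thesis using that by (intro restI[of i]) (simp add: win_4)
  qed
  have after: "{#w i#} \<in> rest 4" if H: "w i \<noteq> a" "w (i + 2) = a" "1 \<le> i" for i
  proof -
    obtain l where l: "i = l + 1" using H(3) by (metis add.commute le_Suc_ex plus_1_eq_Suc)
    have "w l = a" "w (l + 2) = a" using star[of l] star[of i] that l by (auto simp: numeral_eq_Suc)
    then show ?thesis using that l by (intro restI[of l]) (simp add: numeral_eq_Suc win_nf)
  qed
  have before: "{#w (i + 2)#} \<in> rest 4" if "w (i + 2) \<noteq> a" "w i = a" for i
  proof -
    have "w (i + 1) = a" "w (i + 3) = a" using star[of "i + 1"] star[of "i + 2"] that by (auto simp: numeral_eq_Suc)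
    then show ?thesis using that by (intro restI[of i]) (simp add: win_4)
  qed
  have next_pair: "\<exists>v. v \<noteq> a \<and> {#w i, v#} \<in> rest 4 \<and> (w (i + 2) = v \<or> w (i + 2) = a \<and> w (i + 3) = v)" if "w i \<noteq> a" for i
  proof (cases "w (i + 2) = a")
    case True
    have "w (i + 1) = a" using star[of i] that by simp
    then have "w (i + 3) \<noteq> a" using E1[of "i + 1"] True by (simp add: numeral_eq_Suc)
    then show ?thesis using Q4[OF that] True by blast
  qed (use P4[OF that] in blast)
  have outside: "{#u#} \<in> rest 4" if u: "u \<in> range w" "u \<noteq> a" "u \<notin> C" for u
  proof -
    obtain q where q: "1 \<le> q" "w q = u" using u(1) letter_recurs[of 1] by (metis rangeE)
    have "w (q + 2) = a" using C(1)[of q] q u by auto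
    then show ?thesis using after[of q] q u by simp
  qed
  have pair: "{#w p, w (p + 2)#} \<in> rest 4" using P4[OF p] .
  (* Some letter outside C occurs after one in C; as blocks of length 1 stay inside C, the walk leaves C across a
     block of length 2. *)
  have leave: "\<exists>i\<ge>1. w i \<noteq> a \<and> w i \<in> C \<and> w (i + 2) = a \<and> w (i + 3) \<noteq> a \<and> w (i + 3) \<notin> C"
  proof (rule ccontr)
    assume no: "\<not> ?thesis"
    obtain q where q: "1 \<le> q" "w q = w p" using letter_recurs[of 1 p] by blast
    have step: "w k = a \<or> w k \<in> C" if "q \<le> k" for k
      using that
    proof (induction k rule: less_induct)
      case (less k)
      have e0: "w (q + 1) = a" using star[of q] q p by simp
      show ?case
      proof (cases "w k = a \<or> k < q + 2")
        case True
        then have "w k = a \<or> k = q \<or> k = q + 1" using less.prems by linarith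
        then show ?thesis using e0 q(2) by (auto simp: C_def)
      next
        case False
        define l where "l = k - 2"
        have l: "k = l + 2" "q \<le> l" using False by (auto simp: l_def)
        show ?thesis
        proof (cases "w l = a")
          case False
          then show ?thesis using C(2)[of l] l by auto
        next
          case True
          have l1: "w (l + 1) = a" using star[of "l + 1"] l False by (simp add: numeral_eq_Suc)
          have "l \<noteq> q" using True q p by auto
          define j where "j = l - 1"
          have j: "l = j + 1" "q \<le> j" using \<open>l \<noteq> q\<close> l by (auto simp: j_def)
          have jn: "w j \<noteq> a" using E1[of j] True l1 j by (simp add: numeral_eq_Suc)
          then have "w j \<in> C" using less.IH[of j] j l by auto
          moreover have "w (j + 2) = a" "w (j + 3) = w k" using l1 j l by (simp_all add: numeral_eq_Suc)
          moreover have "1 \<le> j" using j(2) q(1) by simp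
          ultimately show ?thesis using no jn by auto
        qed
      qed
    qed
    obtain u where u: "u \<in> range w" "u \<noteq> a" "u \<noteq> w p" "u \<noteq> w (p + 2)" using third_letter by blast
    obtain k where "q \<le> k" "w k = u" using u(1) letter_recurs[of q] by (metis rangeE)
    then show False using step[of k] u by (auto simp: C_def)
  qed
  then obtain c where c: "1 \<le> c" "w c \<noteq> a" "w c \<in> C" "w (c + 2) = a" "w (c + 3) \<noteq> a" "w (c + 3) \<notin> C"
    by blast
  define t r where "t = w c" and "r = w (c + 3)"
  obtain s where s: "{#w p, w (p + 2)#} = {#s, t#}" "s \<noteq> a"
  proof (cases "t = w p")
    case True then show thesis using that[of "w (p + 2)"] p by (simp add: add_mset_commute)
  next
    case False then show thesis using that[of "w p"] c(3) p by (auto simp: t_def C_def)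
  qed
  have t: "t \<noteq> a" "{#t#} \<in> rest 4" using after[of c] c by (simp_all add: t_def)
  have Cst: "C = {s, t}" using s(1) unfolding C_def pair_mset by auto
  have r: "r \<noteq> a" "r \<noteq> s" "r \<noteq> t" using c(5,6) unfolding Cst r_def by simp_all
  note E2 = E2[unfolded s(1)] and pair = pair[unfolded s(1)] and s = s(2)
  have tr: "{#t, r#} \<in> rest 4" using Q4[of c] c by (simp add: t_def r_def)
  have rw: "s \<in> range w" "t \<in> range w" "r \<in> range w"
  proof -
    have "s \<in> C" unfolding Cst by simp
    then show "s \<in> range w" unfolding C_def by auto
  qed (auto simp: t_def r_def)
  have out: "{#u#} \<in> rest 4" if "u \<in> range w" "u \<noteq> a" "u \<noteq> s" for u
    using outside[OF that(1,2)] that(3) t(2) by (cases "u = t") (auto simp: Cst)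
  (* If s were shown alone by a window of length 4, the single letters and the pair {s, t} would be everything, leaving
     no room for {t, r}. *)
  have ns: "{#s#} \<notin> rest 4"
  proof
    assume "{#s#} \<in> rest 4"
    then have all: "(\<lambda>u. {#u#}) ` (range w - {a}) \<subseteq> rest 4" using out by auto
    have "rest 4 = insert {#s, t#} ((\<lambda>u. {#u#}) ` (range w - {a}))"
    proof (rule rest_eq)
      have "{#s, t#} \<notin> (\<lambda>u. {#u#}) ` (range w - {a})" by auto
      then show "card (insert {#s, t#} ((\<lambda>u. {#u#}) ` (range w - {a}))) = n"
        using card_others n4 by (simp add: card_singles)
    qed (use all pair in auto)
    then show False using tr r by (auto simp: pair_mset)
  qed
  have st: "s \<noteq> t" using ns t(2) by auto
  have R4: "rest 4 = insert {#s, t#} (insert {#t, r#} ((\<lambda>u. {#u#}) ` (range w - {a, s})))"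
  proof (rule rest_eq)
    have "{#s, t#} \<notin> insert {#t, r#} ((\<lambda>u. {#u#}) ` (range w - {a, s}))" "{#t, r#} \<notin> (\<lambda>u. {#u#}) ` (range w - {a, s})"
      using r by (auto simp: pair_mset)
    moreover have "range w - {a, s} = range w - {a} - {s}" by auto
    then have "card (range w - {a, s}) = n - 2" using card_others rw(1) s by simp
    moreover have "finite (range w - {a, s})" using finite_range by simp
    ultimately show "card (insert {#s, t#} (insert {#t, r#} ((\<lambda>u. {#u#}) ` (range w - {a, s})))) = n"
      using n4 by (simp add: card_singles)
  qed (use out pair tr in auto)
  have P2: "{#u, v#} = {#s, t#} \<or> {#u, v#} = {#t, r#}" if "{#u, v#} \<in> rest 4" for u v
    using that unfolding R4 by auto
  have rng: "range w = {a, s, t, r}"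
  proof
    show "range w \<subseteq> {a, s, t, r}"
    proof
      fix u assume u: "u \<in> range w"
      then obtain i where i: "w i = u" by blast
      show "u \<in> {a, s, t, r}"
      proof (cases "u = a")
        case False
        then obtain v where "{#u, v#} \<in> rest 4" using next_pair[of i] i by blast
        then show ?thesis using P2[of u v] by (auto simp: pair_mset)
      qed simp
    qed
    show "{a, s, t, r} \<subseteq> range w" using rw ex_loop by auto
  qed
  have n_4: "n = 4" using card_range s t r st unfolding rng by (simp add: card_insert_if split: if_splits)
  have s_before: "w i = t" if "w (i + 2) = s" for i
    using before[of i] E2[of i] that s st ns by (auto simp: pair_mset)
  have s_after: "w (i + 2) = t" if "w i = s" "1 \<le> i" for i
    using after[of i] E2[of i] that s st ns by (auto simp: pair_mset)
  have r_before: "w i = a" if "w (i + 2) = r" for i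
    using E2[of i] that s r by (auto simp: pair_mset)
  have r_after: "w (i + 2) = a" if "w i = r" for i
    using E2[of i] that s r by (auto simp: pair_mset)
  have r_before3: "w i = t" if "w (i + 3) = r" for i
  proof -
    have 1: "w (i + 1) = a" using r_before[of "i + 1"] that by (simp add: numeral_eq_Suc)
    have 2: "w (i + 2) = a" using star[of "i + 2"] that r(1) by (simp add: numeral_eq_Suc)
    have "w i \<noteq> a" using E1[of i] 1 2 by simp
    then show ?thesis using P2[OF Q4[of i]] that r by (auto simp: pair_mset)
  qed
  obtain q where q: "3 \<le> q" "w q = s" using rw(1) letter_recurs[of 3] by (metis rangeE)
  obtain q' where q': "3 \<le> q'" "w q' = r" using rw(3) letter_recurs[of 3] by (metis rangeE)
  define l l' where "l = q - 3" and "l' = q' - 3"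
  have l: "w (l + 3) = s" "w (l' + 3) = r" using q q' by (simp_all add: l_def l'_def)
  have ls: "w (l + 1) = t" "w (l + 5) = t" "w l = a" "w (l + 2) = a" "w (l + 4) = a"
    using s_before[of "l + 1"] s_after[of "l + 3"] star[of l] star[of "l + 1"] star[of "l + 3"] l t(1) s by (auto simp: numeral_eq_Suc)
  have lr: "w l' = t" "w (l' + 1) = a" "w (l' + 2) = a" "w (l' + 4) = a" "w (l' + 5) = a"
    using r_before3[of l'] r_before[of "l' + 1"] r_after[of "l' + 3"] star[of "l' + 2"] star[of "l' + 3"] l r(1) by (auto simp: numeral_eq_Suc)
  (* These come from the factors t a s a t, a a r a a, t a a r a and a t a s a. *)
  have R5: "rest 5 = {{#t, s, t#}, {#r#}, {#t, r#}, {#t, s#}}"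
  proof (rule rest_eq)
    have "{#t, s, t#} \<in> rest 5" by (rule restI[of "l + 1"]) (use l ls s t in \<open>simp add: numeral_eq_Suc win_Suc_left\<close>)
    moreover have "{#t, s#} \<in> rest 5" by (rule restI[of l]) (use l ls s t in \<open>simp add: numeral_eq_Suc win_Suc_left\<close>)
    moreover have "{#t, r#} \<in> rest 5" by (rule restI[of l']) (use l lr r t in \<open>simp add: numeral_eq_Suc win_Suc_left\<close>)
    moreover have "{#r#} \<in> rest 5" by (rule restI[of "l' + 1"]) (use l lr r t in \<open>simp add: numeral_eq_Suc win_Suc_left\<close>)
    ultimately show "{{#t, s, t#}, {#r#}, {#t, r#}, {#t, s#}} \<subseteq> rest 5" by simp
    have "{#t, r#} \<noteq> {#t, s#}" using r by (simp add: pair_mset)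
    then show "card {{#t, s, t#}, {#r#}, {#t, r#}, {#t, s#}} = n" using n_4 by simp
  qed simp
  have D: "w (i + 4) = (if w (i + 3) \<noteq> a then a else if w (i + 2) = a then if w (i + 1) = t then r else t
     else if w (i + 2) = r then a else if w (i + 2) = s then t else if w i = a then s else a)" for i
  proof -
    have abc: "w k \<in> {a, s, t, r}" for k unfolding rng[symmetric] by blast
    consider "w (i + 3) \<noteq> a" | "w (i + 3) = a" "w (i + 2) = a" | "w (i + 3) = a" "w (i + 2) = r"
      | "w (i + 3) = a" "w (i + 2) = s" | "w (i + 3) = a" "w (i + 2) = t" using abc[of "i + 2"] by blast
    then show ?thesis
    proof cases
      case 1
      then show ?thesis using star[of "i + 3"] by (simp add: numeral_eq_Suc)
    next
      case 2
      have y: "w (i + 4) \<noteq> a" "w (i + 1) \<noteq> a" using E1[of "i + 2"] E1[of "i + 1"] 2 by (simp_all add: numeral_eq_Suc)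
      have "w (i + 4) \<noteq> s" using s_before[of "i + 2"] 2 t(1) by (auto simp: numeral_eq_Suc)
      moreover have "{#w (i + 1), w (i + 4)#} \<in> rest 4" using Q4[of "i + 1"] y by (simp add: numeral_eq_Suc)
      moreover have "w (i + 1) \<noteq> s" using s_after[of "i + 1"] 2 t(1) by (auto simp: numeral_eq_Suc)
      ultimately show ?thesis using P2[of "w (i + 1)" "w (i + 4)"] 2 r by (auto simp: pair_mset)
    next
      case 3
      have "w (i + 4) = a" using r_after[of "i + 2"] 3 by (simp add: numeral_eq_Suc)
      then show ?thesis using 3 r by simp
    next
      case 4
      have "w (i + 4) = t" using s_after[of "i + 2"] 4 by (simp add: numeral_eq_Suc)
      then show ?thesis using 4 s r by simp
    next
      case 5
      have i1: "w (i + 1) = a" using star[of "i + 1"] 5 t(1) by (simp add: numeral_eq_Suc)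
      have u: "w i = a \<or> w i = s" using E2[of i] 5 t(1) s st by (auto simp: pair_mset)
      have v: "w (i + 4) = a \<or> w (i + 4) = s" using E2[of "i + 2"] 5 t(1) s st by (auto simp: pair_mset numeral_eq_Suc)
      have "\<not> (w i = a \<and> w (i + 4) = a)"
      proof
        assume "w i = a \<and> w (i + 4) = a"
        then have "{#t#} \<in> rest 5" using i1 5 t(1) by (intro restI[of i]) (simp add: numeral_eq_Suc win_Suc_left)
        then show False using R5 r by auto
      qed
      moreover have "\<not> (w i = s \<and> w (i + 4) = s)"
      proof
        assume "w i = s \<and> w (i + 4) = s"
        then have "{#s, t, s#} \<in> rest 5" using i1 5 t(1) s by (intro restI[of i]) (simp add: numeral_eq_Suc win_Suc_left)
        then show False using R5 r st by (auto simp: pair_mset triple_mset)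
      qed
      ultimately show ?thesis using u v 5 t(1) r st by auto
    qed
  qed
  obtain i j where ij: "\<forall>l<4. w (i + l) = w (j + l)" "w (i + 4) \<noteq> w (j + 4)" using branching[of 0 4] by blast
  have e: "w i = w j" "w (i + 1) = w (j + 1)" "w (i + 2) = w (j + 2)" "w (i + 3) = w (j + 3)"
    using ij(1)[rule_format, of 0] ij(1)[rule_format, of 1] ij(1)[rule_format, of 2] ij(1)[rule_format, of 3] by simp_all
  have "w (i + 4) = w (j + 4)" unfolding D[of i] D[of j] e by (rule refl)
  then show False using ij(2) by simp
qed

end

section \<open>The theorem\<close>

lemma (in const_word) const_word_impossible: False
proof (cases "\<exists>i. w i = w (i + 1)")
  case True
  then obtain i where "w i = w (i + 1)" by blast
  then have "\<exists>j. w j = w i \<and> w (j + 1) = w i" by metis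
  then interpret loop_word w n "w i" by unfold_locales
  show False by (rule star_impossible)
next
  case False
  then interpret loopless_word w n by unfold_locales simp
  show False by (rule loopless_impossible)
qed

theorem theorem1:
  fixes n :: nat and \<Sigma> :: "'a set"
  assumes "n \<ge> 4" and "finite \<Sigma>" and "card \<Sigma> = n"
  shows "\<not> (\<exists>w :: nat \<Rightarrow> 'a. range w \<subseteq> \<Sigma> \<and> recurrent w \<and>
            (\<forall>m\<ge>1. card (abelian_factors w m) = n))"
proof
  assume "\<exists>w :: nat \<Rightarrow> 'a. range w \<subseteq> \<Sigma> \<and> recurrent w \<and> (\<forall>m\<ge>1. card (abelian_factors w m) = n)"
  then obtain w :: "nat \<Rightarrow> 'a" where w: "recurrent w" "\<And>m. 1 \<le> m \<Longrightarrow> card (abelian_factors w m) = n" by blast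
  interpret const_word w n
    by unfold_locales (use w assms(1) in \<open>simp_all add: card_abelian_factors\<close>)
  show False by (rule const_word_impossible)
qed

end
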